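(* Assume the standing setting and condition (C) described in the context. Let $t\in[0,T]$ be a constant, $\sigma$ a $[t,T]$-valued $\mathbb{F}$-stopping time, $\chi$ a nonnegative $\mathfrak{F}_\sigma$-measurable random variable, $K$ a nonnegative $\mathbb{F}$-predictable process, and $A$ an $\mathbb{F}$-optional nondecreasing process with $A_0=0$. Then, on the event $\{t<\tau\}$, $$\mathbb{E}_t[\chi 1_{\{\sigma<\tau\}}]=\mathbb{E}'_t\big[\chi e^{-(\Gamma_\sigma-\Gamma_t)}\big],$$ $$\mathbb{E}_t[K_\tau 1_{\{\tau\le T\}}]=\mathbb{E}'_t\Big[\int_t^T K_s e^{-(\Gamma_s-\Gamma_t)}\gamma_s\,ds\Big],$$ $$\mathbb{E}_t[A^{\tau-}_T-A^{\tau-}_t]=1_{\{t<\tau\}}\mathbb{E}'_t\Big[\int_t^T e^{-(\Gamma_s-\Gamma_t)}\,dA_s\Big].$$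
   Context: Standing setting: $(\Omega,\mathcal{A},\mathbb{Q})$ is a probability space, $\mathbb{G}=(\mathfrak{G}_t)_{t\ge0}$ a filtration satisfying the usual conditions, $\mathbb{F}=(\mathfrak{F}_t)_{t\ge0}$ a subfiltration of $\mathbb{G}$ satisfying the usual conditions, and $\tau$ a strictly positive (possibly infinite) $\mathbb{G}$-stopping time such that for every $t\ge0$ and $B\in\mathfrak{G}_t$ there is $B'\in\mathfrak{F}_t$ with $B\cap\{t<\tau\}=B'\cap\{t<\tau\}$. For a càdlàg process $X$ and random time $\theta$, $X^{\theta}=X1_{[0,\theta)}+X_\theta1_{[\theta,\infty)}$ and $X^{\theta-}=X1_{[0,\theta)}+X_{\theta-}1_{[\theta,\infty)}$, with $X_{0-}=X_0$. A constant $T>0$ is fixed. Condition (C): (a) $\tau$ has a $(\mathbb{G},\mathbb{Q})$ intensity, written $\gamma1_{(0,\tau]}$ for a nonnegative $\mathbb{F}$-predictable process $\gamma$, i.e. the $(\mathbb{G},\mathbb{Q})$ compensator of $1_{[\tau,\infty)}$ is $\int_0^{\cdot\wedge\tau}\gamma_s\,ds$; (b) the Azéma supermartingale $S_t=\mathbb{Q}(\tau>t\mid\mathfrak{F}_t)$ (the $\mathbb{F}$-optional projection of $1_{[0,\tau)}$) satisfies $S_T>0$ a.s.; (c) there exists a probability measure $\mathbb{P}$ equivalent to $\mathbb{Q}$ on $\mathfrak{F}_T$ such that for every $(\mathbb{F},\mathbb{P})$ local martingale $P$, the process $P^{\tau-}$ is a $(\mathbb{G},\mathbb{Q})$ local martingale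 on $[0,T]$. Write $\Gamma_t=\int_0^t\gamma_s\,ds$. $\mathbb{E}_t$ denotes conditional expectation given $\mathfrak{G}_t$ under $\mathbb{Q}$ and $\mathbb{E}'_t$ conditional expectation given $\mathfrak{F}_t$ under $\mathbb{P}$. *)

theory Defs
  imports "HOL-Probability.Probability"
begin

definition filtration_on :: "'a measure \<Rightarrow> (real \<Rightarrow> 'a measure) \<Rightarrow> bool" where
  "filtration_on M F \<longleftrightarrow> (\<forall>t\<ge>0. subalgebra M (F t)) \<and>
     (\<forall>s t. 0 \<le> s \<longrightarrow> s \<le> t \<longrightarrow> sets (F s) \<subseteq> sets (F t))"

definition usual_conditions :: "'a measure \<Rightarrow> (real \<Rightarrow> 'a measure) \<Rightarrow> bool" where
  "usual_conditions M F \<longleftrightarrow> filtration_on M F \<and>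
     (\<forall>t\<ge>0. sets (F t) = (\<Inter>s\<in>{t<..}. sets (F s))) \<and>
     (\<forall>N. N \<subseteq> space M \<longrightarrow> (\<exists>N'\<in>null_sets M. N \<subseteq> N') \<longrightarrow> N \<in> sets (F 0))"

definition stopping_time_on :: "(real \<Rightarrow> 'a measure) \<Rightarrow> ('a \<Rightarrow> ereal) \<Rightarrow> bool" where
  "stopping_time_on F \<rho> \<longleftrightarrow> (\<forall>\<omega>\<in>space (F 0). 0 \<le> \<rho> \<omega>) \<and>
     (\<forall>t\<ge>0. {\<omega>\<in>space (F t). \<rho> \<omega> \<le> ereal t} \<in> sets (F t))"

definition stopped_sigma :: "'a measure \<Rightarrow> (real \<Rightarrow> 'a measure) \<Rightarrow> ('a \<Rightarrow> ereal) \<Rightarrow> 'a measure" where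
  "stopped_sigma M F \<rho> = sigma (space M)
     {B. B \<in> sets M \<and> (\<forall>s\<ge>0. B \<inter> {\<omega>. \<rho> \<omega> \<le> ereal s} \<in> sets (F s))}"

definition adapted :: "(real \<Rightarrow> 'a measure) \<Rightarrow> (real \<Rightarrow> 'a \<Rightarrow> real) \<Rightarrow> bool" where
  "adapted F X \<longleftrightarrow> (\<forall>t\<ge>0. X t \<in> borel_measurable (F t))"

definition cadlag :: "'a measure \<Rightarrow> (real \<Rightarrow> 'a \<Rightarrow> real) \<Rightarrow> bool" where
  "cadlag M X \<longleftrightarrow> (\<forall>\<omega>\<in>space M.
     (\<forall>t\<ge>0. continuous (at_right t) (\<lambda>s. X s \<omega>)) \<and>
     (\<forall>t>0. \<exists>l. ((\<lambda>s. X s \<omega>) \<longlongrightarrow> l) (at_left t)))"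

definition predictable_sigma :: "'a measure \<Rightarrow> (real \<Rightarrow> 'a measure) \<Rightarrow> (real \<times> 'a) measure" where
  "predictable_sigma M F = sigma ({0..} \<times> space M)
     ({{0} \<times> B | B. B \<in> sets (F 0)} \<union>
      {{s<..t} \<times> B | s t B. 0 \<le> s \<and> s \<le> t \<and> B \<in> sets (F s)})"

definition predictable :: "'a measure \<Rightarrow> (real \<Rightarrow> 'a measure) \<Rightarrow> (real \<Rightarrow> 'a \<Rightarrow> real) \<Rightarrow> bool" where
  "predictable M F X \<longleftrightarrow> (\<lambda>(t, \<omega>). X t \<omega>) \<in> borel_measurable (predictable_sigma M F)"

definition optional_sigma :: "'a measure \<Rightarrow> (real \<Rightarrow> 'a measure) \<Rightarrow> (real \<times> 'a) measure" where
  "optional_sigma M F = sigma ({0..} \<times> space M)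
     {{(s, \<omega>). 0 \<le> s \<and> \<omega> \<in> space M \<and> \<rho> \<omega> \<le> ereal s} | \<rho>. stopping_time_on F \<rho>}"

definition optional :: "'a measure \<Rightarrow> (real \<Rightarrow> 'a measure) \<Rightarrow> (real \<Rightarrow> 'a \<Rightarrow> real) \<Rightarrow> bool" where
  "optional M F X \<longleftrightarrow> (\<lambda>(t, \<omega>). X t \<omega>) \<in> borel_measurable (optional_sigma M F)"

definition martingale :: "'a measure \<Rightarrow> (real \<Rightarrow> 'a measure) \<Rightarrow> (real \<Rightarrow> 'a \<Rightarrow> real) \<Rightarrow> bool" where
  "martingale M F X \<longleftrightarrow> adapted F X \<and> (\<forall>t\<ge>0. integrable M (X t)) \<and>
     (\<forall>s t. 0 \<le> s \<longrightarrow> s \<le> t \<longrightarrow> (AE \<omega> in M. real_cond_exp M (F s) (X t) \<omega> = X s \<omega>))"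

definition stopped :: "(real \<Rightarrow> 'a \<Rightarrow> real) \<Rightarrow> ('a \<Rightarrow> ereal) \<Rightarrow> real \<Rightarrow> 'a \<Rightarrow> real" where
  "stopped X \<theta> = (\<lambda>t \<omega>. if ereal t < \<theta> \<omega> then X t \<omega> else X (real_of_ereal (\<theta> \<omega>)) \<omega>)"

definition stopped_left :: "(real \<Rightarrow> 'a \<Rightarrow> real) \<Rightarrow> ('a \<Rightarrow> ereal) \<Rightarrow> real \<Rightarrow> 'a \<Rightarrow> real" where
  "stopped_left X \<theta> = (\<lambda>t \<omega>. if ereal t < \<theta> \<omega> then X t \<omega>
     else if \<theta> \<omega> = 0 then X 0 \<omega>
     else Lim (at_left (real_of_ereal (\<theta> \<omega>))) (\<lambda>s. X s \<omega>))"

definition local_martingale :: "'a measure \<Rightarrow> (real \<Rightarrow> 'a measure) \<Rightarrow> (real \<Rightarrow> 'a \<Rightarrow> real) \<Rightarrow> bool" where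
  "local_martingale M F X \<longleftrightarrow> adapted F X \<and> cadlag M X \<and>
     (\<exists>\<rho> :: nat \<Rightarrow> 'a \<Rightarrow> ereal. (\<forall>n. stopping_time_on F (\<rho> n)) \<and>
        (\<forall>n. \<forall>\<omega>\<in>space M. \<rho> n \<omega> \<le> \<rho> (Suc n) \<omega>) \<and>
        (AE \<omega> in M. \<forall>c::real. \<exists>n. ereal c \<le> \<rho> n \<omega>) \<and>
        (\<forall>n. martingale M F (stopped X (\<rho> n))))"

definition local_martingale_upto :: "'a measure \<Rightarrow> (real \<Rightarrow> 'a measure) \<Rightarrow> (real \<Rightarrow> 'a \<Rightarrow> real) \<Rightarrow> real \<Rightarrow> bool" where
  "local_martingale_upto M F X T \<longleftrightarrow> local_martingale M F (\<lambda>t \<omega>. X (min t T) \<omega>)"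

text \<open>tau has (G,Q)-intensity gamma 1_{(0,tau]}: the compensator of 1_{[tau,\<infinity>)} is
  int_0^{t\<and>tau} gamma_s ds, i.e. this (finite, continuous, adapted) process makes
  1_{[tau,\<infinity>)} minus it a local martingale.\<close>
definition has_intensity :: "'a measure \<Rightarrow> (real \<Rightarrow> 'a measure) \<Rightarrow> ('a \<Rightarrow> ereal) \<Rightarrow> (real \<Rightarrow> 'a \<Rightarrow> real) \<Rightarrow> bool" where
  "has_intensity M G \<tau> \<gamma> \<longleftrightarrow>
     (AE \<omega> in M. \<forall>t\<ge>0. (\<integral>\<^sup>+ s\<in>{0<..t}. ennreal (\<gamma> s \<omega> * indicator {s. ereal s \<le> \<tau> \<omega>} s) \<partial>lborel) < \<infinity>) \<and>
     local_martingale M G (\<lambda>t \<omega>. indicator {\<omega>. \<tau> \<omega> \<le> ereal t} \<omega>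
        - enn2real (\<integral>\<^sup>+ s\<in>{0<..t}. ennreal (\<gamma> s \<omega> * indicator {s. ereal s \<le> \<tau> \<omega>} s) \<partial>lborel))"

definition Gamma_diff :: "(real \<Rightarrow> 'a \<Rightarrow> real) \<Rightarrow> real \<Rightarrow> real \<Rightarrow> 'a \<Rightarrow> ennreal" where
  "Gamma_diff \<gamma> a b \<omega> = (\<integral>\<^sup>+ s\<in>{a<..b}. ennreal (\<gamma> s \<omega>) \<partial>lborel)"

definition expneg :: "ennreal \<Rightarrow> ennreal" where
  "expneg x = (if x = \<infinity> then 0 else ennreal (exp (- enn2real x)))"

end

theory Submission
  imports Defs
begin

text \<open>
  Take a bounded \<open>F\<close>-martingale \<open>X\<close> under \<open>P\<close> with terminal value \<open>\<xi> e\<^sup>-\<^sup>\<Gamma>\<close> at time \<open>s\<close>.  By condition (C), \<open>X\<close> stopped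
  just before \<open>\<tau>\<close> is a \<open>G\<close>-martingale under \<open>Q\<close>; removing its values after \<open>\<tau>\<close> leaves \<open>1\<^bsub>{u < \<tau>}\<^esub> X\<^sub>u\<close>, whose drift is
  \<open>- \<gamma>\<^sub>u 1\<^bsub>{u < \<tau>}\<^esub> X\<^sub>u\<close> because \<open>\<gamma>\<close> is the intensity of \<open>\<tau>\<close>.  Hence \<open>1\<^bsub>{u < \<tau>}\<^esub> X\<^sub>u e\<^sup>\<Gamma>\<close> is a martingale, which is the first
  formula for a deterministic date and a payoff \<open>\<xi>\<close> known at \<open>s\<close>.  The payment at \<open>\<tau>\<close> follows by integrating this
  over \<open>s\<close> against the compensator, while stopping times and increasing processes are reached from dyadic dates by
  monotone convergence.

  Condition (C) only speaks about cadlag processes, so the conditional expectations have to be regularized.  The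
  number of oscillations of size \<open>\<epsilon>\<close> of a bounded martingale along a finite grid has expectation at most
  \<open>E X\<^sup>2 / \<epsilon>\<^sup>2\<close>, by orthogonality of increments, which replaces the upcrossing inequality.
\<close>

section \<open>Oscillations of paths along the dyadic rationals\<close>

text \<open>No stochastic calculus is available: each martingale statement is used as an equality of
  nonnegative integrals over events, and products and compensators are handled by Fubini. Integrals
  over events of F_t suffice because on {t < \<tau>} every event of G_t coincides with one of F_t.
  They pass from Q to P through a density, on F_t, of Q restricted to {t < \<tau>}; as P and Q are
  equivalent only on F_T, exceptional sets moved between them have to lie in F_T.

  Two obstacles shape the route. The intensity is a priori integrable only up to \<tau>; positivity
  of the Azema supermartingale at T is what makes \<Gamma>_T finite almost surely. And integrals in
  \<open>ennreal\<close> cancel only when finite, so payoffs are cut to be bounded and to vanish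
  where \<Gamma> exceeds a constant c. This keeps e^\<Gamma> below e^c wherever it meets a nonzero
  factor, and monotone convergence removes the cut.

  Payment dates are rounded up, never down: as the grid refines, the survival indicators and the
  discount factors then both increase, so the limits need no domination.\<close>

fun anchor :: "real \<Rightarrow> (nat \<Rightarrow> real) \<Rightarrow> nat \<Rightarrow> real" where
  "anchor \<epsilon> x 0 = x 0"
| "anchor \<epsilon> x (Suc k) = (if \<bar>x (Suc k) - anchor \<epsilon> x k\<bar> \<ge> \<epsilon> then x (Suc k) else anchor \<epsilon> x k)"

text \<open>The anchor is the value at the last index where the sequence had moved by at least
  \<epsilon> from the previous anchor, and the count is the number of such moves. In contrast to
  upcrossings, no interval of levels is fixed, so one count controls all oscillations of size
  2\<epsilon>.\<close>

fun osc_count :: "real \<Rightarrow> (nat \<Rightarrow> real) \<Rightarrow> nat \<Rightarrow> nat" where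
  "osc_count \<epsilon> x 0 = 0"
| "osc_count \<epsilon> x (Suc k) = (if \<bar>x (Suc k) - anchor \<epsilon> x k\<bar> \<ge> \<epsilon> then Suc (osc_count \<epsilon> x k) else osc_count \<epsilon> x k)"

lemma anchor_bounded: "(\<And>k. a \<le> x k \<and> x k \<le> b) \<Longrightarrow> a \<le> anchor \<epsilon> x n \<and> anchor \<epsilon> x n \<le> b"
  by (induction n) auto

lemma anchor_close: "0 < \<epsilon> \<Longrightarrow> \<bar>x n - anchor \<epsilon> x n\<bar> < \<epsilon>"
  by (cases n) auto

lemma osc_count_mono: "m \<le> n \<Longrightarrow> osc_count \<epsilon> x m \<le> osc_count \<epsilon> x n"
  by (induction rule: dec_induct) auto

lemma anchor_const_if_osc_count_eq:
  assumes "p \<le> q" "osc_count \<epsilon> x q = osc_count \<epsilon> x p"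
  shows "anchor \<epsilon> x q = anchor \<epsilon> x p"
  using assms
proof (induction rule: dec_induct)
  case (step k)
  have "osc_count \<epsilon> x p \<le> osc_count \<epsilon> x k" using step by (intro osc_count_mono) auto
  then show ?case using step by (auto split: if_splits)
qed auto

text \<open>If the count did not change between p and q, the anchor would not change either, and
  both \<open>x p\<close> and \<open>x q\<close> would lie within \<epsilon> of it. This is the
  origin of the factor 2 in \<open>osc_chain\<close>.\<close>

lemma osc_count_increases:
  assumes "0 < \<epsilon>" "p < q" "2 * \<epsilon> \<le> \<bar>x p - x q\<bar>"
  shows "Suc (osc_count \<epsilon> x p) \<le> osc_count \<epsilon> x q"
proof (rule ccontr)
  assume "\<not> ?thesis"
  then have "osc_count \<epsilon> x q = osc_count \<epsilon> x p"
    using osc_count_mono[of p q \<epsilon> x] assms by auto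
  then have "anchor \<epsilon> x q = anchor \<epsilon> x p" using assms anchor_const_if_osc_count_eq by auto
  then show False using anchor_close[OF assms(1), of x p] anchor_close[OF assms(1), of x q] assms(3)
    by auto
qed

text \<open>A chain consists of successive pairs of times in D, which may share endpoints but do not
  overlap. It is not tied to any grid, so it describes the limit of all grids, while
  \<open>osc_count\<close> describes a single one.\<close>

fun osc_chain :: "real \<Rightarrow> real set \<Rightarrow> (real \<Rightarrow> real) \<Rightarrow> nat \<Rightarrow> real \<Rightarrow> real \<Rightarrow> bool" where
  "osc_chain \<epsilon> D f 0 lo hi \<longleftrightarrow> lo \<le> hi"
| "osc_chain \<epsilon> D f (Suc n) lo hi \<longleftrightarrow>
     (\<exists>a\<in>D. \<exists>b\<in>D. lo \<le> a \<and> a < b \<and> 2 * \<epsilon> \<le> \<bar>f a - f b\<bar> \<and> osc_chain \<epsilon> D f n b hi)"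

lemma osc_chain_le: "osc_chain \<epsilon> D f n lo hi \<Longrightarrow> lo \<le> hi"
  by (induction n arbitrary: lo) force+

lemma osc_chain_append:
  assumes "osc_chain \<epsilon> D f n lo hi" "hi \<le> a" "a < b" "b \<le> hi'" "a \<in> D" "b \<in> D" "2 * \<epsilon> \<le> \<bar>f a - f b\<bar>"
  shows "osc_chain \<epsilon> D f (Suc n) lo hi'"
  using assms(1)
proof (induction n arbitrary: lo)
  case 0
  then have "lo \<le> a" using assms by auto
  then show ?case using assms(3-) unfolding osc_chain.simps by blast
next
  case (Suc n)
  then obtain a' b' where *: "a'\<in>D" "b'\<in>D" "lo \<le> a'" "a' < b'" "2 * \<epsilon> \<le> \<bar>f a' - f b'\<bar>" "osc_chain \<epsilon> D f n b' hi"
    by auto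
  show ?case by (subst osc_chain.simps(2), rule bexI[OF _ *(1)], rule bexI[OF _ *(2)]) (use * Suc in blast)
qed

section \<open>Nonnegative dyadic rationals as sampling times\<close>

definition dyadic_reals :: "real set" where
  "dyadic_reals = {real k / 2 ^ n | k n. True}"

text \<open>Floor plus one instead of the ceiling: the result is strictly larger than t even when t
  is dyadic, because a right limit at t must not see the value at t.\<close>

definition dyadic_above :: "nat \<Rightarrow> real \<Rightarrow> real" where
  "dyadic_above n t = real (Suc (nat \<lfloor>2 ^ n * t\<rfloor>)) / 2 ^ n"

lemma dyadic_above_in: "dyadic_above n t \<in> dyadic_reals"
  unfolding dyadic_above_def dyadic_reals_def by blast

lemma dyadic_above_bounds:
  assumes "0 \<le> t"
  shows "t < dyadic_above n t" "dyadic_above n t \<le> t + 1 / 2 ^ n"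
proof -
  have "0 \<le> 2 ^ n * t" using assms by auto
  then have "real (nat \<lfloor>2 ^ n * t\<rfloor>) = of_int \<lfloor>2 ^ n * t\<rfloor>" by auto
  then have "2 ^ n * t < real (Suc (nat \<lfloor>2 ^ n * t\<rfloor>))" "real (Suc (nat \<lfloor>2 ^ n * t\<rfloor>)) \<le> 2 ^ n * t + 1"
    by linarith+
  then show "t < dyadic_above n t" "dyadic_above n t \<le> t + 1 / 2 ^ n"
    unfolding dyadic_above_def by (auto simp: field_simps)
qed

lemma dyadic_above_tendsto:
  assumes "0 \<le> t"
  shows "filterlim (\<lambda>n. dyadic_above n t) (at t within (dyadic_reals \<inter> {t<..})) sequentially"
  unfolding filterlim_at
proof
  show "\<forall>\<^sub>F n in sequentially. dyadic_above n t \<in> dyadic_reals \<inter> {t<..} \<and> dyadic_above n t \<noteq> t"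
    using dyadic_above_bounds(1)[OF assms] dyadic_above_in by (intro always_eventually) (simp add: less_imp_neq[symmetric])
  have lim: "(\<lambda>n. t + 1 / 2 ^ n) \<longlonglongrightarrow> t"
    using tendsto_add[OF tendsto_const LIMSEQ_inverse_realpow_zero[of 2], of t] by (simp add: inverse_eq_divide)
  have lower: "\<forall>\<^sub>F n in sequentially. t \<le> dyadic_above n t"
    by (rule always_eventually, rule allI, rule less_imp_le, rule dyadic_above_bounds(1)[OF assms])
  have upper: "\<forall>\<^sub>F n in sequentially. dyadic_above n t \<le> t + 1 / 2 ^ n"
    by (rule always_eventually, rule allI, rule dyadic_above_bounds(2)[OF assms])
  show "(\<lambda>n. dyadic_above n t) \<longlonglongrightarrow> t"
    by (rule tendsto_sandwich[OF lower upper tendsto_const lim])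
qed

lemma dyadic_reals_dense:
  assumes "0 \<le> s" "s < t"
  shows "\<exists>d\<in>dyadic_reals. s < d \<and> d < t"
proof -
  have "(\<lambda>n. dyadic_above n s) \<longlonglongrightarrow> s" using dyadic_above_tendsto[OF assms(1)] unfolding filterlim_at by auto
  then have "\<forall>\<^sub>F n in sequentially. dyadic_above n s < t" using assms(2) by (rule order_tendstoD)
  then obtain n where "dyadic_above n s < t" by (meson eventually_sequentially order_refl)
  then show ?thesis using dyadic_above_in dyadic_above_bounds[OF assms(1)] by blast
qed

text \<open>By \<open>osc_count_increases\<close> each link raises the count by at least one between
  its two endpoints. The start i is left general so that the induction can peel off the first link
  and restart at its right endpoint; the last assumption places all points of D up to N on the grid
  of level n.\<close>

lemma osc_chain_le_count:
  assumes "0 < \<epsilon>" "osc_chain \<epsilon> D f m (real i / 2 ^ n) (real N)"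
    and "\<And>d. d \<in> D \<Longrightarrow> d \<le> real N \<Longrightarrow> \<exists>k. d = real k / 2 ^ n"
  shows "osc_count \<epsilon> (\<lambda>k. f (real k / 2 ^ n)) i + m \<le> osc_count \<epsilon> (\<lambda>k. f (real k / 2 ^ n)) (N * 2 ^ n)"
  using assms(2)
proof (induction m arbitrary: i)
  case 0
  then have "real i \<le> real (N * 2 ^ n)" by (simp add: field_simps)
  then have "i \<le> N * 2 ^ n" by (simp only: of_nat_le_iff)
  then show ?case using osc_count_mono by auto
next
  case (Suc m)
  then obtain a b where *: "a\<in>D" "b\<in>D" "real i / 2 ^ n \<le> a" "a < b" "2 * \<epsilon> \<le> \<bar>f a - f b\<bar>" "osc_chain \<epsilon> D f m b (real N)"
    by auto
  have "b \<le> real N" using *(6) osc_chain_le by auto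
  then obtain p q where pq: "a = real p / 2 ^ n" "b = real q / 2 ^ n" using assms(3)[of a] assms(3)[of b] * by auto
  have ip: "i \<le> p" using *(3) unfolding pq by (simp add: divide_le_cancel)
  have lt: "p < q" using *(4) unfolding pq by (simp add: divide_less_cancel)
  have osc: "2 * \<epsilon> \<le> \<bar>f (real p / 2 ^ n) - f (real q / 2 ^ n)\<bar>" using *(5) unfolding pq .
  have "osc_count \<epsilon> (\<lambda>k. f (real k / 2 ^ n)) i \<le> osc_count \<epsilon> (\<lambda>k. f (real k / 2 ^ n)) p"
    by (intro osc_count_mono ip)
  moreover have "Suc (osc_count \<epsilon> (\<lambda>k. f (real k / 2 ^ n)) p) \<le> osc_count \<epsilon> (\<lambda>k. f (real k / 2 ^ n)) q"
    by (rule osc_count_increases[OF assms(1) lt osc])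
  moreover have "osc_count \<epsilon> (\<lambda>k. f (real k / 2 ^ n)) q + m \<le> osc_count \<epsilon> (\<lambda>k. f (real k / 2 ^ n)) (N * 2 ^ n)"
    using Suc.IH[of q] *(6) unfolding pq by blast
  ultimately show ?case by linarith
qed

lemma osc_chain_finite_subset:
  "osc_chain \<epsilon> D f n lo hi \<Longrightarrow> \<exists>D'. finite D' \<and> D' \<subseteq> D \<and> osc_chain \<epsilon> D' f n lo hi"
proof (induction n arbitrary: lo)
  case 0
  then show ?case by auto
next
  case (Suc n)
  then obtain a b where *: "a\<in>D" "b\<in>D" "lo \<le> a" "a < b" "2 * \<epsilon> \<le> \<bar>f a - f b\<bar>" "osc_chain \<epsilon> D f n b hi"
    by auto
  from Suc.IH[OF *(6)] obtain D' where D': "finite D'" "D' \<subseteq> D" "osc_chain \<epsilon> D' f n b hi" by auto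
  have mono: "osc_chain \<epsilon> A f m l h \<Longrightarrow> A \<subseteq> B \<Longrightarrow> osc_chain \<epsilon> B f m l h" for A B m l h
  proof (induction m arbitrary: l)
    case (Suc m)
    then obtain a b where *: "a\<in>A" "b\<in>A" "l \<le> a" "a < b" "2 * \<epsilon> \<le> \<bar>f a - f b\<bar>" "osc_chain \<epsilon> A f m b h"
      by auto
    show ?case by (subst osc_chain.simps(2), rule bexI[of _ a], rule bexI[of _ b]) (use * Suc in auto)
  qed auto
  have "osc_chain \<epsilon> (insert a (insert b D')) f (Suc n) lo hi"
    using *(3,4,5) mono[OF D'(3), of "insert a (insert b D')"]
    by (subst osc_chain.simps(2)) blast
  then show ?case using D' * by (intro exI[of _ "insert a (insert b D')"]) auto
qed

lemma dyadic_reals_eventually_level: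
  assumes "d \<in> dyadic_reals"
  shows "\<forall>\<^sub>F n in sequentially. \<exists>k. d = real k / 2 ^ n"
proof -
  obtain k m where d: "d = real k / 2 ^ m" using assms by (auto simp: dyadic_reals_def)
  have "\<exists>k. d = real k / 2 ^ n" if "m \<le> n" for n
  proof -
    have "(2::real) ^ n = 2 ^ m * 2 ^ (n - m)" using that by (simp add: power_add[symmetric])
    then show ?thesis by (intro exI[of _ "k * 2 ^ (n - m)"]) (simp add: d)
  qed
  then show ?thesis by (auto simp: eventually_sequentially)
qed

text \<open>A finite liminf suffices because a chain with finitely many links lies in every sufficiently
  fine dyadic grid.\<close>
lemma osc_chain_length_bounded:
  assumes "0 < \<epsilon>"
    and "liminf (\<lambda>n. ennreal (real (osc_count \<epsilon> (\<lambda>k. f (real k / 2 ^ n)) (N * 2 ^ n)))) < \<infinity>"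
  shows "\<exists>C. \<forall>m. osc_chain \<epsilon> dyadic_reals f m 0 (real N) \<longrightarrow> m \<le> C"
proof -
  let ?c = "\<lambda>n. osc_count \<epsilon> (\<lambda>k. f (real k / 2 ^ n)) (N * 2 ^ n)"
  define L where "L = liminf (\<lambda>n. ennreal (real (?c n)))"
  obtain C where C: "L < of_nat C"
    using assms(2) unfolding L_def[symmetric] by (metis ennreal_Ex_less_of_nat infinity_ennreal_def)
  \<comment> \<open>A finite liminf bounds the count at infinitely many levels only, not at all late
    ones; the level used below is chosen among these, beyond the level that contains the whole
    chain.\<close>
  have C': "\<exists>\<^sub>F n in sequentially. ?c n \<le> C"
  proof (rule ccontr)
    assume "\<not> ?thesis"
    then have "\<forall>\<^sub>F n in sequentially. of_nat C \<le> ennreal (real (?c n))"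
      unfolding frequently_def not_not
      by (rule eventually_mono) (simp add: ennreal_of_nat_eq_real_of_nat)
    then have "of_nat C \<le> L" unfolding L_def by (rule Liminf_bounded)
    then show False using C by simp
  qed
  have "m \<le> C" if "osc_chain \<epsilon> dyadic_reals f m 0 (real N)" for m
  proof -
    from osc_chain_finite_subset[OF that] obtain D where
      D: "finite D" "D \<subseteq> dyadic_reals" "osc_chain \<epsilon> D f m 0 (real N)" by auto
    have "\<forall>\<^sub>F n in sequentially. \<forall>d\<in>D. \<exists>k. d = real k / 2 ^ n"
      using D dyadic_reals_eventually_level by (intro eventually_ball_finite) auto
    then obtain n0 where n0: "\<And>n. n0 \<le> n \<Longrightarrow> \<forall>d\<in>D. \<exists>k. d = real k / 2 ^ n"
      unfolding eventually_sequentially by blast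
    have "\<exists>n\<ge>n0. ?c n \<le> C"
      using C' unfolding frequently_def eventually_sequentially by blast
    then obtain n where n: "n0 \<le> n" "?c n \<le> C" by blast
    have "osc_count \<epsilon> (\<lambda>k. f (real k / 2 ^ n)) 0 + m \<le> ?c n"
    proof (rule osc_chain_le_count[OF assms(1)])
      show "osc_chain \<epsilon> D f m (real 0 / 2 ^ n) (real N)" using D(3) by simp
    qed (use n0[OF n(1)] in blast)
    then show ?thesis using n by simp
  qed
  then show ?thesis by blast
qed

lemma osc_chain_lower: "osc_chain \<epsilon> D f m lo hi \<Longrightarrow> lo' \<le> lo \<Longrightarrow> osc_chain \<epsilon> D f m lo' hi"
  by (cases m) (auto, meson order_trans)

lemma osc_chain_upper: "osc_chain \<epsilon> D f m lo hi \<Longrightarrow> hi \<le> hi' \<Longrightarrow> osc_chain \<epsilon> D f m lo hi'"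
proof (induction m arbitrary: lo)
  case (Suc m)
  then obtain a b where *: "a\<in>D" "b\<in>D" "lo \<le> a" "a < b" "2 * \<epsilon> \<le> \<bar>f a - f b\<bar>" "osc_chain \<epsilon> D f m b hi"
    by auto
  show ?case by (subst osc_chain.simps(2), rule bexI[of _ a], rule bexI[of _ b]) (use * Suc in auto)
qed auto

text \<open>A quantitative form of having one-sided limits along the dyadics. Unlike the existence
  of limits at uncountably many times, it follows from countably many conditions on finite grids and
  so can be verified almost surely.\<close>

definition regular_path :: "(real \<Rightarrow> real) \<Rightarrow> bool" where
  "regular_path f \<longleftrightarrow> (\<forall>\<epsilon>>0. \<forall>N. \<exists>C. \<forall>m. osc_chain \<epsilon> dyadic_reals f m 0 (real N) \<longrightarrow> m \<le> C)"

lemma tendsto_if_Cauchy_at_within: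
  fixes f :: "real \<Rightarrow> real"
  assumes "at t within S \<noteq> bot"
    and "\<And>e. 0 < e \<Longrightarrow> \<exists>d>0. \<forall>x\<in>S. \<forall>y\<in>S. x \<noteq> t \<longrightarrow> y \<noteq> t \<longrightarrow> \<bar>x - t\<bar> < d \<longrightarrow> \<bar>y - t\<bar> < d \<longrightarrow> \<bar>f x - f y\<bar> < e"
  shows "\<exists>l. (f \<longlongrightarrow> l) (at t within S)"
proof -
  have "cauchy_filter (filtermap f (at t within S))"
    unfolding cauchy_filter_metric_filtermap
  proof (intro allI impI)
    fix e :: real assume "0 < e"
    from assms(2)[OF this] obtain d where d: "d > 0"
      "\<forall>x\<in>S. \<forall>y\<in>S. x \<noteq> t \<longrightarrow> y \<noteq> t \<longrightarrow> \<bar>x - t\<bar> < d \<longrightarrow> \<bar>y - t\<bar> < d \<longrightarrow> \<bar>f x - f y\<bar> < e" by blast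
    have "eventually (\<lambda>x. x \<in> S \<and> x \<noteq> t \<and> \<bar>x - t\<bar> < d) (at t within S)"
      unfolding eventually_at using d(1) by (intro exI[of _ d]) (auto simp: dist_real_def)
    then show "\<exists>P. eventually P (at t within S) \<and> (\<forall>x y. P x \<and> P y \<longrightarrow> dist (f x) (f y) < e)"
      using d(2) unfolding dist_real_def by blast
  qed
  moreover have "filtermap f (at t within S) \<noteq> bot" using assms(1) by (simp add: filtermap_bot_iff)
  ultimately obtain l where "filtermap f (at t within S) \<le> nhds l"
    using cauchy_filter_complete_converges[of "filtermap f (at t within S)" UNIV] complete_UNIV by auto
  then show ?thesis unfolding filterlim_def by blast
qed

lemma at_within_dyadic_right_nontrivial:
  assumes "0 \<le> t" shows "at t within (dyadic_reals \<inter> {t<..}) \<noteq> bot"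
proof -
  have "\<exists>y\<in>dyadic_reals \<inter> {t<..}. y \<noteq> t \<and> dist y t < e" if "0 < e" for e
    using dyadic_reals_dense[of t "t + e"] assms that by (force simp: dist_real_def)
  then show ?thesis unfolding trivial_limit_within islimpt_approachable by blast
qed

lemma at_within_dyadic_left_nontrivial:
  assumes "0 < t" shows "at t within (dyadic_reals \<inter> {..<t}) \<noteq> bot"
proof -
  have "\<exists>y\<in>dyadic_reals \<inter> {..<t}. y \<noteq> t \<and> dist y t < e" if "0 < e" for e
    using dyadic_reals_dense[of "max 0 (t - e)" t] assms that by (force simp: dist_real_def)
  then show ?thesis unfolding trivial_limit_within islimpt_approachable by blast
qed

text \<open>If the Cauchy criterion failed on the right of t, pairs with oscillation at least e
  would exist arbitrarily close to t. They are stacked from right to left: each chain starts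
  strictly after t, which leaves room for one more pair in front of it. Chains of every length with
  \<epsilon> = e/2 contradict regularity.\<close>

lemma regular_path_right_limit:
  assumes "regular_path f" "0 \<le> t"
  shows "\<exists>l. (f \<longlongrightarrow> l) (at t within (dyadic_reals \<inter> {t<..}))"
proof (rule tendsto_if_Cauchy_at_within[OF at_within_dyadic_right_nontrivial[OF assms(2)]], rule ccontr)
  fix e :: real
  assume "0 < e" and no: "\<not> (\<exists>d>0. \<forall>x\<in>dyadic_reals \<inter> {t<..}. \<forall>y\<in>dyadic_reals \<inter> {t<..}. x \<noteq> t \<longrightarrow> y \<noteq> t \<longrightarrow>
      \<bar>x - t\<bar> < d \<longrightarrow> \<bar>y - t\<bar> < d \<longrightarrow> \<bar>f x - f y\<bar> < e)"
  have ex: "\<exists>x\<in>dyadic_reals. \<exists>y\<in>dyadic_reals. t < x \<and> x < y \<and> y < t + d \<and> e \<le> \<bar>f x - f y\<bar>" if "0 < d" for d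
  proof -
    have "\<not> (\<forall>x\<in>dyadic_reals \<inter> {t<..}. \<forall>y\<in>dyadic_reals \<inter> {t<..}. x \<noteq> t \<longrightarrow> y \<noteq> t \<longrightarrow>
      \<bar>x - t\<bar> < d \<longrightarrow> \<bar>y - t\<bar> < d \<longrightarrow> \<bar>f x - f y\<bar> < e)"
      using no that by blast
    then have "\<exists>x\<in>dyadic_reals \<inter> {t<..}. \<exists>y\<in>dyadic_reals \<inter> {t<..}. \<bar>x - t\<bar> < d \<and> \<bar>y - t\<bar> < d \<and> e \<le> \<bar>f x - f y\<bar>" by (meson not_less)
    then obtain x y where xy: "x \<in> dyadic_reals" "y \<in> dyadic_reals" "t < x" "t < y" "x < t + d" "y < t + d" "e \<le> \<bar>f x - f y\<bar>"
      by (force simp: abs_less_iff)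
    have "x \<noteq> y" using xy \<open>0 < e\<close> by auto
    then consider "x < y" | "y < x" by linarith
    then show ?thesis
    proof cases
      case 2
      then show ?thesis using xy by (intro bexI[of _ y] bexI[of _ x]) (auto simp: abs_minus_commute)
    qed (use xy in blast)
  qed
  obtain N :: nat where N: "t + 1 \<le> real N" using real_arch_simple by blast
  have chain: "\<exists>lo>t. osc_chain (e/2) dyadic_reals f m lo (real N)" for m
  proof (induction m)
    case 0
    then show ?case using N by (intro exI[of _ "t + 1"]) auto
  next
    case (Suc m)
    then obtain lo where lo: "lo > t" "osc_chain (e/2) dyadic_reals f m lo (real N)" by blast
    from ex[of "lo - t"] lo(1) obtain x y where xy: "x \<in> dyadic_reals" "y \<in> dyadic_reals" "t < x" "x < y" "y < lo" "e \<le> \<bar>f x - f y\<bar>"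
      by auto
    have "osc_chain (e/2) dyadic_reals f (Suc m) x (real N)"
      using xy osc_chain_lower[OF lo(2), of y] by (subst osc_chain.simps(2), intro bexI[of _ x] bexI[of _ y]) auto
    then show ?case using xy by blast
  qed
  have "0 < e/2" using \<open>0 < e\<close> by simp
  then obtain C where "\<And>m. osc_chain (e/2) dyadic_reals f m 0 (real N) \<Longrightarrow> m \<le> C"
    using assms(1) unfolding regular_path_def by blast
  moreover obtain lo where "lo > t" "osc_chain (e/2) dyadic_reals f (Suc C) lo (real N)" using chain by blast
  ultimately show False using osc_chain_lower[of "e/2" dyadic_reals f "Suc C" lo "real N" 0] assms(2) by fastforce
qed

text \<open>The mirror image of the argument on the right: chains now end strictly before t, and
  each new pair is appended between their end and t, which is why \<open>osc_chain_append\<close>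
  extends a chain at its far end.\<close>

lemma regular_path_left_limit:
  assumes "regular_path f" "0 < t"
  shows "\<exists>l. (f \<longlongrightarrow> l) (at t within (dyadic_reals \<inter> {..<t}))"
proof (rule tendsto_if_Cauchy_at_within[OF at_within_dyadic_left_nontrivial[OF assms(2)]], rule ccontr)
  fix e :: real
  assume "0 < e" and no: "\<not> (\<exists>d>0. \<forall>x\<in>dyadic_reals \<inter> {..<t}. \<forall>y\<in>dyadic_reals \<inter> {..<t}. x \<noteq> t \<longrightarrow> y \<noteq> t \<longrightarrow>
      \<bar>x - t\<bar> < d \<longrightarrow> \<bar>y - t\<bar> < d \<longrightarrow> \<bar>f x - f y\<bar> < e)"
  have ex: "\<exists>x\<in>dyadic_reals. \<exists>y\<in>dyadic_reals. t - d < x \<and> x < y \<and> y < t \<and> e \<le> \<bar>f x - f y\<bar>" if "0 < d" for d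
  proof -
    have "\<not> (\<forall>x\<in>dyadic_reals \<inter> {..<t}. \<forall>y\<in>dyadic_reals \<inter> {..<t}. x \<noteq> t \<longrightarrow> y \<noteq> t \<longrightarrow>
      \<bar>x - t\<bar> < d \<longrightarrow> \<bar>y - t\<bar> < d \<longrightarrow> \<bar>f x - f y\<bar> < e)"
      using no that by blast
    then have "\<exists>x\<in>dyadic_reals \<inter> {..<t}. \<exists>y\<in>dyadic_reals \<inter> {..<t}. \<bar>x - t\<bar> < d \<and> \<bar>y - t\<bar> < d \<and> e \<le> \<bar>f x - f y\<bar>" by (meson not_less)
    then obtain x y where xy: "x \<in> dyadic_reals" "y \<in> dyadic_reals" "x < t" "y < t" "t - d < x" "t - d < y" "e \<le> \<bar>f x - f y\<bar>"
      by (force simp: abs_less_iff)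
    have "x \<noteq> y" using xy \<open>0 < e\<close> by auto
    then consider "x < y" | "y < x" by linarith
    then show ?thesis
    proof cases
      case 2
      then show ?thesis using xy by (intro bexI[of _ y] bexI[of _ x]) (auto simp: abs_minus_commute)
    qed (use xy in blast)
  qed
  have chain: "\<exists>hi<t. osc_chain (e/2) dyadic_reals f m 0 hi" for m
  proof (induction m)
    case 0
    then show ?case using assms by (intro exI[of _ 0]) auto
  next
    case (Suc m)
    then obtain hi where hi: "hi < t" "osc_chain (e/2) dyadic_reals f m 0 hi" by blast
    from ex[of "t - hi"] hi(1) obtain x y where xy: "x \<in> dyadic_reals" "y \<in> dyadic_reals" "hi < x" "x < y" "y < t" "e \<le> \<bar>f x - f y\<bar>"
      by auto
    have "osc_chain (e/2) dyadic_reals f (Suc m) 0 y"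
      by (rule osc_chain_append[OF hi(2), of x y]) (use xy in auto)
    then show ?case using xy by blast
  qed
  obtain N :: nat where N: "t \<le> real N" using real_arch_simple by blast
  have "0 < e/2" using \<open>0 < e\<close> by simp
  then obtain C where C: "\<And>m. osc_chain (e/2) dyadic_reals f m 0 (real N) \<Longrightarrow> m \<le> C"
    using assms(1) unfolding regular_path_def by blast
  moreover obtain hi where "hi < t" "osc_chain (e/2) dyadic_reals f (Suc C) 0 hi" using chain by blast
  ultimately show False using osc_chain_upper[of "e/2" dyadic_reals f "Suc C" 0 hi "real N"] N by fastforce
qed

section \<open>Right-continuous regularization along the dyadics\<close>

definition dyadic_rlim :: "(real \<Rightarrow> real) \<Rightarrow> real \<Rightarrow> real" where
  "dyadic_rlim f t = Lim (at t within (dyadic_reals \<inter> {t<..})) f"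

lemma tendsto_dyadic_rlim:
  assumes "regular_path f" "0 \<le> t"
  shows "(f \<longlongrightarrow> dyadic_rlim f t) (at t within (dyadic_reals \<inter> {t<..}))"
  using regular_path_right_limit[OF assms] tendsto_Lim[OF at_within_dyadic_right_nontrivial[OF assms(2)]]
  unfolding dyadic_rlim_def by metis

lemma LIMSEQ_dyadic_rlim:
  assumes "regular_path f" "0 \<le> t"
  shows "(\<lambda>n. f (dyadic_above n t)) \<longlonglongrightarrow> dyadic_rlim f t"
  by (rule filterlim_compose[OF tendsto_dyadic_rlim[OF assms] dyadic_above_tendsto[OF assms(2)]])

text \<open>A closed bound on the dyadic values in (a, b) survives the right limit at every u in [a,
  b), since the dyadics just after u still lie in (a, b). Both right continuity and left limits of
  the regularization reduce to this.\<close>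

lemma dyadic_rlim_close:
  assumes "regular_path f" "0 \<le> u" "a \<le> u" "u < b"
    and "\<And>s. s \<in> dyadic_reals \<Longrightarrow> a < s \<Longrightarrow> s < b \<Longrightarrow> dist (f s) L \<le> e"
  shows "dist (dyadic_rlim f u) L \<le> e"
proof (rule tendsto_upperbound)
  show "((\<lambda>s. dist (f s) L) \<longlongrightarrow> dist (dyadic_rlim f u) L) (at u within (dyadic_reals \<inter> {u<..}))"
    by (intro tendsto_dist tendsto_dyadic_rlim assms tendsto_const)
  have "dist (f s) L \<le> e" if "s \<in> dyadic_reals \<inter> {u<..}" "dist s u < b - u" for s
    using that assms(3,4) by (intro assms(5)) (auto simp: dist_real_def)
  then show "\<forall>\<^sub>F s in at u within (dyadic_reals \<inter> {u<..}). dist (f s) L \<le> e"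
    unfolding eventually_at using assms(4) by (intro exI[of _ "b - u"]) auto
qed (rule at_within_dyadic_right_nontrivial[OF assms(2)])

lemma dyadic_rlim_bounds:
  assumes "regular_path f" "0 \<le> t" "\<And>s. a \<le> f s \<and> f s \<le> b"
  shows "a \<le> dyadic_rlim f t \<and> dyadic_rlim f t \<le> b"
  using LIMSEQ_le_const[OF LIMSEQ_dyadic_rlim[OF assms(1,2)]] LIMSEQ_le_const2[OF LIMSEQ_dyadic_rlim[OF assms(1,2)]] assms(3)
  by blast

lemma dyadic_rlim_right_continuous:
  assumes "regular_path f" "0 \<le> t"
  shows "continuous (at_right t) (dyadic_rlim f)"
  unfolding continuous_within
proof (rule tendstoI)
  fix e :: real assume "0 < e"
  then have "\<forall>\<^sub>F s in at t within (dyadic_reals \<inter> {t<..}). dist (f s) (dyadic_rlim f t) < e/2"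
    using tendstoD[OF tendsto_dyadic_rlim[OF assms], of "e/2"] by simp
  then obtain d where d: "d > 0" "\<And>s. s \<in> dyadic_reals \<Longrightarrow> t < s \<Longrightarrow> dist s t < d \<Longrightarrow> dist (f s) (dyadic_rlim f t) < e/2"
    unfolding eventually_at by auto
  have "dist (dyadic_rlim f u) (dyadic_rlim f t) < e" if "t < u" "u < t + d" for u
  proof -
    have "dist (dyadic_rlim f u) (dyadic_rlim f t) \<le> e/2"
    proof (rule dyadic_rlim_close[OF assms(1), of u t "t + d"])
      show "dist (f s) (dyadic_rlim f t) \<le> e/2" if "s \<in> dyadic_reals" "t < s" "s < t + d" for s
        by (intro less_imp_le d(2)) (use that in \<open>auto simp: dist_real_def\<close>)
    qed (use that assms in auto)
    then show ?thesis using \<open>0 < e\<close> by linarith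
  qed
  then show "\<forall>\<^sub>F u in at_right t. dist (dyadic_rlim f u) (dyadic_rlim f t) < e"
    unfolding eventually_at using d(1) by (intro exI[of _ d]) (auto simp: dist_real_def)
qed

lemma dyadic_rlim_left_limit:
  assumes "regular_path f" "0 < t"
  shows "\<exists>l. (dyadic_rlim f \<longlongrightarrow> l) (at_left t)"
proof -
  obtain l where l: "(f \<longlongrightarrow> l) (at t within (dyadic_reals \<inter> {..<t}))"
    using regular_path_left_limit[OF assms] by blast
  have "(dyadic_rlim f \<longlongrightarrow> l) (at_left t)"
  proof (rule tendstoI)
    fix e :: real assume "0 < e"
    then have "\<forall>\<^sub>F s in at t within (dyadic_reals \<inter> {..<t}). dist (f s) l < e/2"
      using tendstoD[OF l, of "e/2"] by simp
    then obtain d where d: "d > 0" "\<And>s. s \<in> dyadic_reals \<Longrightarrow> s < t \<Longrightarrow> dist s t < d \<Longrightarrow> dist (f s) l < e/2"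
      unfolding eventually_at by auto
    \<comment> \<open>The cap at t keeps every u under consideration nonnegative, where the right
      limits are known to exist.\<close>
    define d' where "d' = min d t"
    have "dist (dyadic_rlim f u) l < e" if "t - d' < u" "u < t" for u
    proof -
      have "dist (dyadic_rlim f u) l \<le> e/2"
      proof (rule dyadic_rlim_close[OF assms(1), of u "t - d'" t])
        show "dist (f s) l \<le> e/2" if "s \<in> dyadic_reals" "t - d' < s" "s < t" for s
          by (intro less_imp_le d(2)) (use that in \<open>auto simp: dist_real_def d'_def\<close>)
      qed (use that assms in \<open>auto simp: d'_def\<close>)
      then show ?thesis using \<open>0 < e\<close> by linarith
    qed
    then show "\<forall>\<^sub>F u in at_left t. dist (dyadic_rlim f u) l < e"
      unfolding eventually_at using d(1) assms(2) by (intro exI[of _ d']) (auto simp: dist_real_def d'_def)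
  qed
  then show ?thesis by blast
qed

section \<open>Cadlag versions of bounded martingales\<close>

text \<open>The bound comes from an energy balance: every counted move uses up at least \<epsilon>^2
  of the second moment, which is at most c^2. It depends neither on the number of steps nor on the
  mesh. The martingale property enters as an identity tested against bounded functions, so that no
  conditional expectation appears.\<close>

lemma (in prob_space) expected_osc_count_le:
  fixes x :: "nat \<Rightarrow> 'a \<Rightarrow> real"
  assumes sub: "\<And>k. subalgebra M (Fd k)" and incr: "\<And>k. sets (Fd k) \<subseteq> sets (Fd (Suc k))"
    and meas: "\<And>k. x k \<in> borel_measurable (Fd k)"
    and bounds: "\<And>k \<omega>. 0 \<le> x k \<omega> \<and> x k \<omega> \<le> c"
    and eps: "0 < \<epsilon>"
    and mart: "\<And>k h C. h \<in> borel_measurable (Fd k) \<Longrightarrow> (\<And>\<omega>. \<bar>h \<omega>\<bar> \<le> C) \<Longrightarrow>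
        (\<integral>\<omega>. h \<omega> * x (Suc k) \<omega> \<partial>M) = (\<integral>\<omega>. h \<omega> * x k \<omega> \<partial>M)"
  shows "(\<integral>\<omega>. \<epsilon>\<^sup>2 * real (osc_count \<epsilon> (\<lambda>k. x k \<omega>) n) \<partial>M) \<le> c\<^sup>2"
    and "(\<lambda>\<omega>. real (osc_count \<epsilon> (\<lambda>k. x k \<omega>) n)) \<in> borel_measurable (Fd n)"
    and "integrable M (\<lambda>\<omega>. real (osc_count \<epsilon> (\<lambda>k. x k \<omega>) n))"
proof -
  let ?a = "\<lambda>n \<omega>. anchor \<epsilon> (\<lambda>k. x k \<omega>) n"
  let ?N = "\<lambda>n \<omega>. real (osc_count \<epsilon> (\<lambda>k. x k \<omega>) n)"
  have up: "f \<in> borel_measurable (Fd k) \<Longrightarrow> f \<in> borel_measurable (Fd (Suc k))" for f :: "'a \<Rightarrow> real" and k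
    by (rule measurable_from_subalg[rotated]) (use sub[of k] sub[of "Suc k"] incr[of k] in \<open>auto simp: subalgebra_def\<close>)
  have a_meas: "?a n \<in> borel_measurable (Fd n)" for n
  proof (induction n)
    case (Suc n)
    note [measurable] = up[OF Suc] meas[of "Suc n"]
    show ?case by simp
  qed (simp add: meas)
  show N_meas: "?N n \<in> borel_measurable (Fd n)" for n
  proof (induction n)
    case (Suc n)
    note [measurable] = up[OF Suc] up[OF a_meas] meas[of "Suc n"]
    have "?N (Suc n) = (\<lambda>\<omega>. if \<epsilon> \<le> \<bar>x (Suc n) \<omega> - ?a n \<omega>\<bar> then 1 + ?N n \<omega> else ?N n \<omega>)" by auto
    then show ?case by simp
  qed simp
  have N_le: "osc_count \<epsilon> z n \<le> n" for z n by (induction n) auto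
  have a_bounds: "0 \<le> ?a n \<omega> \<and> ?a n \<omega> \<le> c" for n \<omega> using anchor_bounded[of 0 "\<lambda>k. x k \<omega>" c] bounds by auto
  note [measurable] = measurable_from_subalg[OF sub meas] measurable_from_subalg[OF sub a_meas] measurable_from_subalg[OF sub N_meas]
  show N_int: "integrable M (?N n)" for n
    by (rule integrable_const_bound[where B = "real n"]) (use N_le in auto)
  have prod_int: "integrable M (\<lambda>\<omega>. f \<omega> * g \<omega>)" if "f \<in> borel_measurable M" "g \<in> borel_measurable M"
    "\<And>\<omega>. 0 \<le> f \<omega> \<and> f \<omega> \<le> c" "\<And>\<omega>. 0 \<le> g \<omega> \<and> g \<omega> \<le> c" for f g :: "'a \<Rightarrow> real"
  proof (rule integrable_const_bound[where B = "c * c"])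
    show "AE \<omega> in M. norm (f \<omega> * g \<omega>) \<le> c * c"
      using that(3,4) by (intro always_eventually allI) (simp add: abs_mult mult_mono')
  qed (use that in measurable)
  have xx: "integrable M (\<lambda>\<omega>. x k \<omega> * x k \<omega>)" and ax: "integrable M (\<lambda>\<omega>. ?a j \<omega> * x k \<omega>)"
    and aa: "integrable M (\<lambda>\<omega>. ?a j \<omega> * ?a j \<omega>)" for k j
    using bounds a_bounds by (auto intro!: prod_int)
  have sq: "integrable M (\<lambda>\<omega>. (x k \<omega> - ?a j \<omega>)\<^sup>2)"
    "(\<integral>\<omega>. (x k \<omega> - ?a j \<omega>)\<^sup>2 \<partial>M) = (\<integral>\<omega>. x k \<omega> * x k \<omega> \<partial>M) - 2 * (\<integral>\<omega>. ?a j \<omega> * x k \<omega> \<partial>M) + (\<integral>\<omega>. ?a j \<omega> * ?a j \<omega> \<partial>M)" for k j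
  proof -
    have eq: "(x k \<omega> - ?a j \<omega>)\<^sup>2 = x k \<omega> * x k \<omega> - 2 * (?a j \<omega> * x k \<omega>) + ?a j \<omega> * ?a j \<omega>" for \<omega>
      by (simp add: power2_eq_square algebra_simps)
    show "integrable M (\<lambda>\<omega>. (x k \<omega> - ?a j \<omega>)\<^sup>2)" unfolding eq using xx ax aa by auto
    show "(\<integral>\<omega>. (x k \<omega> - ?a j \<omega>)\<^sup>2 \<partial>M) = (\<integral>\<omega>. x k \<omega> * x k \<omega> \<partial>M) - 2 * (\<integral>\<omega>. ?a j \<omega> * x k \<omega> \<partial>M) + (\<integral>\<omega>. ?a j \<omega> * ?a j \<omega> \<partial>M)"
      unfolding eq using xx ax aa by simp
  qed
  \<comment> \<open>The second term is the energy not yet charged. When a move is counted, the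
    squared distance from the old anchor, at least \<epsilon>^2, is traded for one unit of the count
    and the distance drops to 0; otherwise nothing changes.\<close>
  have key: "(\<integral>\<omega>. \<epsilon>\<^sup>2 * ?N n \<omega> \<partial>M) + (\<integral>\<omega>. (x n \<omega> - ?a n \<omega>)\<^sup>2 \<partial>M) \<le> (\<integral>\<omega>. x n \<omega> * x n \<omega> \<partial>M)" for n
  proof (induction n)
    case 0
    then show ?case using bounds by (simp add: Bochner_Integration.integral_nonneg)
  next
    case (Suc n)
    have "(\<integral>\<omega>. \<epsilon>\<^sup>2 * ?N (Suc n) \<omega> \<partial>M) + (\<integral>\<omega>. (x (Suc n) \<omega> - ?a (Suc n) \<omega>)\<^sup>2 \<partial>M)
        = (\<integral>\<omega>. \<epsilon>\<^sup>2 * ?N (Suc n) \<omega> + (x (Suc n) \<omega> - ?a (Suc n) \<omega>)\<^sup>2 \<partial>M)"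
      by (rule Bochner_Integration.integral_add[symmetric]) (intro integrable_mult_right N_int sq)+
    also have "\<dots> \<le> (\<integral>\<omega>. \<epsilon>\<^sup>2 * ?N n \<omega> + (x (Suc n) \<omega> - ?a n \<omega>)\<^sup>2 \<partial>M)"
    proof (rule integral_mono)
      show "\<epsilon>\<^sup>2 * ?N (Suc n) \<omega> + (x (Suc n) \<omega> - ?a (Suc n) \<omega>)\<^sup>2 \<le> \<epsilon>\<^sup>2 * ?N n \<omega> + (x (Suc n) \<omega> - ?a n \<omega>)\<^sup>2" for \<omega>
      proof (cases "\<epsilon> \<le> \<bar>x (Suc n) \<omega> - ?a n \<omega>\<bar>")
        case True
        then have "\<epsilon>\<^sup>2 \<le> (x (Suc n) \<omega> - ?a n \<omega>)\<^sup>2" using power_mono[OF True, of 2] eps by simp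
        then show ?thesis using True by (simp add: algebra_simps)
      qed simp
    qed (intro Bochner_Integration.integrable_add integrable_mult_right N_int sq)+
    also have "\<dots> = (\<integral>\<omega>. \<epsilon>\<^sup>2 * ?N n \<omega> \<partial>M) + (\<integral>\<omega>. (x (Suc n) \<omega> - ?a n \<omega>)\<^sup>2 \<partial>M)"
      by (rule Bochner_Integration.integral_add) (intro integrable_mult_right N_int sq)+
    \<comment> \<open>Orthogonality of increments: the anchor at n is bounded and known at n, so the
      cross term with \<open>x (Suc n)\<close> equals the one with \<open>x n\<close>, and only the
      two second moments differ.\<close>
    also have "(\<integral>\<omega>. (x (Suc n) \<omega> - ?a n \<omega>)\<^sup>2 \<partial>M) = (\<integral>\<omega>. (x n \<omega> - ?a n \<omega>)\<^sup>2 \<partial>M)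
        + (\<integral>\<omega>. x (Suc n) \<omega> * x (Suc n) \<omega> \<partial>M) - (\<integral>\<omega>. x n \<omega> * x n \<omega> \<partial>M)"
      unfolding sq(2) using mart[OF a_meas[of n], of c] a_bounds by (auto simp: abs_le_iff)
    finally show ?case using Suc by linarith
  qed
  have "(\<integral>\<omega>. \<epsilon>\<^sup>2 * ?N n \<omega> \<partial>M) \<le> (\<integral>\<omega>. x n \<omega> * x n \<omega> \<partial>M)"
  proof -
    have "0 \<le> (\<integral>\<omega>. (x n \<omega> - ?a n \<omega>)\<^sup>2 \<partial>M)" by (rule Bochner_Integration.integral_nonneg) simp
    with key[of n] show ?thesis by linarith
  qed
  also have "\<dots> \<le> (\<integral>\<omega>. c * c \<partial>M)"
    by (rule integral_mono[OF xx]) (use bounds in \<open>auto intro!: mult_mono'\<close>)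
  finally show "(\<integral>\<omega>. \<epsilon>\<^sup>2 * ?N n \<omega> \<partial>M) \<le> c\<^sup>2" by (simp add: power2_eq_square prob_space)
qed

text \<open>Null sets are only required to lie in \<^term>\<open>F 0\<close> up to the horizon \<^term>\<open>T\<close>, since the measures \<open>P\<close> and \<open>Q\<close>
  of the theorem need not be equivalent later on; this suffices for a filtration frozen at \<^term>\<open>T\<close>.\<close>
theorem (in prob_space) cadlag_martingale_version:
  assumes sub: "\<And>u. 0 \<le> u \<Longrightarrow> subalgebra M (F u)"
    and incr: "\<And>u v. 0 \<le> u \<Longrightarrow> u \<le> v \<Longrightarrow> sets (F u) \<subseteq> sets (F v)"
    and rc: "\<And>u. 0 \<le> u \<Longrightarrow> (\<Inter>s\<in>{u<..}. sets (F s)) \<subseteq> sets (F u)"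
    and null: "\<And>N. N \<in> sets (F T) \<Longrightarrow> emeasure M N = 0 \<Longrightarrow> N \<in> sets (F 0)"
    and frozen: "\<And>u. T \<le> u \<Longrightarrow> sets (F u) = sets (F T)" and T: "0 \<le> T"
    and Y: "Y \<in> borel_measurable M" "\<And>\<omega>. 0 \<le> Y \<omega> \<and> Y \<omega> \<le> c"
  obtains X where "\<And>u. 0 \<le> u \<Longrightarrow> X u \<in> borel_measurable (F u)" "cadlag M X"
    "\<And>u \<omega>. 0 \<le> u \<Longrightarrow> 0 \<le> X u \<omega> \<and> X u \<omega> \<le> c"
    "\<And>u B. 0 \<le> u \<Longrightarrow> B \<in> sets (F u) \<Longrightarrow>
       (\<integral>\<omega>. indicator B \<omega> * X u \<omega> \<partial>M) = (\<integral>\<omega>. indicator B \<omega> * Y \<omega> \<partial>M)"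
proof -
  \<comment> \<open>The clamp alters the conditional expectation only on a null set and makes the
    bounds 0 and c hold at every point, so that they pass to all limits.\<close>
  define m where "m u \<omega> = max 0 (min c (real_cond_exp M (F u) Y \<omega>))" for u \<omega>
  have c0: "0 \<le> c" using Y(2) order_trans by blast
  have Y_int: "integrable M Y" by (rule integrable_const_bound[where B = c]) (use Y in auto)
  have m_bounds: "0 \<le> m u \<omega> \<and> m u \<omega> \<le> c" for u \<omega> using c0 by (auto simp: m_def)
  have m_meas: "m u \<in> borel_measurable (F u)" for u unfolding m_def by measurable
  have meas_mono: "f \<in> borel_measurable (F v)" if "f \<in> borel_measurable (F u)" "0 \<le> u" "u \<le> v" for f :: "'a \<Rightarrow> real" and u v
    by (rule measurable_from_subalg[OF _ that(1)])
      (use sub[of u] sub[of v] incr[of u v] that in \<open>auto simp: subalgebra_def\<close>)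
  have m_AE: "AE \<omega> in M. m u \<omega> = real_cond_exp M (F u) Y \<omega>" if "0 \<le> u" for u
  proof -
    interpret finite_measure_subalgebra M "F u" by unfold_locales (rule sub[OF that])
    have "AE \<omega> in M. 0 \<le> real_cond_exp M (F u) Y \<omega>" by (rule real_cond_exp_pos) (use Y in auto)
    moreover have "AE \<omega> in M. real_cond_exp M (F u) Y \<omega> \<le> real_cond_exp M (F u) (\<lambda>_. c) \<omega>"
      by (rule real_cond_exp_mono) (use Y Y_int in auto)
    moreover have "AE \<omega> in M. real_cond_exp M (F u) (\<lambda>_. c) \<omega> = c"
      by (rule real_cond_exp_F_meas) auto
    ultimately show ?thesis by eventually_elim (auto simp: m_def)
  qed
  have m_mart: "(\<integral>\<omega>. h \<omega> * m v \<omega> \<partial>M) = (\<integral>\<omega>. h \<omega> * Y \<omega> \<partial>M)"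
    if "h \<in> borel_measurable (F v)" "\<And>\<omega>. \<bar>h \<omega>\<bar> \<le> C" "0 \<le> v" for h :: "'a \<Rightarrow> real" and v C
  proof -
    interpret finite_measure_subalgebra M "F v" by unfold_locales (rule sub[OF that(3)])
    note [measurable] = measurable_from_subalg[OF sub[OF that(3)] that(1)] measurable_from_subalg[OF sub[OF that(3)] m_meas] Y(1)
    have "integrable M (\<lambda>\<omega>. h \<omega> * Y \<omega>)"
      by (rule integrable_const_bound[where B = "C * c"]) (use that(2) Y in \<open>auto simp: abs_mult intro!: mult_mono'\<close>)
    then have "(\<integral>\<omega>. h \<omega> * real_cond_exp M (F v) Y \<omega> \<partial>M) = (\<integral>\<omega>. h \<omega> * Y \<omega> \<partial>M)"
      by (rule real_cond_exp_intg(2)) (use that Y in auto)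
    moreover have "(\<integral>\<omega>. h \<omega> * real_cond_exp M (F v) Y \<omega> \<partial>M) = (\<integral>\<omega>. h \<omega> * m v \<omega> \<partial>M)"
      by (rule integral_cong_AE) (use m_AE[OF that(3)] in \<open>auto elim!: eventually_mono\<close>)
    ultimately show ?thesis by simp
  qed
  define cnt where "cnt j N n \<omega> = real (osc_count (1 / real (Suc j)) (\<lambda>k. m (real k / 2 ^ n) \<omega>) (N * 2 ^ n))" for j N n \<omega>
  have F_le_T: "sets (F u) \<subseteq> sets (F T)" if "0 \<le> u" for u
    using incr[of u T] frozen[of u] that by (cases "u \<le> T") auto
  have to_T: "f \<in> borel_measurable (F T)" if "f \<in> borel_measurable (F u)" "0 \<le> u" for f :: "'a \<Rightarrow> real" and u
    by (rule measurable_from_subalg[OF _ that(1)]) (use F_le_T[OF that(2)] sub[OF that(2)] sub[OF T] in \<open>auto simp: subalgebra_def\<close>)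
  have cnt: "cnt j N n \<in> borel_measurable (F T)" "(\<integral>\<^sup>+\<omega>. cnt j N n \<omega> \<partial>M) \<le> ennreal ((real (Suc j) * c)\<^sup>2)" for j N n
  proof -
    have mart: "(\<integral>\<omega>. h \<omega> * m (real (Suc k) / 2 ^ n) \<omega> \<partial>M) = (\<integral>\<omega>. h \<omega> * m (real k / 2 ^ n) \<omega> \<partial>M)"
      if "h \<in> borel_measurable (F (real k / 2 ^ n))" "\<And>\<omega>. \<bar>h \<omega>\<bar> \<le> C" for h C k
    proof -
      have "h \<in> borel_measurable (F (real (Suc k) / 2 ^ n))"
        by (rule meas_mono[OF that(1)]) (auto intro!: divide_right_mono)
      then show ?thesis using m_mart[of h "real (Suc k) / 2 ^ n" C] m_mart[of h "real k / 2 ^ n" C] that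
        by (simp del: of_nat_Suc)
    qed
    have incr': "sets (F (real k / 2 ^ n)) \<subseteq> sets (F (real (Suc k) / 2 ^ n))" for k
      by (rule incr) (auto intro!: divide_right_mono)
    have sub': "subalgebra M (F (real k / 2 ^ n))" for k by (rule sub) simp
    have eps: "0 < 1 / real (Suc j)" by simp
    note * = expected_osc_count_le[of "\<lambda>k. F (real k / 2 ^ n)" "\<lambda>k. m (real k / 2 ^ n)" c]
    have 1: "(\<integral>\<omega>. (1 / real (Suc j))\<^sup>2 * cnt j N n \<omega> \<partial>M) \<le> c\<^sup>2"
      unfolding cnt_def by (rule *(1)) (rule sub' incr' m_meas m_bounds eps | (rule mart, assumption, assumption))+
    have 2: "cnt j N n \<in> borel_measurable (F (real (N * 2 ^ n) / 2 ^ n))"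
      unfolding cnt_def by (rule *(2)) (rule sub' incr' m_meas m_bounds eps | (rule mart, assumption, assumption))+
    have 3: "integrable M (cnt j N n)"
      unfolding cnt_def by (rule *(3)) (rule sub' incr' m_meas m_bounds eps | (rule mart, assumption, assumption))+
    show "cnt j N n \<in> borel_measurable (F T)" using to_T[OF 2] by simp
    have "(\<integral>\<omega>. cnt j N n \<omega> \<partial>M) / (real (Suc j))\<^sup>2 \<le> c\<^sup>2" using 1 by (simp add: power_one_over)
    then have le: "(\<integral>\<omega>. cnt j N n \<omega> \<partial>M) \<le> (real (Suc j) * c)\<^sup>2"
      by (simp add: divide_le_eq power_mult_distrib mult.commute)
    have "(\<integral>\<^sup>+\<omega>. cnt j N n \<omega> \<partial>M) = ennreal (\<integral>\<omega>. cnt j N n \<omega> \<partial>M)"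
      by (rule nn_integral_eq_integral[OF 3]) (simp add: cnt_def)
    then show "(\<integral>\<^sup>+\<omega>. cnt j N n \<omega> \<partial>M) \<le> ennreal ((real (Suc j) * c)\<^sup>2)"
      using ennreal_leI[OF le] by (simp only:)
  qed
  \<comment> \<open>Thresholds 1/(j+1) and horizons N range over countable sets, so this is an
    event; every count is measurable with respect to \<open>F T\<close> because the filtration is
    frozen there.\<close>
  define good where "good = {\<omega> \<in> space M. \<forall>j N. liminf (\<lambda>n. ennreal (cnt j N n \<omega>)) < \<infinity>}"
  note [measurable] = cnt(1)
  have space_T: "space (F u) = space M" if "0 \<le> u" for u using sub[OF that] by (simp add: subalgebra_def)
  have "{\<omega> \<in> space (F T). \<forall>j N. liminf (\<lambda>n. ennreal (cnt j N n \<omega>)) < \<infinity>} \<in> sets (F T)" by measurable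
  then have good_T: "good \<in> sets (F T)" by (simp add: good_def space_T[OF T])
  \<comment> \<open>The expected count is bounded uniformly in the grid level n, so by Fatou the
    liminf over n has finite expectation and is finite almost surely.\<close>
  have good_AE: "AE \<omega> in M. \<omega> \<in> good"
  proof -
    have "AE \<omega> in M. liminf (\<lambda>n. ennreal (cnt j N n \<omega>)) \<noteq> \<infinity>" for j N
    proof (rule nn_integral_noteq_infinite)
      note [measurable] = measurable_from_subalg[OF sub[OF T] cnt(1)]
      show "(\<lambda>\<omega>. liminf (\<lambda>n. ennreal (cnt j N n \<omega>))) \<in> borel_measurable M" by measurable
      have "(\<integral>\<^sup>+\<omega>. liminf (\<lambda>n. ennreal (cnt j N n \<omega>)) \<partial>M) \<le> liminf (\<lambda>n. \<integral>\<^sup>+\<omega>. ennreal (cnt j N n \<omega>) \<partial>M)"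
        by (rule nn_integral_liminf) measurable
      also have "\<dots> \<le> liminf (\<lambda>n. ennreal ((real (Suc j) * c)\<^sup>2))"
        by (rule Liminf_mono) (use cnt(2) in auto)
      also have "\<dots> = ennreal ((real (Suc j) * c)\<^sup>2)" by (rule Liminf_const) simp
      finally show "(\<integral>\<^sup>+\<omega>. liminf (\<lambda>n. ennreal (cnt j N n \<omega>)) \<partial>M) \<noteq> \<infinity>" by (auto simp: top_unique)
    qed
    then have "AE \<omega> in M. \<forall>j N. liminf (\<lambda>n. ennreal (cnt j N n \<omega>)) \<noteq> \<infinity>" by (simp add: AE_all_countable)
    then show ?thesis by (rule AE_mp) (auto simp: good_def less_top)
  qed
  \<comment> \<open>The complement is a null set of \<open>F T\<close> and therefore belongs to
    \<open>F 0\<close>. Hence the paths can be changed off the good set without destroying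
    adaptedness at any time.\<close>
  have good_0: "good \<in> sets (F 0)"
  proof -
    have "emeasure M (space M - good) = 0"
      using good_AE good_T sub[OF T] by (subst AE_iff_measurable[symmetric, where P = "\<lambda>\<omega>. \<omega> \<in> good"])
        (auto simp: subalgebra_def)
    moreover have "space M - good \<in> sets (F T)" using good_T space_T[OF T] by (metis sets.compl_sets)
    ultimately have "space M - good \<in> sets (F 0)" by (rule null[rotated])
    then have "space (F 0) - (space M - good) \<in> sets (F 0)" by (rule sets.compl_sets)
    also have "space (F 0) - (space M - good) = good" using space_T[of 0] by (auto simp: good_def)
    finally show ?thesis .
  qed
  have good_regular: "regular_path (\<lambda>u. m u \<omega>)" if "\<omega> \<in> good" for \<omega>
    unfolding regular_path_def
  proof (intro allI impI)
    fix \<epsilon> :: real and N :: nat assume "0 < \<epsilon>"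
    then obtain j where j: "1 / real (Suc j) < \<epsilon>" using nat_approx_posE by blast
    have "liminf (\<lambda>n. ennreal (cnt j N n \<omega>)) < \<infinity>" using that by (auto simp: good_def)
    then obtain C where C: "\<And>k. osc_chain (1 / real (Suc j)) dyadic_reals (\<lambda>u. m u \<omega>) k 0 (real N) \<Longrightarrow> k \<le> C"
      using osc_chain_length_bounded[of "1 / real (Suc j)" "\<lambda>u. m u \<omega>" N] unfolding cnt_def by auto
    have weaken: "osc_chain (1 / real (Suc j)) dyadic_reals (\<lambda>u. m u \<omega>) k lo hi"
      if "osc_chain \<epsilon> dyadic_reals (\<lambda>u. m u \<omega>) k lo hi" for k lo hi
      using that
    proof (induction k arbitrary: lo)
      case (Suc k)
      then obtain a b where *: "a\<in>dyadic_reals" "b\<in>dyadic_reals" "lo \<le> a" "a < b" "2 * \<epsilon> \<le> \<bar>m a \<omega> - m b \<omega>\<bar>"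
        "osc_chain \<epsilon> dyadic_reals (\<lambda>u. m u \<omega>) k b hi"
        by auto
      have "2 * (1 / real (Suc j)) \<le> \<bar>m a \<omega> - m b \<omega>\<bar>" using *(5) j by linarith
      then show ?case using * Suc.IH[OF *(6)] by (subst osc_chain.simps(2)) blast
    qed auto
    show "\<exists>C. \<forall>k. osc_chain \<epsilon> dyadic_reals (\<lambda>u. m u \<omega>) k 0 (real N) \<longrightarrow> k \<le> C"
      using C weaken by blast
  qed
  \<comment> \<open>With the value 0 off the good set, every path is cadlag and bounded, not just
    almost every one.\<close>
  define X where "X u \<omega> = (if \<omega> \<in> good then dyadic_rlim (\<lambda>v. m v \<omega>) u else 0)" for u \<omega>
  define Z where "Z u n \<omega> = (if \<omega> \<in> good then m (dyadic_above n u) \<omega> else 0)" for u n \<omega>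
  have Z_lim: "(\<lambda>n. Z u n \<omega>) \<longlonglongrightarrow> X u \<omega>" if "0 \<le> u" for u \<omega>
    unfolding Z_def X_def using LIMSEQ_dyadic_rlim[OF good_regular that, of \<omega>] by auto
  have Z_meas: "Z u n \<in> borel_measurable (F s)" if "0 \<le> u" "dyadic_above n u \<le> s" for u n s
  proof -
    have d: "0 \<le> dyadic_above n u" using dyadic_above_bounds(1)[OF that(1), of n] that by linarith
    then have "0 \<le> s" using that by linarith
    then have "good \<in> sets (F s)" using good_0 incr[of 0 s] by auto
    moreover have "m (dyadic_above n u) \<in> borel_measurable (F s)" by (rule meas_mono[OF m_meas d that(2)])
    ultimately show ?thesis unfolding Z_def by measurable
  qed
  have X_meas: "X u \<in> borel_measurable (F u)" if u: "0 \<le> u" for u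
  proof -
    \<comment> \<open>The right limit looks at dyadic times strictly after u, so it is first
      measurable only for each later sigma-algebra; the right continuity of the filtration then
      brings it down to \<open>F u\<close>.\<close>
    have later: "X u \<in> borel_measurable (F s)" if s: "u < s" for s
    proof -
      have "\<forall>\<^sub>F n in sequentially. dyadic_above n u < s"
        using dyadic_above_tendsto[OF u] s unfolding filterlim_at by (blast dest: order_tendstoD(2))
      then obtain n0 where n0: "\<And>n. n0 \<le> n \<Longrightarrow> dyadic_above n u < s" unfolding eventually_sequentially by blast
      have "(\<lambda>n. Z u (n + n0) \<omega>) \<longlonglongrightarrow> X u \<omega>" for \<omega> using Z_lim[OF u] by (rule LIMSEQ_ignore_initial_segment)
      moreover have "Z u (n + n0) \<in> borel_measurable (F s)" for n
        by (rule Z_meas[OF u]) (use n0[of "n + n0"] in simp)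
      ultimately show ?thesis by (rule borel_measurable_LIMSEQ_real)
    qed
    show ?thesis
    proof (rule measurableI)
      fix A :: "real set" assume A: "A \<in> sets borel"
      have "X u -` A \<inter> space (F u) \<in> sets (F s)" if "u < s" for s
        using measurable_sets[OF later[OF that] A] space_T[of u] space_T[of s] u that by simp
      then show "X u -` A \<inter> space (F u) \<in> sets (F u)" using rc[OF u] by blast
    qed simp
  qed
  show ?thesis
  proof
    show "X u \<in> borel_measurable (F u)" if "0 \<le> u" for u by (rule X_meas[OF that])
    show "cadlag M X"
      unfolding cadlag_def
    proof (intro ballI conjI allI impI)
      fix \<omega> u :: real and x assume "x \<in> space M"
      show "continuous (at_right u) (\<lambda>s. X s x)" if "0 \<le> u"
        using dyadic_rlim_right_continuous[OF good_regular that, of x] by (cases "x \<in> good") (auto simp: X_def)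
      show "\<exists>l. ((\<lambda>s. X s x) \<longlongrightarrow> l) (at_left u)" if "0 < u"
        using dyadic_rlim_left_limit[OF good_regular that, of x] by (cases "x \<in> good") (auto simp: X_def)
    qed
    show X_bounds: "0 \<le> X u \<omega> \<and> X u \<omega> \<le> c" if "0 \<le> u" for u \<omega>
      using dyadic_rlim_bounds[OF good_regular that m_bounds] c0 by (simp add: X_def)
    show "(\<integral>\<omega>. indicator B \<omega> * X u \<omega> \<partial>M) = (\<integral>\<omega>. indicator B \<omega> * Y \<omega> \<partial>M)" if u: "0 \<le> u" and B: "B \<in> sets (F u)" for u B
    proof (rule LIMSEQ_unique)
      have B_M: "B \<in> sets M" using B sub[OF u] by (auto simp: subalgebra_def)
      have Z_M: "Z u n \<in> borel_measurable M" for n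
      proof -
        have "0 \<le> dyadic_above n u" using dyadic_above_bounds(1)[OF u, of n] u by linarith
        then show ?thesis using measurable_from_subalg[OF sub Z_meas[OF u order_refl]] by blast
      qed
      show "(\<lambda>n. \<integral>\<omega>. indicator B \<omega> * Z u n \<omega> \<partial>M) \<longlonglongrightarrow> (\<integral>\<omega>. indicator B \<omega> * X u \<omega> \<partial>M)"
      proof (rule integral_dominated_convergence[where w = "\<lambda>_. c"])
        show "(\<lambda>\<omega>. indicator B \<omega> * X u \<omega>) \<in> borel_measurable M"
          using B_M measurable_from_subalg[OF sub[OF u] X_meas[OF u]] by measurable
        show "(\<lambda>\<omega>. indicator B \<omega> * Z u n \<omega>) \<in> borel_measurable M" for n
          using B_M Z_M by measurable
        show "AE \<omega> in M. (\<lambda>n. indicator B \<omega> * Z u n \<omega>) \<longlonglongrightarrow> indicator B \<omega> * X u \<omega>"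
          by (intro always_eventually allI tendsto_mult tendsto_const Z_lim u)
        show "AE \<omega> in M. norm (indicator B \<omega> * Z u n \<omega>) \<le> c" for n
          using m_bounds c0 by (intro always_eventually allI) (auto simp: Z_def indicator_def)
      qed simp
      \<comment> \<open>The approximating integrals do not depend on n: B also belongs to the
        sigma-algebra of the later dyadic time, where the martingale property already yields the
        integral of Y.\<close>
      have "(\<integral>\<omega>. indicator B \<omega> * Z u n \<omega> \<partial>M) = (\<integral>\<omega>. indicator B \<omega> * Y \<omega> \<partial>M)" for n
      proof -
        have d: "0 \<le> dyadic_above n u" "u \<le> dyadic_above n u" using dyadic_above_bounds(1)[OF u, of n] u by linarith+
        have "B \<in> sets (F (dyadic_above n u))" using B incr[OF u d(2)] by blast
        then have "indicator B \<in> borel_measurable (F (dyadic_above n u))" by simp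
        from m_mart[of "indicator B", OF this _ d(1), of 1]
        have "(\<integral>\<omega>. indicator B \<omega> * m (dyadic_above n u) \<omega> \<partial>M) = (\<integral>\<omega>. indicator B \<omega> * Y \<omega> \<partial>M)"
          by (simp add: indicator_def)
        moreover have "(\<integral>\<omega>. indicator B \<omega> * Z u n \<omega> \<partial>M) = (\<integral>\<omega>. indicator B \<omega> * m (dyadic_above n u) \<omega> \<partial>M)"
        proof (rule integral_cong_AE)
          show "(\<lambda>\<omega>. indicator B \<omega> * m (dyadic_above n u) \<omega>) \<in> borel_measurable M"
            using B_M measurable_from_subalg[OF sub[OF d(1)] m_meas] by measurable
          show "AE \<omega> in M. indicator B \<omega> * Z u n \<omega> = indicator B \<omega> * m (dyadic_above n u) \<omega>"
            using good_AE by eventually_elim (simp add: Z_def)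
        qed (use B_M Z_M in measurable)
        ultimately show ?thesis by simp
      qed
      then show "(\<lambda>n. \<integral>\<omega>. indicator B \<omega> * Z u n \<omega> \<partial>M) \<longlonglongrightarrow> (\<integral>\<omega>. indicator B \<omega> * Y \<omega> \<partial>M)" by simp
    qed
  qed
qed

section \<open>Local martingales and real analysis\<close>

lemma countable_if_left_isolated:
  fixes D :: "real set"
  assumes "\<And>t. t \<in> D \<Longrightarrow> \<exists>\<delta>>0. D \<inter> {t - \<delta><..<t} = {}"
  shows "countable D"
proof -
  obtain \<delta> where \<delta>: "\<And>t. t \<in> D \<Longrightarrow> \<delta> t > 0 \<and> D \<inter> {t - \<delta> t<..<t} = {}" using assms by metis
  have "\<forall>t\<in>D. \<exists>q\<in>\<rat>. t - \<delta> t < q \<and> q < t" using \<delta> by (intro ballI Rats_dense_in_real) auto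
  then obtain q where q: "\<And>t. t \<in> D \<Longrightarrow> q t \<in> \<rat> \<and> t - \<delta> t < q t \<and> q t < t" by metis
  \<comment> \<open>Two points with the same rational would have the smaller one inside the empty
    left gap of the larger one.\<close>
  have "inj_on q D"
  proof (rule inj_onI, rule ccontr)
    fix x y assume xy: "x \<in> D" "y \<in> D" "q x = q y" "x \<noteq> y"
    have "False" if "a \<in> D" "b \<in> D" "q a = q b" "a < b" for a b
    proof -
      have "b - \<delta> b < a" using q[OF that(1)] q[OF that(2)] that(3) by linarith
      then show False using \<delta>[OF that(2)] that(1,4) by auto
    qed
    then show False using xy by (metis linorder_neqE_linordered_idom)
  qed
  moreover have "countable (q ` D)" by (rule countable_subset[OF _ countable_rat]) (use q in auto)
  ultimately show ?thesis by (rule countable_image_inj_on[rotated])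
qed

text \<open>A rational p separates the left limit from the value. For fixed p, the function stays on
  the side of the left limit just before such a time, so these times are isolated from the left. The
  lemma allows X_{s-} to be replaced by X_s under an integral ds.\<close>

lemma countable_left_discontinuities:
  fixes f :: "real \<Rightarrow> real"
  assumes "\<And>t. 0 < t \<Longrightarrow> (f \<longlongrightarrow> L t) (at_left t)"
  shows "countable {t. 0 < t \<and> L t \<noteq> f t}"
proof -
  define D1 where "D1 p = {t. 0 < t \<and> L t < p \<and> p < f t}" for p
  define D2 where "D2 p = {t. 0 < t \<and> f t < p \<and> p < L t}" for p
  have near: "\<exists>\<delta>>0. \<forall>u. t - \<delta> < u \<and> u < t \<longrightarrow> R u" if ev: "\<forall>\<^sub>F u in at_left t. R u" for t :: real and R
  proof -
    obtain b where "b < t" "\<And>u. b < u \<Longrightarrow> u < t \<Longrightarrow> R u" using ev unfolding eventually_at_left_field by blast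
    then show ?thesis by (intro exI[of _ "t - b"]) auto
  qed
  have "countable (D1 p)" for p
  proof (rule countable_if_left_isolated)
    fix t assume "t \<in> D1 p"
    then have "\<forall>\<^sub>F u in at_left t. f u < p" using assms[of t] by (auto simp: D1_def dest: order_tendstoD(2))
    from near[OF this] obtain \<delta> where "\<delta> > 0" "\<And>u. t - \<delta> < u \<Longrightarrow> u < t \<Longrightarrow> f u < p" by blast
    then show "\<exists>\<delta>>0. D1 p \<inter> {t - \<delta><..<t} = {}" by (intro exI[of _ \<delta>]) (force simp: D1_def)
  qed
  moreover have "countable (D2 p)" for p
  proof (rule countable_if_left_isolated)
    fix t assume "t \<in> D2 p"
    then have "\<forall>\<^sub>F u in at_left t. p < f u" using assms[of t] by (auto simp: D2_def dest: order_tendstoD(1))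
    from near[OF this] obtain \<delta> where "\<delta> > 0" "\<And>u. t - \<delta> < u \<Longrightarrow> u < t \<Longrightarrow> p < f u" by blast
    then show "\<exists>\<delta>>0. D2 p \<inter> {t - \<delta><..<t} = {}" by (intro exI[of _ \<delta>]) (force simp: D2_def)
  qed
  ultimately have "countable (\<Union>p\<in>\<rat>. D1 p \<union> D2 p)" by (intro countable_UN countable_rat) auto
  moreover have "{t. 0 < t \<and> L t \<noteq> f t} \<subseteq> (\<Union>p\<in>\<rat>. D1 p \<union> D2 p)"
  proof
    fix t assume "t \<in> {t. 0 < t \<and> L t \<noteq> f t}"
    then have t: "0 < t" "L t < f t \<or> f t < L t" by auto
    then show "t \<in> (\<Union>p\<in>\<rat>. D1 p \<union> D2 p)"
      using Rats_dense_in_real[of "L t" "f t"] Rats_dense_in_real[of "f t" "L t"] unfolding D1_def D2_def by blast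
  qed
  ultimately show ?thesis by (rule countable_subset[rotated])
qed

text \<open>The two sides are integrals of h against the measures with densities f and g, restricted
  to F. Since the equality is assumed on all of F and not merely on a generator, these measures
  coincide even when they are infinite.\<close>

lemma nn_integral_eq_if_eq_on_subalgebra:
  assumes sub: "subalgebra M F" and fg[measurable]: "f \<in> borel_measurable M" "g \<in> borel_measurable M"
    and eq: "\<And>B. B \<in> sets F \<Longrightarrow> (\<integral>\<^sup>+x. indicator B x * f x \<partial>M) = (\<integral>\<^sup>+x. indicator B x * g x \<partial>M)"
    and h: "h \<in> borel_measurable F"
  shows "(\<integral>\<^sup>+x. h x * f x \<partial>M) = (\<integral>\<^sup>+x. h x * g x \<partial>M)"
proof -
  have h_M[measurable]: "h \<in> borel_measurable M" by (rule measurable_from_subalg[OF sub h])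
  have sub': "subalgebra (density M k) F" for k using sub by (simp add: subalgebra_def)
  have "restr_to_subalg (density M f) F = restr_to_subalg (density M g) F"
  proof (rule measure_eqI)
    show "sets (restr_to_subalg (density M f) F) = sets (restr_to_subalg (density M g) F)"
      by (simp add: sets_restr_to_subalg[OF sub'])
    fix B assume "B \<in> sets (restr_to_subalg (density M f) F)"
    then have B: "B \<in> sets F" by (simp add: sets_restr_to_subalg[OF sub'])
    then have "B \<in> sets M" using sub by (auto simp: subalgebra_def)
    then show "emeasure (restr_to_subalg (density M f) F) B = emeasure (restr_to_subalg (density M g) F) B"
      using eq[OF B] by (simp add: emeasure_restr_to_subalg[OF sub' B] emeasure_density mult.commute)
  qed
  moreover have "(\<integral>\<^sup>+x. h x * k x \<partial>M) = (\<integral>\<^sup>+x. h x \<partial>restr_to_subalg (density M k) F)" if [measurable]: "k \<in> borel_measurable M" for k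
    using h by (simp add: nn_integral_subalgebra2[OF sub'] nn_integral_density mult.commute)
  ultimately show ?thesis using fg by simp
qed

text \<open>The form in which local martingales are used below: integrals over events replace
  conditional expectations, and monotonicity of the localizing times upgrades "some n" to "all large
  n", so that at a fixed time the stopped process eventually equals the original one.\<close>

lemma (in prob_space) local_martingale_stopped_integral:
  assumes sub: "\<And>u. 0 \<le> u \<Longrightarrow> subalgebra M (F u)" and X: "local_martingale M F X"
  obtains \<rho> :: "nat \<Rightarrow> 'a \<Rightarrow> ereal" where "\<And>n. stopping_time_on F (\<rho> n)"
    "AE \<omega> in M. \<forall>c::real. \<forall>\<^sub>F n in sequentially. ereal c < \<rho> n \<omega>"
    "\<And>n t. 0 \<le> t \<Longrightarrow> integrable M (stopped X (\<rho> n) t)"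
    "\<And>n s t B. 0 \<le> s \<Longrightarrow> s \<le> t \<Longrightarrow> B \<in> sets (F s) \<Longrightarrow>
       (\<integral>\<omega>. indicator B \<omega> * stopped X (\<rho> n) t \<omega> \<partial>M) = (\<integral>\<omega>. indicator B \<omega> * stopped X (\<rho> n) s \<omega> \<partial>M)"
proof -
  obtain \<rho> where \<rho>: "\<And>n. stopping_time_on F (\<rho> n)" "\<And>n \<omega>. \<omega> \<in> space M \<Longrightarrow> \<rho> n \<omega> \<le> \<rho> (Suc n) \<omega>"
    "AE \<omega> in M. \<forall>c::real. \<exists>n. ereal c \<le> \<rho> n \<omega>" "\<And>n. martingale M F (stopped X (\<rho> n))"
    using X unfolding local_martingale_def by blast
  show ?thesis
  proof
    show "stopping_time_on F (\<rho> n)" for n by (rule \<rho>)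
    show "AE \<omega> in M. \<forall>c::real. \<forall>\<^sub>F n in sequentially. ereal c < \<rho> n \<omega>"
      using \<rho>(3) AE_space
    proof eventually_elim
      case (elim \<omega>)
      show ?case
      proof
        fix c :: real
        \<comment> \<open>Aiming at c + 1 makes the inequality at c strict, as
          \<open>stopped_before\<close> requires.\<close>
        obtain n where n: "ereal (c + 1) \<le> \<rho> n \<omega>" using elim by blast
        have "incseq (\<lambda>n. \<rho> n \<omega>)" using \<rho>(2) elim by (intro incseq_SucI) auto
        then have "ereal c < \<rho> m \<omega>" if "n \<le> m" for m
          using n incseqD[of "\<lambda>n. \<rho> n \<omega>" n m] that by (metis ereal_less_eq(3) less_add_one linorder_not_less order.trans)
        then show "\<forall>\<^sub>F n in sequentially. ereal c < \<rho> n \<omega>" unfolding eventually_sequentially by blast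
      qed
    qed
    show int: "integrable M (stopped X (\<rho> n) t)" if "0 \<le> t" for n t
      using \<rho>(4)[of n] that unfolding martingale_def by blast
    fix n s t B assume st: "0 \<le> s" "s \<le> t" and B: "B \<in> sets (F s)"
    interpret finite_measure_subalgebra M "F s" by unfold_locales (rule sub[OF st(1)])
    have B_M: "B \<in> sets M" using B sub[OF st(1)] by (auto simp: subalgebra_def)
    have "(\<integral>\<omega>. indicator B \<omega> * stopped X (\<rho> n) t \<omega> \<partial>M) = (\<integral>\<omega>. indicator B \<omega> * real_cond_exp M (F s) (stopped X (\<rho> n) t) \<omega> \<partial>M)"
      using real_cond_exp_intA[OF int B, of t n] st by (simp add: set_lebesgue_integral_def)
    also have "\<dots> = (\<integral>\<omega>. indicator B \<omega> * stopped X (\<rho> n) s \<omega> \<partial>M)"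
    proof (rule integral_cong_AE)
      show "AE \<omega> in M. indicator B \<omega> * real_cond_exp M (F s) (stopped X (\<rho> n) t) \<omega> = indicator B \<omega> * stopped X (\<rho> n) s \<omega>"
        using \<rho>(4)[of n] st unfolding martingale_def by (auto elim!: eventually_mono)
    qed (use B_M borel_measurable_integrable[OF int[OF st(1)]] in measurable)
    finally show "(\<integral>\<omega>. indicator B \<omega> * stopped X (\<rho> n) t \<omega> \<partial>M) = (\<integral>\<omega>. indicator B \<omega> * stopped X (\<rho> n) s \<omega> \<partial>M)" .
  qed
qed

lemma stopped_before: "ereal t < \<theta> \<omega> \<Longrightarrow> stopped X \<theta> t \<omega> = X t \<omega>"
  by (simp add: stopped_def)

text \<open>Every value of a stopped process is a value of X at some time in [0, t]; through this,
  bounds and monotonicity of X pass to the stopped process.\<close>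

lemma stopped_eq_at_time:
  assumes "0 \<le> \<theta> \<omega>" "0 \<le> t"
  shows "\<exists>s. 0 \<le> s \<and> s \<le> t \<and> ereal s \<le> \<theta> \<omega> \<and> (s = t \<or> ereal s = \<theta> \<omega>) \<and> stopped X \<theta> t \<omega> = X s \<omega>"
proof (cases "ereal t < \<theta> \<omega>")
  case False
  then have "\<bar>\<theta> \<omega>\<bar> \<noteq> \<infinity>" using assms by auto
  then have "ereal (real_of_ereal (\<theta> \<omega>)) = \<theta> \<omega>" by (rule ereal_real')
  with False assms show ?thesis
    by (intro exI[of _ "real_of_ereal (\<theta> \<omega>)"]) (metis ereal_less_eq(3) linorder_not_less order_refl real_of_ereal_pos stopped_def)
qed (use assms in \<open>auto simp: stopped_def intro!: exI[of _ t]\<close>)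

text \<open>The constant c bounds all stopped processes at once, so dominated convergence removes
  the localization on both sides.\<close>

lemma (in prob_space) bounded_local_martingale_integral:
  assumes sub: "\<And>u. 0 \<le> u \<Longrightarrow> subalgebra M (F u)" and X: "local_martingale M F X"
    and bound: "\<And>u \<omega>. 0 \<le> u \<Longrightarrow> \<omega> \<in> space M \<Longrightarrow> \<bar>X u \<omega>\<bar> \<le> c"
    and st: "0 \<le> s" "s \<le> t" and B: "B \<in> sets (F s)"
  shows "(\<integral>\<omega>. indicator B \<omega> * X t \<omega> \<partial>M) = (\<integral>\<omega>. indicator B \<omega> * X s \<omega> \<partial>M)"
proof -
  obtain \<rho> where \<rho>: "\<And>n. stopping_time_on F (\<rho> n)"
    "AE \<omega> in M. \<forall>c::real. \<forall>\<^sub>F n in sequentially. ereal c < \<rho> n \<omega>"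
    "\<And>n t. 0 \<le> t \<Longrightarrow> integrable M (stopped X (\<rho> n) t)"
    "\<And>n s t B. 0 \<le> s \<Longrightarrow> s \<le> t \<Longrightarrow> B \<in> sets (F s) \<Longrightarrow>
       (\<integral>\<omega>. indicator B \<omega> * stopped X (\<rho> n) t \<omega> \<partial>M) = (\<integral>\<omega>. indicator B \<omega> * stopped X (\<rho> n) s \<omega> \<partial>M)"
    using local_martingale_stopped_integral[OF sub X] by blast
  have B_M: "B \<in> sets M" using B sub[OF st(1)] by (auto simp: subalgebra_def)
  have X_M: "X u \<in> borel_measurable M" if "0 \<le> u" for u
    using X sub[OF that] that unfolding local_martingale_def adapted_def by (meson measurable_from_subalg)
  have lim: "(\<lambda>n. \<integral>\<omega>. indicator B \<omega> * stopped X (\<rho> n) u \<omega> \<partial>M) \<longlonglongrightarrow> (\<integral>\<omega>. indicator B \<omega> * X u \<omega> \<partial>M)" if u: "0 \<le> u" for u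
  proof (rule integral_dominated_convergence[where w = "\<lambda>_. c"])
    show "AE \<omega> in M. (\<lambda>n. indicator B \<omega> * stopped X (\<rho> n) u \<omega>) \<longlonglongrightarrow> indicator B \<omega> * X u \<omega>"
      using \<rho>(2)
    proof eventually_elim
      case (elim \<omega>)
      then have "\<forall>\<^sub>F n in sequentially. ereal u < \<rho> n \<omega>" by blast
      then have "\<forall>\<^sub>F n in sequentially. indicator B \<omega> * stopped X (\<rho> n) u \<omega> = indicator B \<omega> * X u \<omega>"
        by eventually_elim (simp add: stopped_before)
      then show ?case by (rule tendsto_eventually)
    qed
    show "AE \<omega> in M. norm (indicator B \<omega> * stopped X (\<rho> n) u \<omega>) \<le> c" for n
    proof (rule AE_I2)
      fix \<omega> assume \<omega>: "\<omega> \<in> space M"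
      have "space (F 0) = space M" using sub[of 0] by (simp add: subalgebra_def)
      then have "0 \<le> \<rho> n \<omega>" using \<rho>(1)[of n] \<omega> unfolding stopping_time_on_def by simp
      from stopped_eq_at_time[of "\<rho> n", OF this u, of X]
      obtain r where "0 \<le> r" "stopped X (\<rho> n) u \<omega> = X r \<omega>" by blast
      then have "\<bar>stopped X (\<rho> n) u \<omega>\<bar> \<le> c" using bound \<omega> by simp
      then show "norm (indicator B \<omega> * stopped X (\<rho> n) u \<omega>) \<le> c" by (auto simp: indicator_def)
    qed
  qed (use B_M X_M[OF u] borel_measurable_integrable[OF \<rho>(3)[OF u]] in \<open>measurable\<close>)
  have "0 \<le> t" using st by linarith
  from lim[OF this] lim[OF st(1)] show ?thesis unfolding \<rho>(4)[OF st B] by (rule LIMSEQ_unique)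
qed

lemma null_boundary_point_nn_integral:
  "(\<integral>\<^sup>+s\<in>{a<..b}. f s \<partial>lborel) = (\<integral>\<^sup>+s\<in>{a..b::real}. f s \<partial>lborel)"
proof (rule nn_integral_cong_AE)
  have "AE s in lborel. s \<noteq> a" by (rule AE_lborel_singleton)
  then show "AE s in lborel. f s * indicator {a<..b} s = f s * indicator {a..b} s"
    by eventually_elim (auto simp: indicator_def)
qed

section \<open>The cumulative integral of a nonnegative density and its exponential\<close>

context
  fixes g :: "real \<Rightarrow> real" and t v :: real and J :: "real \<Rightarrow> real"
  assumes g_meas[measurable]: "g \<in> borel_measurable borel" and g_nonneg: "\<And>s. 0 \<le> g s"
    and t: "0 \<le> t" "t \<le> v"
    and finite: "(\<integral>\<^sup>+s\<in>{0<..v}. ennreal (g s) \<partial>lborel) < \<infinity>"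
    and J: "\<And>u. J u = enn2real (\<integral>\<^sup>+s\<in>{0<..u}. ennreal (g s) \<partial>lborel)"
begin

lemma cumulative_finite: "u \<le> v \<Longrightarrow> (\<integral>\<^sup>+s\<in>{0<..u}. ennreal (g s) \<partial>lborel) < \<infinity>"
  by (rule le_less_trans[OF _ finite]) (auto intro!: nn_integral_mono simp: indicator_def)

lemma ennreal_cumulative: "u \<le> v \<Longrightarrow> ennreal (J u) = (\<integral>\<^sup>+s\<in>{0<..u}. ennreal (g s) \<partial>lborel)"
  unfolding J using cumulative_finite by (simp add: less_top)

lemma cumulative_nonneg: "0 \<le> J u" unfolding J by simp

lemma nn_integral_increment:
  assumes "0 \<le> a" "a \<le> b" "b \<le> v"
  shows "(\<integral>\<^sup>+s\<in>{a<..b}. ennreal (g s) \<partial>lborel) = ennreal (J b - J a)"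
proof -
  have "(\<integral>\<^sup>+s\<in>{0<..b}. ennreal (g s) \<partial>lborel) = (\<integral>\<^sup>+s\<in>{0<..a} \<union> {a<..b}. ennreal (g s) \<partial>lborel)"
    using assms by (intro nn_integral_cong) (auto simp: indicator_def)
  also have "\<dots> = (\<integral>\<^sup>+s\<in>{0<..a}. ennreal (g s) \<partial>lborel) + (\<integral>\<^sup>+s\<in>{a<..b}. ennreal (g s) \<partial>lborel)"
    by (rule nn_integral_disjoint_pair) auto
  finally have eq: "ennreal (J b) = ennreal (J a) + (\<integral>\<^sup>+s\<in>{a<..b}. ennreal (g s) \<partial>lborel)"
    using assms by (simp add: ennreal_cumulative)
  have "(\<integral>\<^sup>+s\<in>{a<..b}. ennreal (g s) \<partial>lborel) = ennreal (J b) - ennreal (J a)"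
    unfolding eq by simp
  then show ?thesis by (simp add: ennreal_minus cumulative_nonneg)
qed

lemma cumulative_mono: "0 \<le> a \<Longrightarrow> a \<le> b \<Longrightarrow> b \<le> v \<Longrightarrow> J a \<le> J b"
proof -
  assume ab: "0 \<le> a" "a \<le> b" "b \<le> v"
  then have "ennreal (J a) \<le> ennreal (J b)" using ennreal_cumulative[of a] ennreal_cumulative[of b]
    by (auto intro!: nn_integral_mono simp: indicator_def)
  then show ?thesis by (simp add: cumulative_nonneg)
qed

lemma cumulative_continuous: "continuous_on {0..v} J"
proof -
  have fin: "(\<integral>\<^sup>+s. ennreal (indicator {0..u} s * g s) \<partial>lborel) = ennreal (J u)" if "u \<le> v" for u
  proof -
    have "(\<integral>\<^sup>+s. ennreal (indicator {0..u} s * g s) \<partial>lborel) = (\<integral>\<^sup>+s\<in>{0..u}. ennreal (g s) \<partial>lborel)"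
      by (intro nn_integral_cong) (auto simp: indicator_def)
    then show ?thesis
      using ennreal_cumulative[OF that] null_boundary_point_nn_integral[of "\<lambda>s. ennreal (g s)" 0 u] by simp
  qed
  have int: "integrable lborel (\<lambda>s. indicator {0..u} s * g s)" if "u \<le> v" for u
    by (rule integrableI_nonneg) (auto simp: g_nonneg fin[OF that])
  have set_int: "set_integrable lborel {0..u} g" if "u \<le> v" for u
    using int[OF that] by (simp add: set_integrable_def)
  have "J u = integral {0..u} g" if "u \<le> v" for u
  proof -
    have "ennreal (\<integral>s. indicator {0..u} s * g s \<partial>lborel) = ennreal (J u)"
      using fin[OF that] nn_integral_eq_integral[OF int[OF that]] by (simp add: g_nonneg)
    then have "J u = (\<integral>s. indicator {0..u} s * g s \<partial>lborel)"
      using cumulative_nonneg Bochner_Integration.integral_nonneg[of lborel "\<lambda>s. indicator {0..u} s * g s"] g_nonneg by simp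
    also have "\<dots> = integral {0..u} g"
      using set_borel_integral_eq_integral(2)[OF set_int[OF that]] by (simp add: set_lebesgue_integral_def)
    finally show ?thesis .
  qed
  moreover have "continuous_on {0..v} (\<lambda>u. integral {0..u} g)"
    by (rule indefinite_integral_continuous_1) (rule set_borel_integral_eq_integral(1)[OF set_int], simp)
  ultimately show ?thesis using continuous_on_cong[of "{0..v}" "{0..v}" J "\<lambda>u. integral {0..u} g"] by auto
qed

text \<open>Since \<^term>\<open>J\<close> need not be differentiable everywhere, the chain rule is obtained from the fact that
  \<^term>\<open>J\<close> pushes \<open>g(u) du\<close> forward to Lebesgue measure.\<close>
lemma nn_integral_cumulative_exp:
  "(\<integral>\<^sup>+u\<in>{t<..v}. ennreal (g u * exp (J u)) \<partial>lborel) = ennreal (exp (J v) - exp (J t))"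
proof -
  \<comment> \<open>Freezing J outside [t, v] makes it continuous on the whole line, hence Borel;
    finiteness of the integral is assumed only up to v.\<close>
  define J' where "J' u = J (max t (min v u))" for u
  have J'_eq: "J' u = J u" if "u \<in> {t..v}" for u using that by (auto simp: J'_def max_def min_def dest: antisym)
  have "continuous_on UNIV J'"
    unfolding J'_def by (rule continuous_on_compose2[OF cumulative_continuous]) (use t in \<open>auto intro!: continuous_intros\<close>)
  then have J'_meas[measurable]: "J' \<in> borel_measurable borel" by (rule borel_measurable_continuous_onI)
  define N where "N = density lborel (\<lambda>u. ennreal (g u) * indicator {t<..v} u)"
  have N_interval: "emeasure N {a<..b} = ennreal (J b - J a)" if "t \<le> a" "a \<le> b" "b \<le> v" for a b
  proof -
    have "emeasure N {a<..b} = (\<integral>\<^sup>+u. ennreal (g u) * indicator {t<..v} u * indicator {a<..b} u \<partial>lborel)"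
      unfolding N_def by (subst emeasure_density) auto
    also have "\<dots> = (\<integral>\<^sup>+u\<in>{a<..b}. ennreal (g u) \<partial>lborel)"
      using that by (intro nn_integral_cong) (auto simp: indicator_def)
    finally show ?thesis using nn_integral_increment[of a b] that t by simp
  qed
  have N_null: "emeasure N A = emeasure N (A \<inter> {t<..v})" if [measurable]: "A \<in> sets borel" for A
    unfolding N_def by (subst (1 2) emeasure_density) (auto intro!: nn_integral_cong simp: indicator_def)
  \<comment> \<open>Both measures are finite on the half-lines (x, \<infinity>), where they are
    compared. Intervals on which J is constant are harmless, as g(u) du gives them no mass.\<close>
  have "distr N borel J' = density lborel (indicator {J t..J v})"
  proof (rule measure_eqI_lessThan)
    have eq: "emeasure (distr N borel J') {x<..} = ennreal (J v - max x (J t)) \<and>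
      emeasure (density lborel (indicator {J t..J v})) {x<..} = ennreal (J v - max x (J t))" for x
    proof
      have "emeasure (density lborel (indicator {J t..J v})) {x<..} = (\<integral>\<^sup>+y. indicator {J t..J v} y * indicator {x<..} y \<partial>lborel)"
        by (subst emeasure_density) auto
      also have "\<dots> = (\<integral>\<^sup>+y. indicator {max x (J t)<..J v} y \<partial>lborel)"
      proof (rule nn_integral_cong_AE)
        have "AE y in lborel. y \<noteq> J t" by (rule AE_lborel_singleton)
        then show "AE y in lborel. indicator {J t..J v} y * indicator {x<..} y = (indicator {max x (J t)<..J v} y :: ennreal)"
          by eventually_elim (auto simp: indicator_def)
      qed
      also have "\<dots> = ennreal (J v - max x (J t))"
        using cumulative_mono[OF t order_refl] by (cases "x \<le> J v") (auto simp: ennreal_neg max_def)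
      finally show "emeasure (density lborel (indicator {J t..J v})) {x<..} = ennreal (J v - max x (J t))" .
      have "emeasure (distr N borel J') {x<..} = emeasure N (J' -` {x<..} \<inter> space N)"
        by (rule emeasure_distr) (auto simp: N_def)
      also have "\<dots> = emeasure N {u. x < J' u}" by (rule arg_cong[where f = "emeasure N"]) (auto simp: N_def)
      also have "\<dots> = emeasure N ({u. x < J' u} \<inter> {t<..v})" by (rule N_null) measurable
      also have "\<dots> = ennreal (J v - max x (J t))"
      proof (cases "x < J t")
        case True
        then have "{u. x < J' u} \<inter> {t<..v} = {t<..v}"
          using J'_eq cumulative_mono[of t] t by (auto intro: less_le_trans)
        then show ?thesis using N_interval[of t v] t True by (simp add: max_def)
      next
        case False
        show ?thesis
        proof (cases "x < J v")
          case True
          \<comment> \<open>The largest element w of this compact set is the last time at which J is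
            at most x. By the intermediate value theorem J equals x there, so J exceeds x exactly on
            (w, v], an interval of mass J(v) - x.\<close>
          define E where "E = {t..v} \<inter> {u. J' u \<le> x}"
          have "compact E"
            unfolding E_def using \<open>continuous_on UNIV J'\<close>
            by (intro compact_Int_closed compact_Icc closed_Collect_le continuous_on_const)
          moreover have "t \<in> E" using False t by (simp add: E_def J'_eq)
          ultimately obtain w where w: "w \<in> E" "\<And>u. u \<in> E \<Longrightarrow> u \<le> w" using compact_attains_sup[of E] by blast
          have w_in: "w \<in> {t..v}" "J w \<le> x" using w(1) J'_eq[of w] by (auto simp: E_def)
          have "J w = x"
          proof (rule ccontr)
            assume "J w \<noteq> x"
            then have "J w < x" using w_in by simp
            have "continuous_on {w..v} J" using cumulative_continuous by (rule continuous_on_subset) (use w_in t in auto)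
            then obtain y where y: "w \<le> y" "y \<le> v" "J y = x"
              using IVT'[of J w x v] \<open>J w < x\<close> True w_in by auto
            then have "y \<in> E" using w_in J'_eq[of y] by (simp add: E_def)
            then have "y = w" using w(2)[of y] y by simp
            then show False using y \<open>J w < x\<close> by simp
          qed
          have "{u. x < J' u} \<inter> {t<..v} = {w<..v}"
          proof (intro subset_antisym subsetI)
            fix u assume u: "u \<in> {u. x < J' u} \<inter> {t<..v}"
            then have "u \<in> {t..v}" by auto
            have "\<not> u \<le> w"
            proof
              assume "u \<le> w"
              then have "J u \<le> J w" using cumulative_mono[of u w] u w_in t by auto
              then show False using u \<open>J w = x\<close> J'_eq[OF \<open>u \<in> {t..v}\<close>] by simp
            qed
            then show "u \<in> {w<..v}" using u by auto
          next
            fix u assume u: "u \<in> {w<..v}"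
            then have "u \<notin> E" using w(2)[of u] by auto
            then show "u \<in> {u. x < J' u} \<inter> {t<..v}" using u w_in by (auto simp: E_def)
          qed
          then show ?thesis using N_interval[of w v] w_in \<open>J w = x\<close> False by (simp add: max_def)
        next
          case False': False
          have "J' u \<le> J v" if "u \<in> {t<..v}" for u using that cumulative_mono[of u v] t J'_eq[of u] by auto
          then have "{u. x < J' u} \<inter> {t<..v} = {}" using False' by force
          then show ?thesis using False' False by (simp add: ennreal_neg max_def)
        qed
      qed
      finally show "emeasure (distr N borel J') {x<..} = ennreal (J v - max x (J t))" .
    qed
    then show "emeasure (distr N borel J') {x<..} = emeasure (density lborel (indicator {J t..J v})) {x<..}"
      "emeasure (distr N borel J') {x<..} < \<infinity>" for x by simp_all
  qed auto
  then have push: "(\<integral>\<^sup>+x. ennreal (exp x) \<partial>distr N borel J') = (\<integral>\<^sup>+x. ennreal (exp x) \<partial>density lborel (indicator {J t..J v}))"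
    by simp
  have "(\<integral>\<^sup>+u\<in>{t<..v}. ennreal (g u * exp (J u)) \<partial>lborel) = (\<integral>\<^sup>+u. ennreal (g u) * indicator {t<..v} u * ennreal (exp (J' u)) \<partial>lborel)"
    by (intro nn_integral_cong) (auto simp: indicator_def J'_eq ennreal_mult g_nonneg)
  also have "\<dots> = (\<integral>\<^sup>+u. ennreal (exp (J' u)) \<partial>N)"
    unfolding N_def by (subst nn_integral_density) auto
  also have "\<dots> = (\<integral>\<^sup>+x. ennreal (exp x) \<partial>distr N borel J')"
    by (subst nn_integral_distr) (auto simp: N_def)
  also have "\<dots> = (\<integral>\<^sup>+x. ennreal (exp x) * indicator {J t..J v} x \<partial>lborel)"
    unfolding push by (subst nn_integral_density) (auto simp: mult.commute)
  also have "\<dots> = ennreal (exp (J v) - exp (J t))"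
    by (rule nn_integral_FTC_Icc) (use cumulative_mono[of t v] t in \<open>auto intro!: derivative_eq_intros\<close>)
  finally show ?thesis .
qed

end

section \<open>Predictable and optional processes\<close>

lemma filtration_on_subalgebra: "filtration_on M F \<Longrightarrow> 0 \<le> u \<Longrightarrow> subalgebra M (F u)"
  by (simp add: filtration_on_def)

lemma filtration_on_space: "filtration_on M F \<Longrightarrow> 0 \<le> u \<Longrightarrow> space (F u) = space M"
  by (simp add: filtration_on_def subalgebra_def)

lemma filtration_on_mono: "filtration_on M F \<Longrightarrow> 0 \<le> u \<Longrightarrow> u \<le> v \<Longrightarrow> B \<in> sets (F u) \<Longrightarrow> B \<in> sets (F v)"
  by (auto simp: filtration_on_def)

lemma filtration_on_sets: "filtration_on M F \<Longrightarrow> 0 \<le> u \<Longrightarrow> B \<in> sets (F u) \<Longrightarrow> B \<in> sets M"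
  by (auto simp: filtration_on_def subalgebra_def)

lemma filtration_on_borel:
  "filtration_on M F \<Longrightarrow> 0 \<le> u \<Longrightarrow> f \<in> borel_measurable (F u) \<Longrightarrow> f \<in> borel_measurable M"
  using measurable_from_subalg filtration_on_subalgebra by blast

lemma filtration_on_borel_mono:
  assumes "filtration_on M F" "0 \<le> u" "u \<le> v" "f \<in> borel_measurable (F u)"
  shows "f \<in> borel_measurable (F v)"
proof (rule measurable_from_subalg[OF _ assms(4)])
  show "subalgebra (F v) (F u)" using assms(1-3) filtration_on_space[of M F u] filtration_on_space[of M F v]
    by (auto simp: subalgebra_def filtration_on_mono)
qed

lemma predictable_generator_subset:
  assumes "filtration_on M F"
  shows "{{0} \<times> B | B. B \<in> sets (F 0)} \<union> {{s<..t} \<times> B | s t B. 0 \<le> s \<and> s \<le> t \<and> B \<in> sets (F s)} \<subseteq> Pow ({0..} \<times> space M)"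
proof -
  have sub: "B \<subseteq> space M" if "0 \<le> s" "B \<in> sets (F s)" for s B
    using sets.sets_into_space[OF that(2)] filtration_on_space[OF assms that(1)] by simp
  show ?thesis
  proof
    fix A assume "A \<in> {{0} \<times> B | B. B \<in> sets (F 0)} \<union> {{s<..t} \<times> B | s t B. 0 \<le> s \<and> s \<le> t \<and> B \<in> sets (F s)}"
    then consider B where "A = {0} \<times> B" "B \<in> sets (F 0)" | s t B where "A = {s<..t} \<times> B" "0 \<le> s" "B \<in> sets (F s)"
      by blast
    then show "A \<in> Pow ({0..} \<times> space M)"
    proof cases
      case 1
      then show ?thesis using sub[of 0 B] by auto
    next
      case 2
      then show ?thesis using sub[of s B] by auto
    qed
  qed
qed

lemma space_predictable_sigma [simp]:
  "filtration_on M F \<Longrightarrow> space (predictable_sigma M F) = {0..} \<times> space M"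
  unfolding predictable_sigma_def by (rule space_measure_of) (rule predictable_generator_subset)

lemma predictable_sigma_rectangle:
  assumes "filtration_on M F" "0 \<le> s" "B \<in> sets (F s)"
  shows "{s<..t} \<times> B \<in> sets (predictable_sigma M F)"
proof (cases "s \<le> t")
  case True
  then show ?thesis using assms unfolding predictable_sigma_def sets_measure_of[OF predictable_generator_subset[OF assms(1)]]
    by (intro sigma_sets.Basic) auto
qed simp

lemma predictable_sigma_zero:
  assumes "filtration_on M F" "B \<in> sets (F 0)"
  shows "{0} \<times> B \<in> sets (predictable_sigma M F)"
  using assms unfolding predictable_sigma_def sets_measure_of[OF predictable_generator_subset[OF assms(1)]]
  by (intro sigma_sets.Basic) auto

lemma measurable_predictable_sigmaI:
  assumes "filtration_on M F" "f \<in> space N \<rightarrow> {0..} \<times> space M"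
    and "\<And>B. B \<in> sets (F 0) \<Longrightarrow> f -` ({0} \<times> B) \<inter> space N \<in> sets N"
    and "\<And>s t B. 0 \<le> s \<Longrightarrow> s \<le> t \<Longrightarrow> B \<in> sets (F s) \<Longrightarrow> f -` ({s<..t} \<times> B) \<inter> space N \<in> sets N"
  shows "f \<in> measurable N (predictable_sigma M F)"
  unfolding predictable_sigma_def
  by (rule measurable_measure_of[OF predictable_generator_subset[OF assms(1)] assms(2)]) (use assms(3,4) in auto)

lemma measurable_section_predictable:
  assumes F: "filtration_on M F" and u: "0 \<le> u"
  shows "(\<lambda>\<omega>. (u, \<omega>)) \<in> measurable (F u) (predictable_sigma M F)"
proof (rule measurable_predictable_sigmaI[OF F])
  show "(\<lambda>\<omega>. (u, \<omega>)) \<in> space (F u) \<rightarrow> {0..} \<times> space M" using u filtration_on_space[OF F u] by auto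
  fix B assume "B \<in> sets (F 0)"
  then have B: "B \<in> sets (F u)" using filtration_on_mono[OF F] u by blast
  from sets.sets_into_space[OF this]
  have "(\<lambda>\<omega>. (u, \<omega>)) -` ({0} \<times> B) \<inter> space (F u) = (if u = 0 then B else {})" by auto
  moreover have "(if u = 0 then B else {}) \<in> sets (F u)" using B by (cases "u = 0") simp_all
  ultimately show "(\<lambda>\<omega>. (u, \<omega>)) -` ({0} \<times> B) \<inter> space (F u) \<in> sets (F u)" by (simp only:)
next
  fix s t B assume st: "0 \<le> s" "s \<le> t" and B: "B \<in> sets (F s)"
  show "(\<lambda>\<omega>. (u, \<omega>)) -` ({s<..t} \<times> B) \<inter> space (F u) \<in> sets (F u)"
  proof (cases "s < u \<and> u \<le> t")
    case True
    then have "B \<in> sets (F u)" using filtration_on_mono[OF F st(1) _ B] by auto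
    moreover from sets.sets_into_space[OF this]
    have "(\<lambda>\<omega>. (u, \<omega>)) -` ({s<..t} \<times> B) \<inter> space (F u) = B" using True by auto
    ultimately show ?thesis by simp
  next
    case False
    then have "(\<lambda>\<omega>. (u, \<omega>)) -` ({s<..t} \<times> B) \<inter> space (F u) = {}" by auto
    then show ?thesis by simp
  qed
qed

lemma predictable_adapted:
  assumes "filtration_on M F" "predictable M F X" "0 \<le> u"
  shows "X u \<in> borel_measurable (F u)"
  using measurable_compose[OF measurable_section_predictable[OF assms(1,3)] assms(2)[unfolded predictable_def]] by simp

text \<open>Clamping the time to [0, u] serves two purposes: it makes the map total on the real
  line, although predictable sets live on nonnegative times, and it lets only information of
  \<open>F u\<close> enter. Composing with it shows that predictable processes are
  progressive.\<close>

lemma measurable_progressive_predictable: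
  assumes F: "filtration_on M F" and u: "0 \<le> u"
  shows "(\<lambda>(s, \<omega>). (max 0 (min u s), \<omega>)) \<in> measurable (borel \<Otimes>\<^sub>M F u) (predictable_sigma M F)"
proof (rule measurable_predictable_sigmaI[OF F])
  have sp: "space (borel \<Otimes>\<^sub>M F u) = UNIV \<times> space M" by (simp add: space_pair_measure filtration_on_space[OF F u])
  show "(\<lambda>(s, \<omega>). (max 0 (min u s), \<omega>)) \<in> space (borel \<Otimes>\<^sub>M F u) \<rightarrow> {0..} \<times> space M"
    unfolding sp by auto
  fix B assume "B \<in> sets (F 0)"
  then have B: "B \<in> sets (F u)" using filtration_on_mono[OF F] u by blast
  from sets.sets_into_space[OF B]
  have "(\<lambda>(s, \<omega>). (max 0 (min u s), \<omega>)) -` ({0} \<times> B) \<inter> space (borel \<Otimes>\<^sub>M F u) = {s. max 0 (min u s) = 0} \<times> B"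
    by (auto simp: space_pair_measure)
  moreover have "{s. max 0 (min u s) = 0} \<in> sets borel" by measurable
  ultimately show "(\<lambda>(s, \<omega>). (max 0 (min u s), \<omega>)) -` ({0} \<times> B) \<inter> space (borel \<Otimes>\<^sub>M F u) \<in> sets (borel \<Otimes>\<^sub>M F u)"
    using B by simp
next
  fix s t B assume st: "0 \<le> s" "s \<le> t" and B: "B \<in> sets (F s)"
  show "(\<lambda>(s, \<omega>). (max 0 (min u s), \<omega>)) -` ({s<..t} \<times> B) \<inter> space (borel \<Otimes>\<^sub>M F u) \<in> sets (borel \<Otimes>\<^sub>M F u)"
  proof (cases "s < u")
    case True
    then have B': "B \<in> sets (F u)" using filtration_on_mono[OF F st(1) _ B] by auto
    from sets.sets_into_space[OF B']
    have "(\<lambda>(s, \<omega>). (max 0 (min u s), \<omega>)) -` ({s<..t} \<times> B) \<inter> space (borel \<Otimes>\<^sub>M F u) = {r. s < max 0 (min u r) \<and> max 0 (min u r) \<le> t} \<times> B"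
      by (auto simp: space_pair_measure)
    moreover have "{r. s < max 0 (min u r) \<and> max 0 (min u r) \<le> t} \<in> sets borel" by measurable
    ultimately show ?thesis using B' by simp
  next
    case False
    then have "(\<lambda>(s, \<omega>). (max 0 (min u s), \<omega>)) -` ({s<..t} \<times> B) \<inter> space (borel \<Otimes>\<^sub>M F u) = {}"
      using st by auto
    then show ?thesis by (simp only: sets.empty_sets)
  qed
qed

lemma predictable_progressive:
  assumes "filtration_on M F" "predictable M F X" "0 \<le> u"
  shows "(\<lambda>(s, \<omega>). X (max 0 (min u s)) \<omega>) \<in> borel_measurable (borel \<Otimes>\<^sub>M F u)"
  using measurable_compose[OF measurable_progressive_predictable[OF assms(1,3)] assms(2)[unfolded predictable_def]]
  by (simp add: case_prod_beta')

text \<open>Needed to evaluate predictable processes at the random time: on the generating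
  rectangles the preimage is an event about \<theta> intersected with B.\<close>

lemma measurable_graph_predictable:
  assumes F: "filtration_on M F" and \<theta>[measurable]: "\<theta> \<in> borel_measurable M" and nn: "\<And>\<omega>. \<omega> \<in> space M \<Longrightarrow> 0 \<le> \<theta> \<omega>"
  shows "(\<lambda>\<omega>. (\<theta> \<omega> :: real, \<omega>)) \<in> measurable M (predictable_sigma M F)"
proof (rule measurable_predictable_sigmaI[OF F])
  show "(\<lambda>\<omega>. (\<theta> \<omega>, \<omega>)) \<in> space M \<rightarrow> {0..} \<times> space M" using nn by auto
  fix B assume "B \<in> sets (F 0)"
  then have [measurable]: "B \<in> sets M" using filtration_on_sets[OF F] by auto
  have "(\<lambda>\<omega>. (\<theta> \<omega>, \<omega>)) -` ({0} \<times> B) \<inter> space M = {\<omega>\<in>space M. \<theta> \<omega> = 0} \<inter> B" by auto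
  then show "(\<lambda>\<omega>. (\<theta> \<omega>, \<omega>)) -` ({0} \<times> B) \<inter> space M \<in> sets M" by simp
next
  fix s t B assume st: "0 \<le> s" "s \<le> t" and B: "B \<in> sets (F s)"
  then have [measurable]: "B \<in> sets M" using filtration_on_sets[OF F] by auto
  have "(\<lambda>\<omega>. (\<theta> \<omega>, \<omega>)) -` ({s<..t} \<times> B) \<inter> space M = {\<omega>\<in>space M. s < \<theta> \<omega> \<and> \<theta> \<omega> \<le> t} \<inter> B" by auto
  then show "(\<lambda>\<omega>. (\<theta> \<omega>, \<omega>)) -` ({s<..t} \<times> B) \<inter> space M \<in> sets M" by simp
qed

lemma optional_generator_subset:
  "{{(s, \<omega>). 0 \<le> s \<and> \<omega> \<in> space M \<and> \<rho> \<omega> \<le> ereal s} | \<rho>. stopping_time_on F \<rho>} \<subseteq> Pow ({0..} \<times> space M)"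
  by auto

text \<open>The section at u of a generator, the stochastic interval that starts at a stopping time
  \<rho>, is the event {\<rho> \<le> u}.\<close>

lemma optional_adapted:
  assumes F: "filtration_on M F" and X: "optional M F X" and u: "0 \<le> u"
  shows "X u \<in> borel_measurable (F u)"
proof -
  have "(\<lambda>\<omega>. (u, \<omega>)) \<in> measurable (F u) (optional_sigma M F)"
    unfolding optional_sigma_def
  proof (rule measurable_measure_of[OF optional_generator_subset])
    show "(\<lambda>\<omega>. (u, \<omega>)) \<in> space (F u) \<rightarrow> {0..} \<times> space M" using u filtration_on_space[OF F u] by auto
    fix A assume "A \<in> {{(s, \<omega>). 0 \<le> s \<and> \<omega> \<in> space M \<and> \<rho> \<omega> \<le> ereal s} | \<rho>. stopping_time_on F \<rho>}"
    then obtain \<rho> where \<rho>: "A = {(s, \<omega>). 0 \<le> s \<and> \<omega> \<in> space M \<and> \<rho> \<omega> \<le> ereal s}" "stopping_time_on F \<rho>" by blast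
    have "(\<lambda>\<omega>. (u, \<omega>)) -` A \<inter> space (F u) = {\<omega>\<in>space (F u). \<rho> \<omega> \<le> ereal u}"
      unfolding \<rho>(1) using u filtration_on_space[OF F u] by auto
    then show "(\<lambda>\<omega>. (u, \<omega>)) -` A \<inter> space (F u) \<in> sets (F u)" using \<rho>(2) u by (simp add: stopping_time_on_def)
  qed
  from measurable_compose[OF this X[unfolded optional_def]] show ?thesis by simp
qed

section \<open>Predictability of step processes and of left limits\<close>

lemma measurable_fst_predictable:
  assumes F: "filtration_on M F"
  shows "fst \<in> borel_measurable (predictable_sigma M F)"
proof (rule borel_measurable_iff_le[THEN iffD2], rule allI)
  fix b :: real
  have top: "space M \<in> sets (F 0)" using sets.top[of "F 0"] filtration_on_space[OF F, of 0] by simp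
  have "{w \<in> space (predictable_sigma M F). fst w \<le> b} = (if 0 \<le> b then {0} \<times> space M \<union> {0<..b} \<times> space M else {})"
    using F by auto
  then show "{w \<in> space (predictable_sigma M F). fst w \<le> b} \<in> sets (predictable_sigma M F)"
    using predictable_sigma_rectangle[OF F _ top, of b] predictable_sigma_zero[OF F top] by auto
qed

lemma predictable_step:
  fixes h :: "'a \<Rightarrow> real"
  assumes F: "filtration_on M F" and a: "0 \<le> a" and h: "h \<in> borel_measurable (F a)"
  shows "(\<lambda>(v, \<omega>). if a < v \<and> v \<le> b then h \<omega> else 0) \<in> borel_measurable (predictable_sigma M F)"
proof (rule measurableI)
  fix A :: "real set" assume A: "A \<in> sets borel"
  have 1: "h -` A \<inter> space (F a) \<in> sets (F a)" using h A by (rule measurable_sets)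
  have 2: "space M \<in> sets (F a)" using sets.top[of "F a"] filtration_on_space[OF F a] by simp
  have "(\<lambda>(v, \<omega>). if a < v \<and> v \<le> b then h \<omega> else 0) -` A \<inter> space (predictable_sigma M F)
    = {a<..b} \<times> (h -` A \<inter> space (F a)) \<union> (if 0 \<in> A then space (predictable_sigma M F) - {a<..b} \<times> space M else {})"
    using a F filtration_on_space[OF F a] by (auto split: if_splits)
  also have "\<dots> \<in> sets (predictable_sigma M F)"
    using predictable_sigma_rectangle[OF F a 1, of b] predictable_sigma_rectangle[OF F a 2, of b] by auto
  finally show "(\<lambda>(v, \<omega>). if a < v \<and> v \<le> b then h \<omega> else 0) -` A \<inter> space (predictable_sigma M F) \<in> sets (predictable_sigma M F)" .
qed simp

text \<open>The ceiling minus one lies strictly below w even when w is dyadic, in contrast to the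
  floor; a left limit at w is thus approached from strictly smaller grid times.\<close>

definition dyadic_below :: "nat \<Rightarrow> real \<Rightarrow> real" where
  "dyadic_below n w = real (nat (\<lceil>2 ^ n * w\<rceil> - 1)) / 2 ^ n"

lemma dyadic_below_bounds:
  assumes "0 < w"
  shows "0 \<le> dyadic_below n w" "dyadic_below n w < w" "w \<le> dyadic_below n w + 1 / 2 ^ n"
proof -
  have "0 < 2 ^ n * w" using assms by simp
  then have "real (nat (\<lceil>2 ^ n * w\<rceil> - 1)) = of_int \<lceil>2 ^ n * w\<rceil> - 1" by auto
  then have "real (nat (\<lceil>2 ^ n * w\<rceil> - 1)) < 2 ^ n * w" "2 ^ n * w \<le> real (nat (\<lceil>2 ^ n * w\<rceil> - 1)) + 1"
    by linarith+
  then show "dyadic_below n w < w" "w \<le> dyadic_below n w + 1 / 2 ^ n"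
    unfolding dyadic_below_def by (auto simp: field_simps)
qed (simp add: dyadic_below_def)

lemma dyadic_below_tendsto:
  assumes "0 < w" "a + w = v"
  shows "filterlim (\<lambda>n. a + dyadic_below n w) (at_left v) sequentially"
  unfolding filterlim_at
proof
  show "\<forall>\<^sub>F n in sequentially. a + dyadic_below n w \<in> {..<v} \<and> a + dyadic_below n w \<noteq> v"
    using dyadic_below_bounds(2)[OF assms(1)] assms(2) by (intro always_eventually) (auto simp: less_imp_neq)
  have lim: "(\<lambda>n. v - 1 / 2 ^ n) \<longlonglongrightarrow> v"
    using tendsto_diff[OF tendsto_const LIMSEQ_inverse_realpow_zero[of 2], of v] by (simp add: inverse_eq_divide)
  have "v - 1 / 2 ^ n \<le> a + dyadic_below n w" "a + dyadic_below n w \<le> v" for n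
    using dyadic_below_bounds[OF assms(1), of n] assms(2) by linarith+
  then show "(\<lambda>n. a + dyadic_below n w) \<longlonglongrightarrow> v"
    by (intro tendsto_sandwich[OF always_eventually always_eventually lim tendsto_const]) auto
qed

text \<open>On each cell (a + k/2^n, a + (k+1)/2^n] the approximating process carries the value at
  the left endpoint, which is known when the cell begins. The grid starts at a and not at 0, so that
  the event B is already known at all of its points.\<close>

lemma predictable_left_limit:
  assumes F: "filtration_on M F" and X: "adapted F X" and lim: "\<And>v \<omega>. \<omega> \<in> space M \<Longrightarrow> 0 < v \<Longrightarrow> ((\<lambda>s. X s \<omega>) \<longlongrightarrow> L v \<omega>) (at_left v)"
    and a: "0 \<le> a" and B: "B \<in> sets (F a)"
  shows "(\<lambda>(v, \<omega>). if a < v \<and> v \<le> b then indicator B \<omega> * L v \<omega> else 0) \<in> borel_measurable (predictable_sigma M F)"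
proof (rule borel_measurable_LIMSEQ_real)
  let ?S = "predictable_sigma M F"
  define f where "f n k = (\<lambda>(v, \<omega>). if a + real k / 2 ^ n < v \<and> v \<le> a + (real k + 1) / 2 ^ n
      then indicator B \<omega> * X (a + real k / 2 ^ n) \<omega> else 0)" for n k :: nat
  define g where "g n = (\<lambda>w. if a < fst w \<and> fst w \<le> b then f n (nat (\<lceil>2 ^ n * (fst w - a)\<rceil> - 1)) w else 0)" for n
  note [measurable] = measurable_fst_predictable[OF F]
  have f[measurable]: "f n k \<in> borel_measurable ?S" for n k
    unfolding f_def
  proof (rule predictable_step[OF F])
    have "0 \<le> a + real k / 2 ^ n" "a \<le> a + real k / 2 ^ n" using a by auto
    then have "B \<in> sets (F (a + real k / 2 ^ n))" "X (a + real k / 2 ^ n) \<in> borel_measurable (F (a + real k / 2 ^ n))"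
      using X filtration_on_mono[OF F a _ B] unfolding adapted_def by auto
    then show "(\<lambda>\<omega>. indicator B \<omega> * X (a + real k / 2 ^ n) \<omega>) \<in> borel_measurable (F (a + real k / 2 ^ n))"
      by (intro borel_measurable_times borel_measurable_indicator)
    show "0 \<le> a + real k / 2 ^ n" by fact
  qed
  have "(\<lambda>w. f n (nat (\<lceil>2 ^ n * (fst w - a)\<rceil> - 1)) w) \<in> borel_measurable ?S" for n
    by (rule measurable_compose_countable[OF f]) measurable
  then show "g n \<in> borel_measurable ?S" for n unfolding g_def by measurable
  fix w assume w: "w \<in> space ?S"
  obtain v \<omega> where vw: "w = (v, \<omega>)" by fastforce
  then have \<omega>: "\<omega> \<in> space M" using w F by auto
  show "(\<lambda>n. g n w) \<longlonglongrightarrow> (case w of (v, \<omega>) \<Rightarrow> if a < v \<and> v \<le> b then indicator B \<omega> * L v \<omega> else 0)"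
  proof (cases "a < v \<and> v \<le> b")
    case True
    then have pos: "0 < v - a" "0 < v" using a by auto
    have "g n w = indicator B \<omega> * X (a + dyadic_below n (v - a)) \<omega>" for n
    proof -
      define k where "k = nat (\<lceil>2 ^ n * (v - a)\<rceil> - 1)"
      have db: "dyadic_below n (v - a) = real k / 2 ^ n" by (simp only: dyadic_below_def k_def)
      have "a + real k / 2 ^ n < v" "v \<le> a + (real k + 1) / 2 ^ n"
        using dyadic_below_bounds[OF pos(1), of n] unfolding db add_divide_distrib by linarith+
      then have "f n k (v, \<omega>) = indicator B \<omega> * X (a + real k / 2 ^ n) \<omega>" by (simp add: f_def)
      moreover have "g n w = f n k (v, \<omega>)" using True by (simp add: g_def vw k_def)
      ultimately show ?thesis unfolding db by simp
    qed
    moreover have "(\<lambda>n. X (a + dyadic_below n (v - a)) \<omega>) \<longlonglongrightarrow> L v \<omega>"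
      by (rule filterlim_compose[OF lim[OF \<omega> pos(2)] dyadic_below_tendsto]) (use pos in auto)
    ultimately show ?thesis using True by (auto simp: vw intro!: tendsto_mult)
  qed (auto simp: vw g_def)
qed

text \<open>By right continuity the process is a limit of its values at \<open>dyadic_above\<close>,
  and these depend on time only through a countable index. The clamp at 0 covers negative times,
  where nothing is known about X.\<close>

lemma cadlag_jointly_measurable:
  fixes X :: "real \<Rightarrow> 'a \<Rightarrow> real"
  assumes rc: "\<And>\<omega> t. \<omega> \<in> space M \<Longrightarrow> 0 \<le> t \<Longrightarrow> continuous (at_right t) (\<lambda>s. X s \<omega>)"
    and X: "\<And>t. 0 \<le> t \<Longrightarrow> X t \<in> borel_measurable M"
  shows "(\<lambda>(v, \<omega>). X (max 0 v) \<omega>) \<in> borel_measurable (borel \<Otimes>\<^sub>M M)"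
proof (rule borel_measurable_LIMSEQ_real)
  define f where "f n k = (\<lambda>w :: real \<times> 'a. X (real (Suc k) / 2 ^ n) (snd w))" for n k :: nat
  have X'[measurable]: "X (real (Suc k) / 2 ^ n) \<in> borel_measurable M" for n k by (rule X) simp
  have [measurable]: "f n k \<in> borel_measurable (borel \<Otimes>\<^sub>M M)" for n k unfolding f_def by measurable
  show "(\<lambda>w. f n (nat \<lfloor>2 ^ n * max 0 (fst w)\<rfloor>) w) \<in> borel_measurable (borel \<Otimes>\<^sub>M M)" for n
    by (rule measurable_compose_countable) measurable
  fix w :: "real \<times> 'a" assume w: "w \<in> space (borel \<Otimes>\<^sub>M M)"
  then have \<omega>: "snd w \<in> space M" by (auto simp: space_pair_measure)
  have "((\<lambda>s. X s (snd w)) \<longlongrightarrow> X (max 0 (fst w)) (snd w)) (at_right (max 0 (fst w)))"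
    using rc[OF \<omega>, of "max 0 (fst w)"] by (simp add: continuous_within)
  moreover have "filterlim (\<lambda>n. dyadic_above n (max 0 (fst w))) (at_right (max 0 (fst w))) sequentially"
    by (rule filterlim_mono[OF dyadic_above_tendsto]) (auto intro: at_le)
  ultimately have "(\<lambda>n. X (dyadic_above n (max 0 (fst w))) (snd w)) \<longlonglongrightarrow> X (max 0 (fst w)) (snd w)"
    by (rule filterlim_compose)
  then show "(\<lambda>n. f n (nat \<lfloor>2 ^ n * max 0 (fst w)\<rfloor>) w) \<longlonglongrightarrow> (case w of (v, \<omega>) \<Rightarrow> X (max 0 v) \<omega>)"
    by (simp add: f_def dyadic_above_def case_prod_beta')
qed

section \<open>The compensator of the random time\<close>

locale invariance_time =
  fixes Q P :: "'a measure" and G F :: "real \<Rightarrow> 'a measure" and \<tau> :: "'a \<Rightarrow> ereal"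
    and \<gamma> :: "real \<Rightarrow> 'a \<Rightarrow> real" and T :: real
  assumes Q: "prob_space Q"
    and G: "usual_conditions Q G"
    and F: "usual_conditions Q F"
    and FG: "\<forall>s\<ge>0. sets (F s) \<subseteq> sets (G s)"
    and tau_st: "stopping_time_on G \<tau>"
    and tau_pos: "\<forall>\<omega>\<in>space Q. 0 < \<tau> \<omega>"
    and key: "\<forall>s\<ge>0. \<forall>B\<in>sets (G s). \<exists>B'\<in>sets (F s).
               B \<inter> {\<omega>. ereal s < \<tau> \<omega>} = B' \<inter> {\<omega>. ereal s < \<tau> \<omega>}"
    and T_pos: "0 < T"
    and gamma_nn: "\<forall>s \<omega>. 0 \<le> \<gamma> s \<omega>"
    and gamma_pred: "predictable Q F \<gamma>"
    and Ca: "has_intensity Q G \<tau> \<gamma>"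
    and Cb: "AE \<omega> in Q. 0 < real_cond_exp Q (F T) (\<lambda>\<omega>. indicator {\<omega>. ereal T < \<tau> \<omega>} \<omega>) \<omega>"
    and P: "prob_space P" "sets P = sets Q"
    and P_equiv: "\<forall>B\<in>sets (F T). emeasure P B = 0 \<longleftrightarrow> emeasure Q B = 0"
    and Cc: "\<forall>X. local_martingale P F X \<longrightarrow> local_martingale_upto Q G (stopped_left X \<tau>) T"
begin

sublocale Q: prob_space Q by (rule Q)
sublocale P: prob_space P by (rule P)
sublocale LQ: pair_sigma_finite lborel Q by unfold_locales
sublocale LP: pair_sigma_finite lborel P by unfold_locales

lemma G_filt: "filtration_on Q G" and F_filt: "filtration_on Q F"
  using G F by (auto simp: usual_conditions_def)

lemma space_P: "space P = space Q" using sets_eq_imp_space_eq[OF P(2)] .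

lemma F_sub: "0 \<le> u \<Longrightarrow> subalgebra Q (F u)" by (rule filtration_on_subalgebra[OF F_filt])

lemma F_sub_P: "0 \<le> u \<Longrightarrow> subalgebra P (F u)"
  using F_sub space_P P(2) by (simp add: subalgebra_def)

lemma G_sub: "0 \<le> u \<Longrightarrow> subalgebra Q (G u)" by (rule filtration_on_subalgebra[OF G_filt])

lemma F_le_G: "0 \<le> u \<Longrightarrow> B \<in> sets (F u) \<Longrightarrow> B \<in> sets (G u)" using FG by auto

lemma borel_P: "f \<in> borel_measurable P \<longleftrightarrow> f \<in> borel_measurable Q"
  using measurable_cong_sets[OF P(2) refl] by auto

lemma tau_le_G: "0 \<le> u \<Longrightarrow> {\<omega>\<in>space Q. \<tau> \<omega> \<le> ereal u} \<in> sets (G u)"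
  using tau_st filtration_on_space[OF G_filt] unfolding stopping_time_on_def by auto

lemma tau_less_G:
  assumes "0 \<le> u" shows "{\<omega>\<in>space Q. ereal u < \<tau> \<omega>} \<in> sets (G u)"
proof -
  have "{\<omega>\<in>space Q. ereal u < \<tau> \<omega>} = space (G u) - {\<omega>\<in>space Q. \<tau> \<omega> \<le> ereal u}"
    using filtration_on_space[OF G_filt assms] by auto
  then show ?thesis using tau_le_G[OF assms] by auto
qed

lemma stopping_time_measurable:
  assumes "stopping_time_on H \<theta>" "filtration_on Q H"
  shows "\<theta> \<in> borel_measurable Q"
proof (rule borel_measurableI_le)
  fix a :: ereal
  have nn: "0 \<le> \<theta> \<omega>" if "\<omega> \<in> space Q" for \<omega>
    using assms filtration_on_space[OF assms(2), of 0] that by (simp add: stopping_time_on_def)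
  show "{x \<in> space Q. \<theta> x \<le> a} \<in> sets Q"
  proof (cases a)
    case (real r)
    show ?thesis
    proof (cases "0 \<le> r")
      case True
      then have "{x \<in> space (H r). \<theta> x \<le> ereal r} \<in> sets (H r)" using assms(1) by (simp add: stopping_time_on_def)
      then have "{x \<in> space (H r). \<theta> x \<le> ereal r} \<in> sets Q" by (rule filtration_on_sets[OF assms(2) True])
      then show ?thesis unfolding filtration_on_space[OF assms(2) True] real .
    next
      case False
      have "\<not> \<theta> x \<le> a" if "x \<in> space Q" for x
      proof
        assume "\<theta> x \<le> a"
        then have "0 \<le> ereal r" using nn[OF that] real by (metis order.trans)
        then show False using False by simp
      qed
      then have "{x \<in> space Q. \<theta> x \<le> a} = {}" by blast
      then show ?thesis by (simp only: sets.empty_sets)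
    qed
  next
    case MInf
    then have "{x \<in> space Q. \<theta> x \<le> a} = {}" using nn by force
    then show ?thesis by (simp only: sets.empty_sets)
  qed simp
qed

lemma tau_meas[measurable]: "\<tau> \<in> borel_measurable Q"
  by (rule stopping_time_measurable[OF tau_st G_filt])

abbreviation alive :: "real \<Rightarrow> 'a \<Rightarrow> ennreal" where
  "alive u \<omega> \<equiv> indicator {\<omega>. ereal u < \<tau> \<omega>} \<omega>"

text \<open>Predictability says nothing about \<^term>\<open>\<gamma>\<close> at negative times, so \<^term>\<open>\<gamma>\<close> itself need not be jointly
  measurable; clamping time to \<open>[0, T]\<close> repairs this.\<close>
definition gam :: "real \<Rightarrow> 'a \<Rightarrow> real" where
  "gam s \<omega> = \<gamma> (max 0 (min T s)) \<omega>"

lemma gam_eq: "0 \<le> s \<Longrightarrow> s \<le> T \<Longrightarrow> gam s \<omega> = \<gamma> s \<omega>" by (simp add: gam_def max_def min_def)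

lemma gam_nonneg: "0 \<le> gam s \<omega>" using gamma_nn by (simp add: gam_def)

lemma gam_meas_T: "(\<lambda>(s, \<omega>). gam s \<omega>) \<in> borel_measurable (borel \<Otimes>\<^sub>M F T)"
  using predictable_progressive[OF F_filt gamma_pred, of T] T_pos by (simp add: gam_def)

lemma progressive_to_Q:
  assumes "f \<in> measurable (borel \<Otimes>\<^sub>M F u) N" "0 \<le> u" shows "f \<in> measurable (lborel \<Otimes>\<^sub>M Q) N"
proof -
  have "(\<lambda>x. x) \<in> measurable (lborel \<Otimes>\<^sub>M Q) (borel \<Otimes>\<^sub>M F u)"
  proof (rule measurable_pair)
    have "(\<lambda>\<omega>. \<omega>) \<in> measurable Q (F u)"
      by (rule measurableI) (use F_sub[OF assms(2)] in \<open>auto simp: subalgebra_def\<close>)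
    then show "snd \<circ> (\<lambda>x. x) \<in> measurable (lborel \<Otimes>\<^sub>M Q) (F u)"
      using measurable_compose[OF measurable_snd] by (simp add: comp_def)
  qed (simp add: comp_def)
  from measurable_compose[OF this assms(1)] show ?thesis by simp
qed

lemma gam_meas[measurable]: "(\<lambda>(s, \<omega>). gam s \<omega>) \<in> borel_measurable (lborel \<Otimes>\<^sub>M Q)"
  by (rule progressive_to_Q[OF gam_meas_T]) (use T_pos in simp)

lemma gam_meas'[measurable (raw)]:
  assumes "f \<in> borel_measurable M" "g \<in> measurable M Q"
  shows "(\<lambda>x. gam (f x) (g x)) \<in> borel_measurable M"
proof -
  have "f \<in> measurable M lborel" using assms(1) by simp
  from measurable_compose[OF measurable_Pair[OF this assms(2)] gam_meas] show ?thesis by simp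
qed

lemma gam_path[measurable]: "\<omega> \<in> space Q \<Longrightarrow> (\<lambda>s. gam s \<omega>) \<in> borel_measurable borel"
  by measurable

lemma gamma_stopped_integral_eq:
  assumes "0 \<le> a" "b \<le> T"
  shows "(\<integral>\<^sup>+ s\<in>{a<..b}. ennreal (\<gamma> s \<omega> * indicator {s. ereal s \<le> \<tau> \<omega>} s) \<partial>lborel)
    = (\<integral>\<^sup>+ s\<in>{a<..b}. ennreal (gam s \<omega> * indicator {s. ereal s \<le> \<tau> \<omega>} s) \<partial>lborel)"
  using assms by (intro nn_integral_cong) (auto simp: indicator_def gam_eq)

text \<open>The increment of 1_{[\<tau>,\<infinity>)} and that of the integrated intensity have the
  same expectation on B, once the localization in \<open>has_intensity\<close> is removed. The jump
  part is bounded by 1. The compensator is shown to be integrable and then dominates its own stopped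
  versions, because it is nondecreasing.\<close>

lemma compensator_rectangle:
  assumes st: "0 \<le> s" "s \<le> t" "t \<le> T" and B: "B \<in> sets (G s)"
  shows "emeasure Q {\<omega>\<in>B. ereal s < \<tau> \<omega> \<and> \<tau> \<omega> \<le> ereal t}
    = (\<integral>\<^sup>+\<omega>. indicator B \<omega> * (\<integral>\<^sup>+ r\<in>{s<..t}. ennreal (gam r \<omega> * indicator {r. ereal r \<le> \<tau> \<omega>} r) \<partial>lborel) \<partial>Q)"
proof -
  define N where "N u \<omega> = (indicator {\<omega>. \<tau> \<omega> \<le> ereal u} \<omega> :: real)" for u \<omega>
  define C where "C u \<omega> = enn2real (\<integral>\<^sup>+ r\<in>{0<..u}. ennreal (\<gamma> r \<omega> * indicator {r. ereal r \<le> \<tau> \<omega>} r) \<partial>lborel)" for u \<omega>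
  define X where "X u \<omega> = N u \<omega> - C u \<omega>" for u \<omega>
  have X: "local_martingale Q G X" using Ca unfolding has_intensity_def X_def N_def C_def by simp
  have fin: "AE \<omega> in Q. \<forall>u\<ge>0. (\<integral>\<^sup>+ r\<in>{0<..u}. ennreal (\<gamma> r \<omega> * indicator {r. ereal r \<le> \<tau> \<omega>} r) \<partial>lborel) < \<infinity>"
    using Ca unfolding has_intensity_def by simp
  have C_nonneg: "0 \<le> C u \<omega>" for u \<omega> by (simp add: C_def)
  have C_0: "C 0 \<omega> = 0" for \<omega> by (simp add: C_def)
  have C_mono: "AE \<omega> in Q. \<forall>u v. 0 \<le> u \<longrightarrow> u \<le> v \<longrightarrow> C u \<omega> \<le> C v \<omega>"
    using fin
  proof eventually_elim
    case (elim \<omega>)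
    show ?case unfolding C_def
      by (intro allI impI enn2real_mono) (use elim in \<open>auto intro!: nn_integral_mono simp: indicator_def\<close>)
  qed
  obtain \<rho> where \<rho>: "\<And>n. stopping_time_on G (\<rho> n)"
    "AE \<omega> in Q. \<forall>c::real. \<forall>\<^sub>F n in sequentially. ereal c < \<rho> n \<omega>"
    "\<And>n t. 0 \<le> t \<Longrightarrow> integrable Q (stopped X (\<rho> n) t)"
    "\<And>n s t B. 0 \<le> s \<Longrightarrow> s \<le> t \<Longrightarrow> B \<in> sets (G s) \<Longrightarrow>
       (\<integral>\<omega>. indicator B \<omega> * stopped X (\<rho> n) t \<omega> \<partial>Q) = (\<integral>\<omega>. indicator B \<omega> * stopped X (\<rho> n) s \<omega> \<partial>Q)"
    using Q.local_martingale_stopped_integral[OF G_sub X] by blast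
  have \<rho>_nonneg: "0 \<le> \<rho> n \<omega>" if "\<omega> \<in> space Q" for n \<omega>
    using \<rho>(1)[of n] that filtration_on_space[OF G_filt, of 0] by (simp add: stopping_time_on_def)
  note [measurable] = stopping_time_measurable[OF \<rho>(1) G_filt]
  define Ns where "Ns n u = stopped N (\<rho> n) u" for n u
  define Cs where "Cs n u = stopped C (\<rho> n) u" for n u
  have X_eq: "stopped X (\<rho> n) u \<omega> = Ns n u \<omega> - Cs n u \<omega>" for n u \<omega>
    by (simp add: stopped_def X_def Ns_def Cs_def)
  have [measurable]: "N u \<in> borel_measurable Q" for u unfolding N_def by measurable
  have Ns_meas[measurable]: "Ns n u \<in> borel_measurable Q" for n u
    unfolding Ns_def stopped_def N_def by measurable
  have Ns_bounds: "0 \<le> Ns n u \<omega> \<and> Ns n u \<omega> \<le> 1" for n u \<omega>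
    by (simp add: Ns_def stopped_def N_def)
  have Ns_int: "integrable Q (Ns n u)" for n u
    by (rule Q.integrable_const_bound[where B = 1]) (use Ns_bounds in auto)
  have Cs_eq: "Cs n u = (\<lambda>\<omega>. Ns n u \<omega> - stopped X (\<rho> n) u \<omega>)" for n u unfolding X_eq by simp
  have Cs_int: "integrable Q (Cs n u)" if "0 \<le> u" for n u
    unfolding Cs_eq using Ns_int \<rho>(3)[OF that] by simp
  have Cs_nonneg: "0 \<le> Cs n u \<omega>" for n u \<omega> by (simp add: Cs_def stopped_def C_nonneg)
  have Cs_le: "AE \<omega> in Q. Cs n u \<omega> \<le> C u \<omega>" if u: "0 \<le> u" for n u
    using C_mono AE_space
  proof eventually_elim
    case (elim \<omega>)
    then show ?case using stopped_eq_at_time[of "\<rho> n" \<omega> u C, OF \<rho>_nonneg u] unfolding Cs_def by auto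
  qed
  have ev: "AE \<omega> in Q. \<forall>\<^sub>F n in sequentially. Cs n u \<omega> = C u \<omega> \<and> Ns n u \<omega> = N u \<omega>" if "0 \<le> u" for u
    using \<rho>(2)
  proof eventually_elim
    case (elim \<omega>)
    then have "\<forall>\<^sub>F n in sequentially. ereal u < \<rho> n \<omega>" by blast
    then show ?case by eventually_elim (simp add: Cs_def Ns_def stopped_before)
  qed
  \<comment> \<open>Measurability is read off from the adaptedness of the local martingale, since C
    is written with \<open>\<gamma>\<close> and not with a jointly measurable version of it.\<close>
  have C_meas[measurable]: "C u \<in> borel_measurable Q" if "0 \<le> u" for u
  proof -
    have "X u \<in> borel_measurable (G u)"
      using X that unfolding local_martingale_def adapted_def by blast
    then have "X u \<in> borel_measurable Q" by (rule filtration_on_borel[OF G_filt that])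
    then have "(\<lambda>\<omega>. N u \<omega> - X u \<omega>) \<in> borel_measurable Q" by measurable
    then show ?thesis by (simp add: X_def)
  qed
  have diff: "(\<integral>\<omega>. indicator B \<omega> * Cs n v \<omega> \<partial>Q) - (\<integral>\<omega>. indicator B \<omega> * Cs n u \<omega> \<partial>Q)
      = (\<integral>\<omega>. indicator B \<omega> * Ns n v \<omega> \<partial>Q) - (\<integral>\<omega>. indicator B \<omega> * Ns n u \<omega> \<partial>Q)"
    if uv: "0 \<le> u" "u \<le> v" "B \<in> sets (G u)" for n u v B
  proof -
    have B: "B \<in> sets Q" using filtration_on_sets[OF G_filt uv(1,3)] .
    have *: "(\<integral>\<omega>. indicator B \<omega> * stopped X (\<rho> n) r \<omega> \<partial>Q) = (\<integral>\<omega>. indicator B \<omega> * Ns n r \<omega> \<partial>Q) - (\<integral>\<omega>. indicator B \<omega> * Cs n r \<omega> \<partial>Q)"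
      if "0 \<le> r" for r
      unfolding X_eq right_diff_distrib
      using integrable_real_mult_indicator[OF B Ns_int[of n r]] integrable_real_mult_indicator[OF B Cs_int[OF that, of n]]
      by (intro Bochner_Integration.integral_diff) (auto simp: mult.commute)
    show ?thesis using \<rho>(4)[OF uv, of n] *[of u] *[of v] uv by simp
  qed
  \<comment> \<open>Since \<tau> > 0, both stopped parts vanish at time 0, so the stopped
    compensator has the same expectation as the stopped jump process, hence at most 1; Fatou passes
    this bound to the limit.\<close>
  have C_int: "integrable Q (C u)" if u: "0 \<le> u" for u
  proof (rule integrableI_nonneg)
    have "(\<integral>\<omega>. Cs n u \<omega> \<partial>Q) \<le> 1" for n
    proof -
      have top: "space Q \<in> sets (G 0)" using sets.top[of "G 0"] filtration_on_space[OF G_filt, of 0] by simp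
      have "Cs n 0 \<omega> = 0 \<and> Ns n 0 \<omega> = 0" if "\<omega> \<in> space Q" for \<omega>
      proof
        show "Cs n 0 \<omega> = 0"
          using stopped_eq_at_time[of "\<rho> n" \<omega> 0 C, OF \<rho>_nonneg[OF that]] C_0 unfolding Cs_def by auto
        have "N 0 \<omega> = 0" using tau_pos that by (auto simp: N_def zero_ereal_def[symmetric] not_le indicator_def dest: leD)
        then show "Ns n 0 \<omega> = 0"
          using stopped_eq_at_time[of "\<rho> n" \<omega> 0 N, OF \<rho>_nonneg[OF that]] unfolding Ns_def by auto
      qed
      then have "(\<integral>\<omega>. indicator (space Q) \<omega> * Cs n 0 \<omega> \<partial>Q) = 0" "(\<integral>\<omega>. indicator (space Q) \<omega> * Ns n 0 \<omega> \<partial>Q) = 0"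
        by (auto intro!: Bochner_Integration.integral_eq_zero_AE)
      then have "(\<integral>\<omega>. Cs n u \<omega> \<partial>Q) = (\<integral>\<omega>. Ns n u \<omega> \<partial>Q)"
        using diff[OF order_refl u top, of n]
        by (simp add: Bochner_Integration.integral_cong[OF refl, of Q "\<lambda>\<omega>. indicator (space Q) \<omega> * f \<omega>" f for f])
      also have "\<dots> \<le> (\<integral>\<omega>. 1 \<partial>Q)" by (rule integral_mono[OF Ns_int]) (use Ns_bounds in auto)
      finally show ?thesis by (simp add: Q.prob_space)
    qed
    then have le: "(\<integral>\<^sup>+\<omega>. ennreal (Cs n u \<omega>) \<partial>Q) \<le> 1" for n
      using nn_integral_eq_integral[OF Cs_int[OF u, of n]] Cs_nonneg by (simp add: ennreal_le_1)
    have "(\<integral>\<^sup>+\<omega>. ennreal (C u \<omega>) \<partial>Q) \<le> (\<integral>\<^sup>+\<omega>. liminf (\<lambda>n. ennreal (Cs n u \<omega>)) \<partial>Q)"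
    proof (rule nn_integral_mono_AE)
      show "AE \<omega> in Q. ennreal (C u \<omega>) \<le> liminf (\<lambda>n. ennreal (Cs n u \<omega>))"
        using ev[OF u]
      proof eventually_elim
        case (elim \<omega>)
        then show ?case by (intro Liminf_bounded) (auto elim: eventually_mono)
      qed
    qed
    also have "\<dots> \<le> liminf (\<lambda>n. \<integral>\<^sup>+\<omega>. ennreal (Cs n u \<omega>) \<partial>Q)"
      by (rule nn_integral_liminf) (use borel_measurable_integrable[OF Cs_int[OF u]] in measurable)
    also have "\<dots> \<le> liminf (\<lambda>n. 1)" by (rule Liminf_mono) (use le in auto)
    also have "\<dots> = (1::ennreal)" by (rule Liminf_const) simp
    finally show "(\<integral>\<^sup>+\<omega>. ennreal (C u \<omega>) \<partial>Q) < \<infinity>" by (auto simp: less_top[symmetric] top_unique)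
  qed (use C_nonneg u in auto)
  have B_Q[measurable]: "B \<in> sets Q" using filtration_on_sets[OF G_filt st(1) B] .
  have limC: "(\<lambda>n. \<integral>\<omega>. indicator B \<omega> * Cs n u \<omega> \<partial>Q) \<longlonglongrightarrow> (\<integral>\<omega>. indicator B \<omega> * C u \<omega> \<partial>Q)" if u: "0 \<le> u" for u
  proof (rule integral_dominated_convergence[where w = "C u"])
    show "AE \<omega> in Q. (\<lambda>n. indicator B \<omega> * Cs n u \<omega>) \<longlonglongrightarrow> indicator B \<omega> * C u \<omega>"
      using ev[OF u] by eventually_elim (auto intro!: tendsto_eventually elim!: eventually_mono)
    show "AE \<omega> in Q. norm (indicator B \<omega> * Cs n u \<omega>) \<le> C u \<omega>" for n
      using Cs_le[OF u, of n] by eventually_elim (use Cs_nonneg C_nonneg in \<open>auto simp: indicator_def\<close>)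
  qed (use C_int[OF u] borel_measurable_integrable[OF Cs_int[OF u]] C_meas[OF u] in \<open>measurable\<close>)
  have limN: "(\<lambda>n. \<integral>\<omega>. indicator B \<omega> * Ns n u \<omega> \<partial>Q) \<longlonglongrightarrow> (\<integral>\<omega>. indicator B \<omega> * N u \<omega> \<partial>Q)" if u: "0 \<le> u" for u
  proof (rule integral_dominated_convergence[where w = "\<lambda>_. 1"])
    show "AE \<omega> in Q. (\<lambda>n. indicator B \<omega> * Ns n u \<omega>) \<longlonglongrightarrow> indicator B \<omega> * N u \<omega>"
      using ev[OF u] by eventually_elim (auto intro!: tendsto_eventually elim!: eventually_mono)
    show "AE \<omega> in Q. norm (indicator B \<omega> * Ns n u \<omega>) \<le> 1" for n
      by (rule AE_I2) (use Ns_bounds[of n u] in \<open>auto simp: indicator_def\<close>)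
  qed measurable
  have t: "0 \<le> t" using st by linarith
  have eq: "(\<integral>\<omega>. indicator B \<omega> * C t \<omega> \<partial>Q) - (\<integral>\<omega>. indicator B \<omega> * C s \<omega> \<partial>Q)
      = (\<integral>\<omega>. indicator B \<omega> * N t \<omega> \<partial>Q) - (\<integral>\<omega>. indicator B \<omega> * N s \<omega> \<partial>Q)"
    using tendsto_diff[OF limC[OF t] limC[OF st(1)]] tendsto_diff[OF limN[OF t] limN[OF st(1)]]
    unfolding diff[OF st(1,2) B] by (rule LIMSEQ_unique)
  define D where "D \<omega> = (\<integral>\<^sup>+ r\<in>{s<..t}. ennreal (gam r \<omega> * indicator {r. ereal r \<le> \<tau> \<omega>} r) \<partial>lborel)" for \<omega>
  have D: "AE \<omega> in Q. D \<omega> = ennreal (C t \<omega> - C s \<omega>)"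
    using fin AE_space
  proof eventually_elim
    case (elim \<omega>)
    define g where "g r = gam r \<omega> * indicator {r. ereal r \<le> \<tau> \<omega>} r" for r
    have "D \<omega> = (\<integral>\<^sup>+ r\<in>{s<..t}. ennreal (g r) \<partial>lborel)" by (simp add: D_def g_def)
    also have "\<dots> = ennreal (enn2real (\<integral>\<^sup>+ r\<in>{0<..t}. ennreal (g r) \<partial>lborel) - enn2real (\<integral>\<^sup>+ r\<in>{0<..s}. ennreal (g r) \<partial>lborel))"
    proof (rule nn_integral_increment[where t = s and v = t])
      show "g \<in> borel_measurable borel" unfolding g_def using elim(2) by measurable
      show "(\<integral>\<^sup>+ r\<in>{0<..t}. ennreal (g r) \<partial>lborel) < \<infinity>"
        using elim(1)[rule_format, OF t] gamma_stopped_integral_eq[of 0 t \<omega>] st by (simp add: g_def)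
    qed (use st in \<open>auto simp: g_def gam_nonneg\<close>)
    also have "\<dots> = ennreal (C t \<omega> - C s \<omega>)"
      using gamma_stopped_integral_eq[of 0 t \<omega>] gamma_stopped_integral_eq[of 0 s \<omega>] st by (simp add: C_def g_def)
    finally show ?case .
  qed
  have int: "integrable Q (\<lambda>\<omega>. indicator B \<omega> * C u \<omega>)" "integrable Q (\<lambda>\<omega>. indicator B \<omega> * N u \<omega>)" if "0 \<le> u" for u
  proof -
    show "integrable Q (\<lambda>\<omega>. indicator B \<omega> * C u \<omega>)"
      using integrable_real_mult_indicator[OF B_Q C_int[OF that]] by (simp add: mult.commute)
    show "integrable Q (\<lambda>\<omega>. indicator B \<omega> * N u \<omega>)"
      by (rule Q.integrable_const_bound[where B = 1]) (auto simp: N_def indicator_def)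
  qed
  have le_st: "\<tau> \<omega> \<le> ereal t" if "\<tau> \<omega> \<le> ereal s" for \<omega>
    using that st by (meson ereal_less_eq(3) order.trans)
  then have N_mono: "N s \<omega> \<le> N t \<omega>" for \<omega> by (simp add: N_def indicator_def)
  have "(\<integral>\<^sup>+\<omega>. indicator B \<omega> * D \<omega> \<partial>Q) = (\<integral>\<^sup>+\<omega>. ennreal (indicator B \<omega> * C t \<omega> - indicator B \<omega> * C s \<omega>) \<partial>Q)"
    by (rule nn_integral_cong_AE) (use D in eventually_elim, auto simp: indicator_def)
  also have "\<dots> = ennreal (\<integral>\<omega>. indicator B \<omega> * C t \<omega> - indicator B \<omega> * C s \<omega> \<partial>Q)"
  proof (rule nn_integral_eq_integral)
    show "AE \<omega> in Q. 0 \<le> indicator B \<omega> * C t \<omega> - indicator B \<omega> * C s \<omega>"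
      using C_mono by eventually_elim (use st in \<open>auto simp: indicator_def\<close>)
  qed (intro Bochner_Integration.integrable_diff int st t)
  also have "\<dots> = ennreal (\<integral>\<omega>. indicator B \<omega> * N t \<omega> - indicator B \<omega> * N s \<omega> \<partial>Q)"
    using eq int[OF t] int[OF st(1)] by simp
  also have "\<dots> = (\<integral>\<^sup>+\<omega>. ennreal (indicator B \<omega> * N t \<omega> - indicator B \<omega> * N s \<omega>) \<partial>Q)"
  proof (rule nn_integral_eq_integral[symmetric])
    show "AE \<omega> in Q. 0 \<le> indicator B \<omega> * N t \<omega> - indicator B \<omega> * N s \<omega>"
      using N_mono by (intro AE_I2) (simp add: indicator_def)
  qed (intro Bochner_Integration.integrable_diff int st t)
  also have "\<dots> = (\<integral>\<^sup>+\<omega>. indicator {\<omega>\<in>B. ereal s < \<tau> \<omega> \<and> \<tau> \<omega> \<le> ereal t} \<omega> \<partial>Q)"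
    using le_st by (intro nn_integral_cong) (auto simp: N_def indicator_def not_le)
  also have "\<dots> = emeasure Q {\<omega>\<in>B. ereal s < \<tau> \<omega> \<and> \<tau> \<omega> \<le> ereal t}"
  proof (rule nn_integral_indicator)
    have "{\<omega>\<in>B. ereal s < \<tau> \<omega> \<and> \<tau> \<omega> \<le> ereal t} = B \<inter> {\<omega>\<in>space Q. ereal s < \<tau> \<omega> \<and> \<tau> \<omega> \<le> ereal t}"
      using sets.sets_into_space[OF B_Q] by auto
    then show "{\<omega>\<in>B. ereal s < \<tau> \<omega> \<and> \<tau> \<omega> \<le> ereal t} \<in> sets Q" by simp
  qed
  finally show ?thesis by (simp add: D_def)
qed

lemma real_tau:
  assumes "\<omega> \<in> space Q" "\<tau> \<omega> \<le> ereal b"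
  shows "0 < real_of_ereal (\<tau> \<omega>)" "ereal (real_of_ereal (\<tau> \<omega>)) = \<tau> \<omega>"
proof -
  have "0 < \<tau> \<omega>" using tau_pos assms by blast
  then show "ereal (real_of_ereal (\<tau> \<omega>)) = \<tau> \<omega>" using assms(2) by (intro ereal_real') auto
  with \<open>0 < \<tau> \<omega>\<close> show "0 < real_of_ereal (\<tau> \<omega>)" by (metis ereal_less(2))
qed

lemma tau_graph_measurable:
  "(\<lambda>\<omega>. (real_of_ereal (\<tau> \<omega>), \<omega>)) \<in> measurable Q (predictable_sigma Q F)"
proof (rule measurable_graph_predictable[OF F_filt])
  show "0 \<le> real_of_ereal (\<tau> \<omega>)" if "\<omega> \<in> space Q" for \<omega>
    using tau_pos that by (intro real_of_ereal_pos) (auto intro: less_imp_le)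
qed measurable

lemma clamp_measurable:
  "(\<lambda>(s, \<omega>). (max 0 (min T s), \<omega>)) \<in> measurable (lborel \<Otimes>\<^sub>M Q) (predictable_sigma Q F)"
  by (rule progressive_to_Q[OF measurable_progressive_predictable[OF F_filt]]) (use T_pos in auto)

text \<open>Both sides are integrals of k against measures on the predictable sigma-algebra: the
  image of Q on {\<tau> \<le> T} under the graph of \<tau>, and \<gamma> ds dQ on the part of (0, T]
  up to \<tau>. They agree on the generating rectangles by \<open>compensator_rectangle\<close>,
  hence everywhere. This is the dual predictable projection of the jump at \<tau>.\<close>

lemma compensator:
  assumes k[measurable]: "k \<in> borel_measurable (predictable_sigma Q F)"
  shows "(\<integral>\<^sup>+\<omega>. indicator {\<omega>. \<tau> \<omega> \<le> ereal T} \<omega> * k (real_of_ereal (\<tau> \<omega>), \<omega>) \<partial>Q)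
    = (\<integral>\<^sup>+\<omega>. \<integral>\<^sup>+s. k (s, \<omega>) * ennreal (gam s \<omega>) * indicator {s. 0 < s \<and> s \<le> T \<and> ereal s < \<tau> \<omega>} s \<partial>lborel \<partial>Q)"
proof -
  let ?S = "predictable_sigma Q F"
  let ?c = "\<lambda>(s, \<omega>). (max 0 (min T s), \<omega>)"
  define w :: "real \<times> 'a \<Rightarrow> ennreal"
    where "w = (\<lambda>(s, \<omega>). ennreal (gam s \<omega> * indicator {s. ereal s \<le> \<tau> \<omega>} s) * indicator {0<..T} s)"
  define \<mu>1 where "\<mu>1 = distr (density Q (\<lambda>\<omega>. indicator {\<omega>. \<tau> \<omega> \<le> ereal T} \<omega>)) ?S (\<lambda>\<omega>. (real_of_ereal (\<tau> \<omega>), \<omega>))"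
  \<comment> \<open>The clamp sends every time into the nonnegative half-line, as the target space
    demands; it leaves no trace because the weight w vanishes outside (0, T].\<close>
  define \<mu>2 where "\<mu>2 = distr (density (lborel \<Otimes>\<^sub>M Q) w) ?S ?c"
  note [measurable] = tau_graph_measurable clamp_measurable
  have w_meas[measurable]: "w \<in> borel_measurable (lborel \<Otimes>\<^sub>M Q)" unfolding w_def by measurable
  have tau_ind[measurable]: "(\<lambda>\<omega>. indicator {\<omega>. \<tau> \<omega> \<le> ereal T} \<omega> :: ennreal) \<in> borel_measurable Q" by measurable
  have int1: "(\<integral>\<^sup>+x. f x \<partial>\<mu>1) = (\<integral>\<^sup>+\<omega>. indicator {\<omega>. \<tau> \<omega> \<le> ereal T} \<omega> * f (real_of_ereal (\<tau> \<omega>), \<omega>) \<partial>Q)"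
    if [measurable]: "f \<in> borel_measurable ?S" for f
    unfolding \<mu>1_def by (subst nn_integral_distr) (auto simp: nn_integral_density)
  have int2: "(\<integral>\<^sup>+x. f x \<partial>\<mu>2)
      = (\<integral>\<^sup>+\<omega>. \<integral>\<^sup>+s. f (s, \<omega>) * ennreal (gam s \<omega> * indicator {s. ereal s \<le> \<tau> \<omega>} s) * indicator {0<..T} s \<partial>lborel \<partial>Q)"
    if [measurable]: "f \<in> borel_measurable ?S" for f
  proof -
    have "(\<integral>\<^sup>+x. f x \<partial>\<mu>2) = (\<integral>\<^sup>+x. w x * f (?c x) \<partial>(lborel \<Otimes>\<^sub>M Q))"
      unfolding \<mu>2_def by (subst nn_integral_distr) (auto simp: nn_integral_density)
    also have "\<dots> = (\<integral>\<^sup>+\<omega>. \<integral>\<^sup>+s. w (s, \<omega>) * f (?c (s, \<omega>)) \<partial>lborel \<partial>Q)"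
      by (rule LQ.nn_integral_snd[symmetric]) measurable
    also have "\<dots> = (\<integral>\<^sup>+\<omega>. \<integral>\<^sup>+s. f (s, \<omega>) * ennreal (gam s \<omega> * indicator {s. ereal s \<le> \<tau> \<omega>} s) * indicator {0<..T} s \<partial>lborel \<partial>Q)"
      by (intro nn_integral_cong) (auto simp: w_def indicator_def mult.commute max_def min_def)
    finally show ?thesis .
  qed
  have em1: "emeasure \<mu>1 A = (\<integral>\<^sup>+x. indicator A x \<partial>\<mu>1)" and em2: "emeasure \<mu>2 A = (\<integral>\<^sup>+x. indicator A x \<partial>\<mu>2)"
    if "A \<in> sets ?S" for A
    using that by (simp_all add: \<mu>1_def \<mu>2_def)
  have "\<mu>1 = \<mu>2"
  proof (rule measure_eqI_generator_eq_countable)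
    let ?E = "{{0::real} \<times> B | B. B \<in> sets (F 0)} \<union> {{s<..t} \<times> B | (s::real) t B. 0 \<le> s \<and> s \<le> t \<and> B \<in> sets (F s)}"
    \<comment> \<open>The half-open rectangles never contain time 0, so the countable cover needs
      the slice {0} in addition.\<close>
    let ?A = "insert ({0::real} \<times> space Q) (range (\<lambda>n. {0<..real n} \<times> space Q))"
    have top: "space Q \<in> sets (F 0)" using sets.top[of "F 0"] filtration_on_space[OF F_filt, of 0] by simp
    have E_S: "A \<in> sets ?S" if "A \<in> ?E" for A
      using that predictable_sigma_rectangle[OF F_filt] predictable_sigma_zero[OF F_filt] by auto
    show "Int_stable ?E"
    proof (rule Int_stableI)
      fix A B :: "(real \<times> 'a) set" assume A: "A \<in> ?E" and B: "B \<in> ?E"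
      have rect: "({s<..t} \<times> C) \<inter> ({s'<..t'} \<times> C') \<in> ?E"
        if "0 \<le> s" "s \<le> t" "C \<in> sets (F s)" "0 \<le> s'" "s' \<le> t'" "C' \<in> sets (F s')" for s t C s' t' C'
      proof -
        define l where "l = max s s'"
        \<comment> \<open>The outer maximum guarantees \<open>l \<le> r\<close> also for disjoint
          time intervals, whose intersection becomes an empty rectangle of the generator.\<close>
        define r where "r = max l (min t t')"
        have "C \<in> sets (F l)" "C' \<in> sets (F l)"
          using filtration_on_mono[OF F_filt, of s l] filtration_on_mono[OF F_filt, of s' l] that by (auto simp: l_def)
        moreover have "({s<..t} \<times> C) \<inter> ({s'<..t'} \<times> C') = {l<..r} \<times> (C \<inter> C')"
          by (auto simp: l_def r_def)
        moreover have "0 \<le> l" "l \<le> r" using that by (auto simp: l_def r_def)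
        ultimately show ?thesis by blast
      qed
      have zero: "({0} \<times> C) \<inter> ({0} \<times> C') \<in> ?E" if "C \<in> sets (F 0)" "C' \<in> sets (F 0)" for C C'
        using that by (intro UnI1) (auto intro!: exI[of _ "C \<inter> C'"])
      have mixed: "({0} \<times> C) \<inter> ({s<..t} \<times> C') \<in> ?E" "({s<..t} \<times> C') \<inter> ({0} \<times> C) \<in> ?E" if "0 \<le> s" for C C' and s t :: real
      proof -
        have "{} \<in> ?E" by (intro UnI1) (auto intro!: exI[of _ "{}"])
        moreover have "({0} \<times> C) \<inter> ({s<..t} \<times> C') = {}" "({s<..t} \<times> C') \<inter> ({0} \<times> C) = {}" using that by auto
        ultimately show "({0} \<times> C) \<inter> ({s<..t} \<times> C') \<in> ?E" "({s<..t} \<times> C') \<inter> ({0} \<times> C) \<in> ?E" by simp_all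
      qed
      from A consider C where "A = {0} \<times> C" "C \<in> sets (F 0)" | s t C where "A = {s<..t} \<times> C" "0 \<le> s" "s \<le> t" "C \<in> sets (F s)"
        by blast
      note casesA = this
      from B consider C where "B = {0} \<times> C" "C \<in> sets (F 0)" | s t C where "B = {s<..t} \<times> C" "0 \<le> s" "s \<le> t" "C \<in> sets (F s)"
        by blast
      note casesB = this
      show "A \<inter> B \<in> ?E"
        by (cases rule: casesA; cases rule: casesB) (simp only:, (rule zero rect mixed; assumption))+
    qed
    show "?E \<subseteq> Pow ({0..} \<times> space Q)" by (rule predictable_generator_subset[OF F_filt])
    show "sets \<mu>1 = sigma_sets ({0..} \<times> space Q) ?E" "sets \<mu>2 = sigma_sets ({0..} \<times> space Q) ?E"
      unfolding \<mu>1_def \<mu>2_def sets_distr predictable_sigma_def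
      by (rule sets_measure_of[OF predictable_generator_subset[OF F_filt]])+
    show A_sub: "?A \<subseteq> ?E"
    proof
      fix A assume "A \<in> ?A"
      then consider "A = {0} \<times> space Q" | n :: nat where "A = {0<..real n} \<times> space Q" by auto
      then show "A \<in> ?E"
      proof cases
        case 1
        then show ?thesis using top by blast
      next
        case 2
        have "\<exists>s t B. A = {s<..t} \<times> B \<and> 0 \<le> s \<and> s \<le> t \<and> B \<in> sets (F s)"
          by (intro exI[of _ 0] exI[of _ "real n"] exI[of _ "space Q"]) (use 2 top in simp)
        then show ?thesis by blast
      qed
    qed
    show "\<Union> ?A = {0..} \<times> space Q"
    proof (intro subset_antisym subsetI)
      fix x :: "real \<times> 'a" assume x: "x \<in> {0..} \<times> space Q"
      obtain n :: nat where n: "fst x \<le> real n" using real_arch_simple by blast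
      show "x \<in> \<Union> ?A"
      proof (cases "fst x = 0")
        case True
        then show ?thesis using x by (intro UnionI[of "{0} \<times> space Q"]) (auto simp: mem_Times_iff)
      next
        case False
        then have "x \<in> {0<..real n} \<times> space Q" using x n by (auto simp: mem_Times_iff)
        then show ?thesis by blast
      qed
    next
      fix x :: "real \<times> 'a" assume "x \<in> \<Union> ?A"
      then consider "x \<in> {0} \<times> space Q" | n :: nat where "x \<in> {0<..real n} \<times> space Q" by blast
      then show "x \<in> {0..} \<times> space Q" by cases auto
    qed
    show "countable ?A" by (intro countable_insert countable_image countableI_type)
    show "emeasure \<mu>1 A \<noteq> \<infinity>" if "A \<in> ?A" for A
    proof -
      have "A \<in> sets ?S" by (rule E_S[OF subsetD[OF A_sub that]])
      then have "emeasure \<mu>1 A = (\<integral>\<^sup>+\<omega>. indicator {\<omega>. \<tau> \<omega> \<le> ereal T} \<omega> * indicator A (real_of_ereal (\<tau> \<omega>), \<omega>) \<partial>Q)"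
        using em1 int1[of "indicator A"] by simp
      also have "\<dots> \<le> (\<integral>\<^sup>+\<omega>. 1 \<partial>Q)" by (intro nn_integral_mono) (auto simp: indicator_def)
      also have "\<dots> < \<infinity>" using Q.emeasure_space_1 by simp
      finally show ?thesis by simp
    qed
    fix A assume A: "A \<in> ?E"
    then have A_S: "A \<in> sets ?S" by (rule E_S)
    have E1: "emeasure \<mu>1 A = (\<integral>\<^sup>+\<omega>. indicator {\<omega>. \<tau> \<omega> \<le> ereal T} \<omega> * indicator A (real_of_ereal (\<tau> \<omega>), \<omega>) \<partial>Q)"
      using em1[OF A_S] int1[of "indicator A"] A_S by simp
    have E2: "emeasure \<mu>2 A = (\<integral>\<^sup>+\<omega>. \<integral>\<^sup>+s. indicator A (s, \<omega>) * ennreal (gam s \<omega> * indicator {s. ereal s \<le> \<tau> \<omega>} s) * indicator {0<..T} s \<partial>lborel \<partial>Q)"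
      using em2[OF A_S] int2[of "indicator A"] A_S by simp
    from A consider B where "A = {0} \<times> B" "B \<in> sets (F 0)" | s t B where "A = {s<..t} \<times> B" "0 \<le> s" "s \<le> t" "B \<in> sets (F s)"
      by blast
    then show "emeasure \<mu>1 A = emeasure \<mu>2 A"
    proof cases
      case 1
      have "emeasure \<mu>1 A = (\<integral>\<^sup>+\<omega>. 0 \<partial>Q)"
        unfolding E1 unfolding 1(1)
        by (intro nn_integral_cong) (auto simp: indicator_def dest!: real_tau(1))
      moreover have "emeasure \<mu>2 A = (\<integral>\<^sup>+\<omega>. \<integral>\<^sup>+s. 0 \<partial>(lborel :: real measure) \<partial>Q)"
        unfolding E2 unfolding 1(1) by (intro nn_integral_cong) (auto simp: indicator_def)
      ultimately show ?thesis by simp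
    next
      case (2 s t B)
      have B: "B \<in> sets (G s)" "B \<in> sets Q" using F_le_G[OF 2(2,4)] filtration_on_sets[OF F_filt 2(2,4)] by auto
      \<comment> \<open>Neither measure charges times after T, so a rectangle may be cut there
        before the compensator is applied.\<close>
      define b where "b = min t T"
      have e1: "emeasure \<mu>1 A = (\<integral>\<^sup>+\<omega>. indicator {\<omega>\<in>B. ereal s < \<tau> \<omega> \<and> \<tau> \<omega> \<le> ereal b} \<omega> \<partial>Q)"
        unfolding E1 unfolding 2(1)
      proof (intro nn_integral_cong)
        fix \<omega> assume \<omega>: "\<omega> \<in> space Q"
        show "indicator {\<omega>. \<tau> \<omega> \<le> ereal T} \<omega> * indicator ({s<..t} \<times> B) (real_of_ereal (\<tau> \<omega>), \<omega>)
          = (indicator {\<omega>\<in>B. ereal s < \<tau> \<omega> \<and> \<tau> \<omega> \<le> ereal b} \<omega> :: ennreal)"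
        proof (cases "\<tau> \<omega> \<le> ereal T")
          case True
          obtain r where r: "\<tau> \<omega> = ereal r" using real_tau(2)[OF \<omega> True] by metis
          show ?thesis using True by (auto simp: indicator_def r b_def)
        next
          case False
          then have "\<not> \<tau> \<omega> \<le> ereal b" by (metis b_def ereal_less_eq(3) min.cobounded2 order.trans)
          then show ?thesis using False by (simp add: indicator_def)
        qed
      qed
      also have "\<dots> = emeasure Q {\<omega>\<in>B. ereal s < \<tau> \<omega> \<and> \<tau> \<omega> \<le> ereal b}"
      proof (rule nn_integral_indicator)
        have "{\<omega>\<in>B. ereal s < \<tau> \<omega> \<and> \<tau> \<omega> \<le> ereal b} = B \<inter> {\<omega>\<in>space Q. ereal s < \<tau> \<omega> \<and> \<tau> \<omega> \<le> ereal b}"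
          using sets.sets_into_space[OF B(2)] by auto
        then show "{\<omega>\<in>B. ereal s < \<tau> \<omega> \<and> \<tau> \<omega> \<le> ereal b} \<in> sets Q" using B by simp
      qed
      also have "\<dots> = (\<integral>\<^sup>+\<omega>. indicator B \<omega> * (\<integral>\<^sup>+ r\<in>{s<..b}. ennreal (gam r \<omega> * indicator {r. ereal r \<le> \<tau> \<omega>} r) \<partial>lborel) \<partial>Q)"
      proof (cases "s \<le> b")
        case True
        then show ?thesis by (intro compensator_rectangle) (use 2 B in \<open>auto simp: b_def\<close>)
      next
        case False
        then have "\<not> (ereal s < \<tau> \<omega> \<and> \<tau> \<omega> \<le> ereal b)" for \<omega>
          by (metis ereal_less_eq(3) less_le_trans less_ereal.simps(1) less_imp_le)
        then have empty: "{\<omega>\<in>B. ereal s < \<tau> \<omega> \<and> \<tau> \<omega> \<le> ereal b} = {}" by blast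
        show ?thesis unfolding empty using False by simp
      qed
      also have "\<dots> = emeasure \<mu>2 A"
        unfolding E2 unfolding 2(1)
        using 2 by (intro nn_integral_cong, subst nn_integral_cmult[symmetric])
          (auto simp: b_def indicator_def intro!: nn_integral_cong)
      finally show ?thesis .
    qed
  qed
  then have "(\<integral>\<^sup>+x. k x \<partial>\<mu>1) = (\<integral>\<^sup>+x. k x \<partial>\<mu>2)" by simp
  moreover have "(\<integral>\<^sup>+\<omega>. \<integral>\<^sup>+s. k (s, \<omega>) * ennreal (gam s \<omega> * indicator {s. ereal s \<le> \<tau> \<omega>} s) * indicator {0<..T} s \<partial>lborel \<partial>Q)
    = (\<integral>\<^sup>+\<omega>. \<integral>\<^sup>+s. k (s, \<omega>) * ennreal (gam s \<omega>) * indicator {s. 0 < s \<and> s \<le> T \<and> ereal s < \<tau> \<omega>} s \<partial>lborel \<partial>Q)"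
  proof (rule nn_integral_cong, rule nn_integral_cong_AE)
    fix \<omega>
    \<comment> \<open>The compensator runs over s \<le> \<tau>, the claim over s < \<tau>; for
      finite \<tau> they differ at one time. For infinite \<tau> they agree, and excluding the
      default value of \<open>real_of_ereal\<close> does no harm.\<close>
    have "AE s in lborel. s \<noteq> real_of_ereal (\<tau> \<omega>)" by (rule AE_lborel_singleton)
    then show "AE s in lborel. k (s, \<omega>) * ennreal (gam s \<omega> * indicator {s. ereal s \<le> \<tau> \<omega>} s) * indicator {0<..T} s
      = k (s, \<omega>) * ennreal (gam s \<omega>) * indicator {s. 0 < s \<and> s \<le> T \<and> ereal s < \<tau> \<omega>} s"
    proof eventually_elim
      case (elim s)
      then have "ereal s \<le> \<tau> \<omega> \<longleftrightarrow> ereal s < \<tau> \<omega>" by (cases "\<tau> \<omega>") auto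
      then show ?case by (auto simp: indicator_def)
    qed
  qed
  ultimately show ?thesis using int1[OF k] int2[OF k] by simp
qed

end

section \<open>The hazard equation\<close>

lemma stopped_infinity: "stopped X (\<lambda>_. \<infinity>) = X"
  by (simp add: stopped_def fun_eq_iff)

lemma tendsto_bounds:
  fixes f :: "real \<Rightarrow> real"
  assumes "(f \<longlongrightarrow> l) F" "F \<noteq> bot" "\<forall>\<^sub>F x in F. a \<le> f x \<and> f x \<le> b"
  shows "a \<le> l \<and> l \<le> b"
  using tendsto_lowerbound[OF assms(1) _ assms(2)] tendsto_upperbound[OF assms(1) _ assms(2)] assms(3)
  by (auto simp: eventually_conj_iff)

context invariance_time
begin

lemma null_sets_in_F0:
  assumes "N \<in> sets Q" "emeasure Q N = 0" shows "N \<in> sets (F 0)"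
  using assms F unfolding usual_conditions_def by (meson null_setsI order_refl sets.sets_into_space)

lemma AE_Q_iff_AE_P:
  assumes "{\<omega>\<in>space Q. \<not> R \<omega>} \<in> sets (F T)"
  shows "(AE \<omega> in Q. R \<omega>) \<longleftrightarrow> (AE \<omega> in P. R \<omega>)"
proof -
  have "{\<omega>\<in>space Q. \<not> R \<omega>} \<in> sets Q" using filtration_on_sets[OF F_filt _ assms] T_pos by simp
  then have "(AE \<omega> in Q. R \<omega>) \<longleftrightarrow> emeasure Q {\<omega>\<in>space Q. \<not> R \<omega>} = 0"
    "(AE \<omega> in P. R \<omega>) \<longleftrightarrow> emeasure P {\<omega>\<in>space Q. \<not> R \<omega>} = 0"
    using P(2) space_P by (auto intro!: AE_iff_measurable)
  then show ?thesis using P_equiv assms by simp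
qed

lemma regularized_martingale:
  assumes Y: "Y \<in> borel_measurable Q" "\<And>\<omega>. 0 \<le> Y \<omega> \<and> Y \<omega> \<le> c"
  obtains X where "\<And>u. 0 \<le> u \<Longrightarrow> u \<le> T \<Longrightarrow> X u \<in> borel_measurable (F u)" "adapted F X" "cadlag Q X"
    "\<And>u \<omega>. 0 \<le> u \<Longrightarrow> 0 \<le> X u \<omega> \<and> X u \<omega> \<le> c"
    "\<And>u B. 0 \<le> u \<Longrightarrow> u \<le> T \<Longrightarrow> B \<in> sets (F u) \<Longrightarrow>
       (\<integral>\<omega>. indicator B \<omega> * X u \<omega> \<partial>P) = (\<integral>\<omega>. indicator B \<omega> * Y \<omega> \<partial>P)"
    "local_martingale P F X"
proof -
  let ?F = "\<lambda>u. F (min u T)"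
  have T: "0 \<le> T" using T_pos by simp
  have sub: "subalgebra P (?F u)" if "0 \<le> u" for u by (rule F_sub_P) (use that T in simp)
  have incr: "sets (?F u) \<subseteq> sets (?F v)" if "0 \<le> u" "u \<le> v" for u v
    using filtration_on_mono[OF F_filt, of "min u T" "min v T"] that T by auto
  have rc: "(\<Inter>s\<in>{u<..}. sets (?F s)) \<subseteq> sets (?F u)" if u: "0 \<le> u" for u
  proof (cases "u < T")
    case True
    have "(\<Inter>s\<in>{u<..}. sets (?F s)) \<subseteq> (\<Inter>s\<in>{u<..}. sets (F s))"
    proof
      fix B assume B: "B \<in> (\<Inter>s\<in>{u<..}. sets (?F s))"
      have "B \<in> sets (F s)" if "u < s" for s
        using B that filtration_on_mono[OF F_filt, of "min s T" s B] u T by auto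
      then show "B \<in> (\<Inter>s\<in>{u<..}. sets (F s))" by auto
    qed
    also have "\<dots> = sets (F u)" using F u unfolding usual_conditions_def by simp
    finally show ?thesis using True by simp
  next
    case False
    have "u + 1 \<in> {u<..}" by simp
    then have "(\<Inter>s\<in>{u<..}. sets (?F s)) \<subseteq> sets (?F (u + 1))" by (rule INF_lower)
    then show ?thesis using False by simp
  qed
  have null: "N \<in> sets (?F 0)" if "N \<in> sets (?F T)" "emeasure P N = 0" for N
    using that P_equiv null_sets_in_F0 filtration_on_sets[OF F_filt T] T by simp
  have frozen: "sets (?F u) = sets (?F T)" if "T \<le> u" for u using that by simp
  have Y_P: "Y \<in> borel_measurable P" using Y(1) by (simp add: borel_P)
  obtain X where X: "\<And>u. 0 \<le> u \<Longrightarrow> X u \<in> borel_measurable (?F u)" "cadlag P X"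
    "\<And>u \<omega>. 0 \<le> u \<Longrightarrow> 0 \<le> X u \<omega> \<and> X u \<omega> \<le> c"
    "\<And>u B. 0 \<le> u \<Longrightarrow> B \<in> sets (?F u) \<Longrightarrow>
       (\<integral>\<omega>. indicator B \<omega> * X u \<omega> \<partial>P) = (\<integral>\<omega>. indicator B \<omega> * Y \<omega> \<partial>P)"
    by (rule P.cadlag_martingale_version[of ?F T Y c, OF sub incr rc null frozen T Y_P Y(2)]) blast+
  have adapted: "X u \<in> borel_measurable (F u)" if "0 \<le> u" for u
    by (rule filtration_on_borel_mono[OF F_filt _ _ X(1)[OF that]]) (use that T in auto)
  have X_P: "X u \<in> borel_measurable P" if "0 \<le> u" for u
    using filtration_on_borel[OF F_filt that adapted[OF that]] by (simp add: borel_P)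
  have int: "integrable P (X u)" if "0 \<le> u" for u
    by (rule P.integrable_const_bound[where B = c]) (use X(3) X_P that in auto)
  have Y_int: "integrable P Y"
    by (rule P.integrable_const_bound[where B = c]) (use Y Y_P in auto)
  \<comment> \<open>From T on the process is almost surely constant in time, so the martingale
    property holds there although \<open>F r\<close> may be larger than \<open>F T\<close>.\<close>
  have late: "AE \<omega> in P. X r \<omega> = real_cond_exp P (F T) Y \<omega>" if "T \<le> r" for r
  proof -
    interpret finite_measure_subalgebra P "F T" by unfold_locales (rule F_sub_P[OF T])
    have "AE \<omega> in P. real_cond_exp P (F T) Y \<omega> = X r \<omega>"
    proof (rule real_cond_exp_charact)
      show "(\<integral>\<omega>\<in>A. Y \<omega> \<partial>P) = (\<integral>\<omega>\<in>A. X r \<omega> \<partial>P)" if "A \<in> sets (F T)" for A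
        using X(4)[of r A] that \<open>T \<le> r\<close> T by (simp add: set_lebesgue_integral_def)
      show "X r \<in> borel_measurable (F T)" using X(1)[of r] \<open>T \<le> r\<close> T by simp
    qed (use int[of r] Y_int \<open>T \<le> r\<close> T in auto)
    then show ?thesis by eventually_elim simp
  qed
  have mart: "martingale P F X"
    unfolding martingale_def adapted_def
  proof (intro conjI allI impI)
    fix s r :: real assume sr: "0 \<le> s" "s \<le> r"
    interpret finite_measure_subalgebra P "F s" by unfold_locales (rule F_sub_P[OF sr(1)])
    show "AE \<omega> in P. real_cond_exp P (F s) (X r) \<omega> = X s \<omega>"
    proof (rule real_cond_exp_charact)
      fix A assume A: "A \<in> sets (F s)"
      then have A_P: "A \<in> sets P" using filtration_on_sets[OF F_filt sr(1) A] P(2) by simp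
      show "(\<integral>\<omega>\<in>A. X r \<omega> \<partial>P) = (\<integral>\<omega>\<in>A. X s \<omega> \<partial>P)"
      proof (cases "s \<le> T")
        case True
        then have "A \<in> sets (?F s)" "A \<in> sets (?F r)"
          using A filtration_on_mono[OF F_filt sr(1), of "min r T" A] sr by auto
        then show ?thesis using X(4)[of s A] X(4)[of r A] sr by (simp add: set_lebesgue_integral_def)
      next
        case False
        have "AE \<omega> in P. X r \<omega> = X s \<omega>" using late[of r] late[of s] False sr by (auto elim: eventually_elim2)
        then show ?thesis unfolding set_lebesgue_integral_def
          by (intro integral_cong_AE) (use A_P X_P sr in \<open>auto elim: eventually_mono\<close>)
      qed
    qed (use int adapted sr in auto)
  qed (use int adapted in auto)
  have cad_Q: "cadlag Q X" using X(2) space_P by (simp add: cadlag_def)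
  have "local_martingale P F X"
    unfolding local_martingale_def
  proof (intro conjI exI[of _ "\<lambda>n \<omega>. \<infinity>"] allI)
    show "stopping_time_on F (\<lambda>\<omega>. \<infinity>)" by (simp add: stopping_time_on_def)
  qed (use X(2) mart adapted in \<open>auto simp: adapted_def stopped_infinity\<close>)
  moreover have "X u \<in> borel_measurable (F u)" if "0 \<le> u" "u \<le> T" for u using X(1)[of u] that by simp
  ultimately show ?thesis using that[of X] adapted cad_Q X(3,4) by (auto simp: adapted_def)
qed

lemma adapted_borel:
  fixes X :: "real \<Rightarrow> 'a \<Rightarrow> real"
  assumes "adapted F X" "0 \<le> u" shows "X u \<in> borel_measurable Q"
  by (rule filtration_on_borel[OF F_filt assms(2)]) (use assms in \<open>simp add: adapted_def\<close>)

lemma cadlag_adapted_measurable: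
  fixes X :: "real \<Rightarrow> 'a \<Rightarrow> real"
  assumes X: "cadlag Q X" "adapted F X" and f: "f \<in> borel_measurable N" and g: "g \<in> measurable N Q"
  shows "(\<lambda>x. X (max 0 (f x)) (g x)) \<in> borel_measurable N"
proof -
  have "(\<lambda>(v, \<omega>). X (max 0 v) \<omega>) \<in> borel_measurable (borel \<Otimes>\<^sub>M Q)"
    by (rule cadlag_jointly_measurable) (use X adapted_borel[OF X(2)] in \<open>auto simp: cadlag_def\<close>)
  from measurable_compose[OF measurable_Pair[OF f g] this] show ?thesis by simp
qed

text \<open>The hazard equation, which expresses on \<open>{u < \<tau>}\<close> that \<open>X\<^sup>\<tau>\<^sup>-\<close> is a \<open>(G, Q)\<close> martingale, with its jump at
  \<^term>\<open>\<tau>\<close> replaced by its compensator.\<close>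
lemma hazard_equation_set:
  assumes lm: "local_martingale P F X" and ad: "adapted F X" and cad: "cadlag Q X"
    and bounds: "\<And>u \<omega>. 0 \<le> u \<Longrightarrow> 0 \<le> X u \<omega> \<and> X u \<omega> \<le> c"
    and uv: "0 \<le> u" "u \<le> v" "v \<le> T" and B: "B \<in> sets (F u)"
  shows "(\<integral>\<^sup>+\<omega>. indicator B \<omega> * (alive u \<omega> * ennreal (X u \<omega>)) \<partial>Q)
    = (\<integral>\<^sup>+\<omega>. indicator B \<omega> * (alive v \<omega> * ennreal (X v \<omega>)
      + (\<integral>\<^sup>+s. ennreal (X s \<omega> * gam s \<omega>) * indicator {s. u < s \<and> s \<le> v \<and> ereal s < \<tau> \<omega>} s \<partial>lborel)) \<partial>Q)"
proof -
  define L where "L s \<omega> = Lim (at_left s) (\<lambda>r. X r \<omega>)" for s \<omega>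
  have L: "((\<lambda>r. X r \<omega>) \<longlongrightarrow> L s \<omega>) (at_left s)" if \<omega>: "\<omega> \<in> space Q" "0 < s" for s \<omega>
  proof -
    obtain l where "((\<lambda>r. X r \<omega>) \<longlongrightarrow> l) (at_left s)" using cad \<omega> unfolding cadlag_def by blast
    moreover from tendsto_Lim[OF trivial_limit_at_left_real this] have "L s \<omega> = l" by (simp add: L_def)
    ultimately show ?thesis by simp
  qed
  have L_bounds: "0 \<le> L s \<omega> \<and> L s \<omega> \<le> c" if "\<omega> \<in> space Q" "0 < s" for s \<omega>
  proof (rule tendsto_bounds[OF L[OF that]])
    show "\<forall>\<^sub>F r in at_left s. 0 \<le> X r \<omega> \<and> X r \<omega> \<le> c"
      unfolding eventually_at_left_field using bounds that by (intro exI[of _ 0]) auto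
  qed simp
  define W where "W r \<omega> = stopped_left X \<tau> r \<omega>" for r \<omega>
  have W_lm: "local_martingale Q G (\<lambda>r \<omega>. W (min r T) \<omega>)"
    using Cc lm unfolding local_martingale_upto_def W_def by blast
  have T: "0 \<le> T" using T_pos by simp
  have W_eq: "W r \<omega> = (if ereal r < \<tau> \<omega> then X r \<omega> else L (real_of_ereal (\<tau> \<omega>)) \<omega>)" if "\<omega> \<in> space Q" for r \<omega>
    using tau_pos that unfolding W_def stopped_left_def L_def by auto
  have W_bounds: "0 \<le> W r \<omega> \<and> W r \<omega> \<le> c" if "\<omega> \<in> space Q" "0 \<le> r" for r \<omega>
    using W_eq[OF that(1), of r] bounds[OF that(2), of \<omega>] L_bounds[OF that(1) real_tau(1)[OF that(1), of r]] by (auto simp: not_less)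
  \<comment> \<open>On this event the process stopped before \<tau> still equals X at u. By v either
    \<tau> has not occurred, and its value is X_v, or \<tau> lies in (u, v] and its value is
    X_{\<tau>-}.\<close>
  define B' where "B' = B \<inter> {\<omega>\<in>space Q. ereal u < \<tau> \<omega>}"
  have B_Q[measurable]: "B \<in> sets Q" using filtration_on_sets[OF F_filt uv(1) B] .
  have B': "B' \<in> sets (G u)" unfolding B'_def using F_le_G[OF uv(1) B] tau_less_G[OF uv(1)] by simp
  have B'_Q[measurable]: "B' \<in> sets Q" using filtration_on_sets[OF G_filt uv(1) B'] .
  have W_meas: "W r \<in> borel_measurable Q" if "0 \<le> r" "r \<le> T" for r
  proof -
    have "(\<lambda>\<omega>. W (min r T) \<omega>) \<in> borel_measurable (G r)"
      using W_lm that unfolding local_martingale_def adapted_def by blast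
    then have "(\<lambda>\<omega>. W (min r T) \<omega>) \<in> borel_measurable Q" by (rule filtration_on_borel[OF G_filt that(1)])
    then show ?thesis using that by (simp add: min_def)
  qed
  have "(\<integral>\<omega>. indicator B' \<omega> * W (min v T) \<omega> \<partial>Q) = (\<integral>\<omega>. indicator B' \<omega> * W (min u T) \<omega> \<partial>Q)"
    by (rule Q.bounded_local_martingale_integral[OF G_sub W_lm, where c = c]) (use W_bounds T uv B' in auto)
  then have "(\<integral>\<omega>. indicator B' \<omega> * W v \<omega> \<partial>Q) = (\<integral>\<omega>. indicator B' \<omega> * W u \<omega> \<partial>Q)"
    using uv by (simp add: min_def)
  moreover have "(\<integral>\<^sup>+\<omega>. ennreal (indicator B' \<omega> * W r \<omega>) \<partial>Q) = ennreal (\<integral>\<omega>. indicator B' \<omega> * W r \<omega> \<partial>Q)" if r: "0 \<le> r" "r \<le> T" for r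
  proof (rule nn_integral_eq_integral)
    note [measurable] = W_meas[OF r]
    show "integrable Q (\<lambda>\<omega>. indicator B' \<omega> * W r \<omega>)"
      by (rule Q.integrable_const_bound[where B = c])
        (use W_bounds[OF _ r(1)] order_trans[OF bounds[THEN conjunct1] bounds[THEN conjunct2]] in \<open>auto simp: indicator_def intro!: AE_I2\<close>)
    show "AE \<omega> in Q. 0 \<le> indicator B' \<omega> * W r \<omega>" by (rule AE_I2) (use W_bounds r in auto)
  qed
  ultimately have eq: "(\<integral>\<^sup>+\<omega>. ennreal (indicator B' \<omega> * W u \<omega>) \<partial>Q) = (\<integral>\<^sup>+\<omega>. ennreal (indicator B' \<omega> * W v \<omega>) \<partial>Q)"
    using uv by simp
  \<comment> \<open>The payment at \<tau> has to be predictable for the compensator formula; this is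
    why the left limit of X appears, on (u, v] and B only.\<close>
  define k where "k = (\<lambda>x. ennreal ((\<lambda>(s, \<omega>). if u < s \<and> s \<le> v then indicator B \<omega> * L s \<omega> else 0) x))"
  have k[measurable]: "k \<in> borel_measurable (predictable_sigma Q F)"
    unfolding k_def by (rule measurable_compose[OF predictable_left_limit[OF F_filt ad L uv(1) B]]) auto
  note [measurable] = tau_graph_measurable
  have Xv[measurable]: "X v \<in> borel_measurable Q"
    using adapted_borel[OF ad, of v] uv by simp
  have "(\<integral>\<^sup>+\<omega>. ennreal (indicator B' \<omega> * W v \<omega>) \<partial>Q)
    = (\<integral>\<^sup>+\<omega>. indicator B \<omega> * (alive v \<omega> * ennreal (X v \<omega>))
       + indicator {\<omega>. \<tau> \<omega> \<le> ereal T} \<omega> * k (real_of_ereal (\<tau> \<omega>), \<omega>) \<partial>Q)"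
  proof (intro nn_integral_cong)
    fix \<omega> assume \<omega>: "\<omega> \<in> space Q"
    show "ennreal (indicator B' \<omega> * W v \<omega>) = indicator B \<omega> * (alive v \<omega> * ennreal (X v \<omega>))
       + indicator {\<omega>. \<tau> \<omega> \<le> ereal T} \<omega> * k (real_of_ereal (\<tau> \<omega>), \<omega>)"
    proof (cases "\<tau> \<omega> \<le> ereal T")
      case True
      obtain r where r: "\<tau> \<omega> = ereal r" using real_tau(2)[OF \<omega> True] by metis
      show ?thesis using uv \<omega> by (auto simp: W_eq k_def indicator_def r B'_def)
    next
      case False
      then have "ereal v < \<tau> \<omega>" "ereal u < \<tau> \<omega>"
        using uv by (metis ereal_less_eq(3) linorder_not_less order.strict_trans1 order_trans)+
      then show ?thesis using False \<omega> by (auto simp: W_eq indicator_def B'_def)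
    qed
  qed
  also have "\<dots> = (\<integral>\<^sup>+\<omega>. indicator B \<omega> * (alive v \<omega> * ennreal (X v \<omega>)) \<partial>Q)
       + (\<integral>\<^sup>+\<omega>. indicator {\<omega>. \<tau> \<omega> \<le> ereal T} \<omega> * k (real_of_ereal (\<tau> \<omega>), \<omega>) \<partial>Q)"
    by (rule nn_integral_add) measurable
  also have "(\<integral>\<^sup>+\<omega>. indicator {\<omega>. \<tau> \<omega> \<le> ereal T} \<omega> * k (real_of_ereal (\<tau> \<omega>), \<omega>) \<partial>Q)
    = (\<integral>\<^sup>+\<omega>. \<integral>\<^sup>+s. k (s, \<omega>) * ennreal (gam s \<omega>) * indicator {s. 0 < s \<and> s \<le> T \<and> ereal s < \<tau> \<omega>} s \<partial>lborel \<partial>Q)"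
    by (rule compensator[OF k])
  also have "\<dots> = (\<integral>\<^sup>+\<omega>. indicator B \<omega> * (\<integral>\<^sup>+s. ennreal (X s \<omega> * gam s \<omega>) * indicator {s. u < s \<and> s \<le> v \<and> ereal s < \<tau> \<omega>} s \<partial>lborel) \<partial>Q)"
  proof (intro nn_integral_cong)
    fix \<omega> assume \<omega>: "\<omega> \<in> space Q"
    \<comment> \<open>After compensation the left limit is integrated ds, where it may be replaced
      by X itself: each path has only countably many left discontinuities.\<close>
    have "countable {s. 0 < s \<and> L s \<omega> \<noteq> X s \<omega>}" by (rule countable_left_discontinuities) (rule L[OF \<omega>])
    then have "AE s in lborel. s \<notin> {s. 0 < s \<and> L s \<omega> \<noteq> X s \<omega>}"
      by (rule AE_not_in[OF countable_imp_null_set_lborel])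
    then have "(\<integral>\<^sup>+s. k (s, \<omega>) * ennreal (gam s \<omega>) * indicator {s. 0 < s \<and> s \<le> T \<and> ereal s < \<tau> \<omega>} s \<partial>lborel)
      = (\<integral>\<^sup>+s. indicator B \<omega> * (ennreal (X s \<omega> * gam s \<omega>) * indicator {s. u < s \<and> s \<le> v \<and> ereal s < \<tau> \<omega>} s) \<partial>lborel)"
    proof (intro nn_integral_cong_AE, eventually_elim)
      case (elim s)
      then show ?case using uv bounds[of s \<omega>] gam_nonneg[of s \<omega>]
        by (auto simp: k_def indicator_def ennreal_mult)
    qed
    also have "\<dots> = indicator B \<omega> * (\<integral>\<^sup>+s. ennreal (X s \<omega> * gam s \<omega>) * indicator {s. u < s \<and> s \<le> v \<and> ereal s < \<tau> \<omega>} s \<partial>lborel)"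
      by (cases "\<omega> \<in> B") simp_all
    finally show "(\<integral>\<^sup>+s. k (s, \<omega>) * ennreal (gam s \<omega>) * indicator {s. 0 < s \<and> s \<le> T \<and> ereal s < \<tau> \<omega>} s \<partial>lborel)
      = indicator B \<omega> * (\<integral>\<^sup>+s. ennreal (X s \<omega> * gam s \<omega>) * indicator {s. u < s \<and> s \<le> v \<and> ereal s < \<tau> \<omega>} s \<partial>lborel)" .
  qed
  also have "(\<integral>\<^sup>+\<omega>. indicator B \<omega> * (alive v \<omega> * ennreal (X v \<omega>)) \<partial>Q) + \<dots>
    = (\<integral>\<^sup>+\<omega>. indicator B \<omega> * (alive v \<omega> * ennreal (X v \<omega>))
      + indicator B \<omega> * (\<integral>\<^sup>+s. ennreal (X s \<omega> * gam s \<omega>) * indicator {s. u < s \<and> s \<le> v \<and> ereal s < \<tau> \<omega>} s \<partial>lborel) \<partial>Q)"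
  proof (rule nn_integral_add[symmetric])
    note [measurable (raw)] = cadlag_adapted_measurable[OF cad ad]
    have "(\<lambda>\<omega>. indicator B \<omega> * (\<integral>\<^sup>+s. ennreal (X (max 0 s) \<omega> * gam s \<omega>) * indicator {s. u < s \<and> s \<le> v \<and> ereal s < \<tau> \<omega>} s \<partial>lborel)) \<in> borel_measurable Q"
      by measurable
    also have "(\<lambda>\<omega>. indicator B \<omega> * (\<integral>\<^sup>+s. ennreal (X (max 0 s) \<omega> * gam s \<omega>) * indicator {s. u < s \<and> s \<le> v \<and> ereal s < \<tau> \<omega>} s \<partial>lborel))
      = (\<lambda>\<omega>. indicator B \<omega> * (\<integral>\<^sup>+s. ennreal (X s \<omega> * gam s \<omega>) * indicator {s. u < s \<and> s \<le> v \<and> ereal s < \<tau> \<omega>} s \<partial>lborel))"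
      by (rule ext, rule arg_cong2[where f = "(*)", OF refl], rule nn_integral_cong) (use uv in \<open>auto simp: indicator_def max_def\<close>)
    finally show "(\<lambda>\<omega>. indicator B \<omega> * (\<integral>\<^sup>+s. ennreal (X s \<omega> * gam s \<omega>) * indicator {s. u < s \<and> s \<le> v \<and> ereal s < \<tau> \<omega>} s \<partial>lborel)) \<in> borel_measurable Q" .
  qed measurable
  finally have "(\<integral>\<^sup>+\<omega>. ennreal (indicator B' \<omega> * W v \<omega>) \<partial>Q) = (\<integral>\<^sup>+\<omega>. indicator B \<omega> * (alive v \<omega> * ennreal (X v \<omega>)
      + (\<integral>\<^sup>+s. ennreal (X s \<omega> * gam s \<omega>) * indicator {s. u < s \<and> s \<le> v \<and> ereal s < \<tau> \<omega>} s \<partial>lborel)) \<partial>Q)"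
    by (simp add: distrib_left)
  moreover have "(\<integral>\<^sup>+\<omega>. ennreal (indicator B' \<omega> * W u \<omega>) \<partial>Q)
    = (\<integral>\<^sup>+\<omega>. indicator B \<omega> * (alive u \<omega> * ennreal (X u \<omega>)) \<partial>Q)"
    by (intro nn_integral_cong) (auto simp: W_eq B'_def indicator_def)
  ultimately show ?thesis using eq by simp
qed

end

lemma jointly_measurable_compose:
  fixes x :: "real \<Rightarrow> 'a \<Rightarrow> 'b :: topological_space"
  assumes "(\<lambda>(r, \<omega>). x r \<omega>) \<in> borel_measurable (lborel \<Otimes>\<^sub>M M)"
    and "f \<in> borel_measurable N" "g \<in> measurable N M"
  shows "(\<lambda>z. x (f z) (g z)) \<in> borel_measurable N"
proof -
  have "f \<in> measurable N lborel" using assms(2) by simp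
  from measurable_compose[OF measurable_Pair[OF this assms(3)] assms(1)] show ?thesis by simp
qed

context invariance_time
begin

section \<open>The cumulative intensity and its exponential\<close>

definition cum :: "real \<Rightarrow> 'a \<Rightarrow> ennreal" where
  "cum v \<omega> = (\<integral>\<^sup>+ r\<in>{0<..v}. ennreal (gam r \<omega>) \<partial>lborel)"

text \<open>This is e^\<Gamma>. Since \<open>enn2real\<close> sends infinity to 0, the value is 1
  where \<Gamma> is infinite; it is given a meaning only where \<Gamma> is finite.\<close>

definition ecum :: "real \<Rightarrow> 'a \<Rightarrow> real" where
  "ecum v \<omega> = exp (enn2real (cum v \<omega>))"

lemma cum_meas[measurable (raw)]:
  assumes [measurable]: "f \<in> borel_measurable N" "g \<in> measurable N Q"
  shows "(\<lambda>x. cum (f x) (g x)) \<in> borel_measurable N"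
proof -
  have "(\<lambda>x. cum (f x) (g x)) = (\<lambda>x. \<integral>\<^sup>+ r. ennreal (gam r (g x)) * indicator {r. 0 < r \<and> r \<le> f x} r \<partial>lborel)"
    unfolding cum_def by (intro ext nn_integral_cong) (auto simp: indicator_def)
  then show ?thesis by simp
qed

lemma ecum_meas[measurable (raw)]:
  assumes [measurable]: "f \<in> borel_measurable N" "g \<in> measurable N Q"
  shows "(\<lambda>x. ecum (f x) (g x)) \<in> borel_measurable N"
  unfolding ecum_def by measurable

lemma cum_mono: "u \<le> v \<Longrightarrow> cum u \<omega> \<le> cum v \<omega>"
  unfolding cum_def by (auto intro!: nn_integral_mono simp: indicator_def)

lemma gam_meas_F:
  assumes "0 \<le> v" "v \<le> T" shows "gam v \<in> borel_measurable (F v)"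
proof -
  have "gam v = \<gamma> v" using assms by (simp add: gam_eq fun_eq_iff)
  then show ?thesis using predictable_adapted[OF F_filt gamma_pred assms(1)] by simp
qed

lemma cum_meas_F:
  assumes v: "0 \<le> v" "v \<le> T" shows "cum v \<in> borel_measurable (F v)"
proof -
  have [measurable]: "(\<lambda>(\<omega>, r). \<gamma> (max 0 (min v r)) \<omega>) \<in> borel_measurable (F v \<Otimes>\<^sub>M lborel)"
    using measurable_pair_swap[OF predictable_progressive[OF F_filt gamma_pred v(1)]]
    by (simp add: case_prod_beta' cong: measurable_cong_sets)
  have "cum v = (\<lambda>\<omega>. \<integral>\<^sup>+ r. ennreal (\<gamma> (max 0 (min v r)) \<omega>) * indicator {0<..v} r \<partial>lborel)"
    unfolding cum_def by (intro ext nn_integral_cong) (use v in \<open>auto simp: indicator_def gam_def max_def min_def\<close>)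
  then show ?thesis by simp
qed

lemma ecum_meas_F: "0 \<le> v \<Longrightarrow> v \<le> T \<Longrightarrow> ecum v \<in> borel_measurable (F v)"
  using cum_meas_F[of v] unfolding ecum_def by measurable

text \<open>Condition (a) controls \<Gamma> only up to \<tau>, hence \<Gamma>_T only on {T <
  \<tau>}. The event {\<Gamma>_T = \<infinity>} lies in \<open>F T\<close> and almost surely misses
  {T < \<tau>}, so the conditional survival probability integrates to 0 over it. As this probability
  is positive almost surely, the event is null.\<close>

lemma cum_T_finite: "AE \<omega> in Q. cum T \<omega> < \<infinity>"
proof -
  have T: "0 \<le> T" using T_pos by simp
  interpret FT: finite_measure_subalgebra Q "F T" by unfold_locales (rule F_sub[OF T])
  define N where "N = {\<omega>\<in>space Q. cum T \<omega> = \<infinity>}"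
  have N: "N \<in> sets (F T)"
  proof -
    have "{\<omega>\<in>space (F T). cum T \<omega> = \<infinity>} \<in> sets (F T)" using cum_meas_F[OF T order_refl] by measurable
    then show ?thesis by (simp add: N_def filtration_on_space[OF F_filt T])
  qed
  have N_Q[measurable]: "N \<in> sets Q" using filtration_on_sets[OF F_filt T N] .
  let ?f = "\<lambda>\<omega>. indicator {\<omega>. ereal T < \<tau> \<omega>} \<omega> :: real"
  have f_int: "integrable Q ?f" by (rule Q.integrable_const_bound[where B = 1]) auto
  have "(\<integral>\<omega>. indicator N \<omega> * real_cond_exp Q (F T) ?f \<omega> \<partial>Q) = (\<integral>\<omega>. indicator N \<omega> * ?f \<omega> \<partial>Q)"
    using FT.real_cond_exp_intA[OF f_int N] by (simp add: set_lebesgue_integral_def)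
  also have "\<dots> = 0"
  proof (rule integral_eq_zero_AE)
    have "AE \<omega> in Q. \<forall>t\<ge>0. (\<integral>\<^sup>+ s\<in>{0<..t}. ennreal (\<gamma> s \<omega> * indicator {s. ereal s \<le> \<tau> \<omega>} s) \<partial>lborel) < \<infinity>"
      using Ca by (simp add: has_intensity_def)
    then show "AE \<omega> in Q. indicator N \<omega> * ?f \<omega> = 0"
    proof eventually_elim
      case (elim \<omega>)
      have "cum T \<omega> < \<infinity>" if "ereal T < \<tau> \<omega>"
      proof -
        have "ereal s \<le> \<tau> \<omega>" if "s \<le> T" for s using that \<open>ereal T < \<tau> \<omega>\<close> by (meson ereal_less_eq(3) less_imp_le order_trans)
        then have "cum T \<omega> = (\<integral>\<^sup>+ s\<in>{0<..T}. ennreal (\<gamma> s \<omega> * indicator {s. ereal s \<le> \<tau> \<omega>} s) \<partial>lborel)"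
          unfolding cum_def by (intro nn_integral_cong) (auto simp: indicator_def gam_eq)
        then show ?thesis using elim[rule_format, OF T] by simp
      qed
      then show ?case by (auto simp: N_def indicator_def)
    qed
  qed
  finally have "(\<integral>\<omega>. indicator N \<omega> * real_cond_exp Q (F T) ?f \<omega> \<partial>Q) = 0" .
  moreover have "integrable Q (\<lambda>\<omega>. indicator N \<omega> * real_cond_exp Q (F T) ?f \<omega>)"
    using integrable_real_mult_indicator[OF N_Q FT.real_cond_exp_int(1)[OF f_int]] by (simp add: mult.commute)
  moreover have "AE \<omega> in Q. 0 \<le> indicator N \<omega> * real_cond_exp Q (F T) ?f \<omega>"
    using Cb by eventually_elim (auto simp: indicator_def)
  ultimately have "AE \<omega> in Q. indicator N \<omega> * real_cond_exp Q (F T) ?f \<omega> = 0"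
    by (subst (asm) integral_nonneg_eq_0_iff_AE) auto
  then show ?thesis using Cb AE_space
    by eventually_elim (auto simp: N_def indicator_def less_top split: if_splits)
qed

text \<open>The fundamental theorem for e^\<Gamma>, stated as a sum to avoid truncated subtraction
  in \<open>ennreal\<close>.\<close>

lemma exp_cumulative_identity:
  assumes \<omega>: "\<omega> \<in> space Q" and tv: "0 \<le> t" "t \<le> v" and fin: "cum v \<omega> < \<infinity>"
  shows "(\<integral>\<^sup>+u\<in>{t<..v}. ennreal (gam u \<omega> * ecum u \<omega>) \<partial>lborel) + ennreal (ecum t \<omega>) = ennreal (ecum v \<omega>)"
proof -
  have "(\<integral>\<^sup>+u\<in>{t<..v}. ennreal (gam u \<omega> * ecum u \<omega>) \<partial>lborel) = ennreal (ecum v \<omega> - ecum t \<omega>)"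
    unfolding ecum_def
    by (rule nn_integral_cumulative_exp) (use \<omega> tv fin gam_nonneg gam_path in \<open>auto simp: cum_def\<close>)
  moreover have "ecum t \<omega> \<le> ecum v \<omega>"
    using cum_mono[OF tv(2), of \<omega>] fin by (simp add: ecum_def enn2real_mono)
  moreover have "0 \<le> ecum t \<omega>" by (simp add: ecum_def)
  ultimately show ?thesis by (simp add: ennreal_plus[symmetric])
qed

text \<open>The compensator formula with integrand 1 gives the probability of {\<tau> \<le> T}. This
  bound makes the term finite that is cancelled in \<open>exponential_hazard\<close>.\<close>

lemma expected_compensator_le_1:
  "(\<integral>\<^sup>+\<omega>. \<integral>\<^sup>+s. ennreal (gam s \<omega>) * indicator {s. 0 < s \<and> s \<le> T \<and> ereal s < \<tau> \<omega>} s \<partial>lborel \<partial>Q) \<le> 1"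
proof -
  have "(\<integral>\<^sup>+\<omega>. \<integral>\<^sup>+s. ennreal (gam s \<omega>) * indicator {s. 0 < s \<and> s \<le> T \<and> ereal s < \<tau> \<omega>} s \<partial>lborel \<partial>Q)
    = (\<integral>\<^sup>+\<omega>. indicator {\<omega>. \<tau> \<omega> \<le> ereal T} \<omega> \<partial>Q)"
    using compensator[of "\<lambda>_. 1"] by simp
  also have "\<dots> \<le> (\<integral>\<^sup>+\<omega>. 1 \<partial>Q)" by (intro nn_integral_mono) (simp add: indicator_def)
  finally show ?thesis by (simp add: Q.emeasure_space_1)
qed

text \<open>If \<open>1\<^bsub>{u < \<tau>}\<^esub> x\<^sub>u\<close> has drift \<open>- \<gamma>\<^sub>u 1\<^bsub>{u < \<tau>}\<^esub> x\<^sub>u\<close>, then multiplying by \<open>e\<^sup>\<Gamma>\<close> removes it.  The product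
  rule is replaced by testing the hypothesis against \<open>\<gamma>\<^sub>u e\<^sup>\<Gamma>\<close>, integrating over \<^term>\<open>u\<close> and exchanging the
  integrals.\<close>
lemma exponential_hazard:
  fixes x :: "real \<Rightarrow> 'a \<Rightarrow> ennreal"
  assumes ts: "0 \<le> t" "t \<le> s" "s \<le> T" and c: "0 \<le> c"
    and x_meas: "(\<lambda>(r, \<omega>). x r \<omega>) \<in> borel_measurable (lborel \<Otimes>\<^sub>M Q)"
    and x_bound: "\<And>r \<omega>. 0 \<le> r \<Longrightarrow> x r \<omega> \<le> ennreal d"
    and x_zero: "\<And>r \<omega>. 0 \<le> r \<Longrightarrow> ennreal c < cum r \<omega> \<Longrightarrow> x r \<omega> = 0"
    and eq: "\<And>u H. t \<le> u \<Longrightarrow> u \<le> s \<Longrightarrow> H \<in> borel_measurable (F u) \<Longrightarrow>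
        (\<integral>\<^sup>+\<omega>. H \<omega> * (alive u \<omega> * x u \<omega>) \<partial>Q)
        = (\<integral>\<^sup>+\<omega>. H \<omega> * (alive s \<omega> * x s \<omega>
          + (\<integral>\<^sup>+r. x r \<omega> * ennreal (gam r \<omega>) * indicator {r. u < r \<and> r \<le> s \<and> ereal r < \<tau> \<omega>} r \<partial>lborel)) \<partial>Q)"
    and B: "B \<in> sets (F t)"
  shows "(\<integral>\<^sup>+\<omega>. indicator B \<omega> * (alive s \<omega> * x s \<omega> * ennreal (ecum s \<omega>)) \<partial>Q)
    = (\<integral>\<^sup>+\<omega>. indicator B \<omega> * (alive t \<omega> * x t \<omega> * ennreal (ecum t \<omega>)) \<partial>Q)"
proof -
  note [measurable (raw)] = jointly_measurable_compose[OF x_meas]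
  have B_Q[measurable]: "B \<in> sets Q" using filtration_on_sets[OF F_filt ts(1) B] .
  \<comment> \<open>The density of e^\<Gamma>, cut off where \<Gamma> exceeds c. There x vanishes,
    now and at all later times, since \<Gamma> is nondecreasing; the cut-off is therefore invisible
    in products with x.\<close>
  define L where "L u \<omega> = ennreal (gam u \<omega> * ecum u \<omega>) * (if cum u \<omega> \<le> ennreal c then 1 else 0)" for u \<omega>
  define p where "p r \<omega> = x r \<omega> * ennreal (gam r \<omega>) * (if ereal r < \<tau> \<omega> then 1 else 0)" for r \<omega>
  define a where "a \<omega> = alive s \<omega> * x s \<omega>" for \<omega>
  have L_joint: "(\<lambda>(u, \<omega>). L u \<omega>) \<in> borel_measurable (lborel \<Otimes>\<^sub>M Q)" unfolding L_def by measurable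
  have p_joint: "(\<lambda>(u, \<omega>). p u \<omega>) \<in> borel_measurable (lborel \<Otimes>\<^sub>M Q)" unfolding p_def by measurable
  note [measurable (raw)] = jointly_measurable_compose[OF L_joint] jointly_measurable_compose[OF p_joint]
  have a_meas[measurable]: "a \<in> borel_measurable Q" unfolding a_def by measurable
  have [measurable]: "x u \<in> borel_measurable Q" "L u \<in> borel_measurable Q" "p u \<in> borel_measurable Q" for u
    using jointly_measurable_compose[OF x_meas measurable_const measurable_ident_sets[OF refl], of u]
      jointly_measurable_compose[OF L_joint measurable_const measurable_ident_sets[OF refl], of u]
      jointly_measurable_compose[OF p_joint measurable_const measurable_ident_sets[OF refl], of u] by simp_all
  define \<Lambda> where "\<Lambda> v \<omega> = (\<integral>\<^sup>+u. L u \<omega> * indicator {u. t < u \<and> u \<le> v} u \<partial>lborel)" for v \<omega>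
  have \<Lambda>_joint: "(\<lambda>(v, \<omega>). \<Lambda> v \<omega>) \<in> borel_measurable (lborel \<Otimes>\<^sub>M Q)" unfolding \<Lambda>_def by measurable
  note [measurable (raw)] = jointly_measurable_compose[OF \<Lambda>_joint]
  \<comment> \<open>Up to the cut-off, \<Lambda>_v is e^{\<Gamma>_v} - e^{\<Gamma>_t}. Multiplied by
    x the identity holds for every v from t on: either \<Gamma>_v \<le> c and the cut-off is
    inactive, or both sides are 0.\<close>
  have K: "x v \<omega> * \<Lambda> v \<omega> + x v \<omega> * ennreal (ecum t \<omega>) = x v \<omega> * ennreal (ecum v \<omega>)"
    if \<omega>: "\<omega> \<in> space Q" and tv: "t \<le> v" for v \<omega>
  proof (cases "cum v \<omega> \<le> ennreal c")
    case True
    have small: "cum u \<omega> \<le> ennreal c" if "u \<le> v" for u using cum_mono[OF that] True by (rule order_trans)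
    have "\<Lambda> v \<omega> = (\<integral>\<^sup>+u\<in>{t<..v}. ennreal (gam u \<omega> * ecum u \<omega>) \<partial>lborel)"
      unfolding \<Lambda>_def by (intro nn_integral_cong) (auto simp: L_def indicator_def dest: small)
    moreover have "cum v \<omega> < \<infinity>" using True by (rule le_less_trans) simp
    ultimately have "\<Lambda> v \<omega> + ennreal (ecum t \<omega>) = ennreal (ecum v \<omega>)"
      using exp_cumulative_identity[OF \<omega> ts(1) tv] by simp
    then show ?thesis by (simp only: distrib_left[symmetric])
  next
    case False
    then have "x v \<omega> = 0" using x_zero[of v \<omega>] ts(1) tv by (simp add: not_le)
    then show ?thesis by simp
  qed
  define I where "I = (\<integral>\<^sup>+\<omega>. indicator B \<omega> * (\<integral>\<^sup>+r. p r \<omega> * ennreal (ecum r \<omega>) * indicator {t<..s} r \<partial>lborel) \<partial>Q)"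
  \<comment> \<open>Where x does not vanish, e^\<Gamma> is at most e^c, so the integrand is at most
    d e^c times the compensator density.\<close>
  have I_fin: "I < \<infinity>"
  proof -
    have bound: "p r \<omega> * ennreal (ecum r \<omega>) * indicator {t<..s} r
          \<le> ennreal (d * exp c) * (ennreal (gam r \<omega>) * indicator {r. 0 < r \<and> r \<le> T \<and> ereal r < \<tau> \<omega>} r)" for r \<omega>
    proof (cases "t < r \<and> r \<le> s \<and> ereal r < \<tau> \<omega> \<and> x r \<omega> \<noteq> 0")
      case True
      then have "cum r \<omega> \<le> ennreal c" using x_zero[of r \<omega>] ts by force
      then have "enn2real (cum r \<omega>) \<le> c" using c by (intro enn2real_leI)
      then have "ecum r \<omega> \<le> exp c" by (simp add: ecum_def)
      then have "x r \<omega> * ennreal (ecum r \<omega>) \<le> ennreal d * ennreal (exp c)"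
        using True ts by (intro mult_mono x_bound ennreal_leI) auto
      also have "\<dots> = ennreal (d * exp c)" by (simp add: ennreal_mult'')
      finally have "x r \<omega> * ennreal (ecum r \<omega>) * ennreal (gam r \<omega>) \<le> ennreal (d * exp c) * ennreal (gam r \<omega>)"
        by (rule mult_right_mono) simp
      then show ?thesis using True ts by (simp add: p_def indicator_def mult_ac)
    next
      case False
      then show ?thesis by (auto simp: p_def indicator_def)
    qed
    have "I \<le> (\<integral>\<^sup>+\<omega>. ennreal (d * exp c) * (\<integral>\<^sup>+r. ennreal (gam r \<omega>) * indicator {r. 0 < r \<and> r \<le> T \<and> ereal r < \<tau> \<omega>} r \<partial>lborel) \<partial>Q)"
      unfolding I_def
    proof (rule nn_integral_mono)
      fix \<omega> assume [simp]: "\<omega> \<in> space Q"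
      have "(\<integral>\<^sup>+r. p r \<omega> * ennreal (ecum r \<omega>) * indicator {t<..s} r \<partial>lborel)
        \<le> (\<integral>\<^sup>+r. ennreal (d * exp c) * (ennreal (gam r \<omega>) * indicator {r. 0 < r \<and> r \<le> T \<and> ereal r < \<tau> \<omega>} r) \<partial>lborel)"
        by (rule nn_integral_mono) (rule bound)
      also have "\<dots> = ennreal (d * exp c) * (\<integral>\<^sup>+r. ennreal (gam r \<omega>) * indicator {r. 0 < r \<and> r \<le> T \<and> ereal r < \<tau> \<omega>} r \<partial>lborel)"
        by (rule nn_integral_cmult) measurable
      finally show "indicator B \<omega> * (\<integral>\<^sup>+r. p r \<omega> * ennreal (ecum r \<omega>) * indicator {t<..s} r \<partial>lborel)
        \<le> ennreal (d * exp c) * (\<integral>\<^sup>+r. ennreal (gam r \<omega>) * indicator {r. 0 < r \<and> r \<le> T \<and> ereal r < \<tau> \<omega>} r \<partial>lborel)"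
        by (cases "\<omega> \<in> B") simp_all
    qed
    also have "\<dots> = ennreal (d * exp c) * (\<integral>\<^sup>+\<omega>. \<integral>\<^sup>+r. ennreal (gam r \<omega>) * indicator {r. 0 < r \<and> r \<le> T \<and> ereal r < \<tau> \<omega>} r \<partial>lborel \<partial>Q)"
      by (rule nn_integral_cmult) measurable
    also have "\<dots> \<le> ennreal (d * exp c) * 1"
      by (rule mult_left_mono[OF expected_compensator_le_1]) simp
    also have "\<dots> < \<infinity>" by simp
    finally show ?thesis .
  qed
  have left: "(\<integral>\<^sup>+u. indicator {t<..s} u * (\<integral>\<^sup>+\<omega>. indicator B \<omega> * L u \<omega> * (alive u \<omega> * x u \<omega>) \<partial>Q) \<partial>lborel) = I"
  proof -
    have "(\<integral>\<^sup>+u. indicator {t<..s} u * (\<integral>\<^sup>+\<omega>. indicator B \<omega> * L u \<omega> * (alive u \<omega> * x u \<omega>) \<partial>Q) \<partial>lborel)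
      = (\<integral>\<^sup>+u. \<integral>\<^sup>+\<omega>. indicator B \<omega> * (p u \<omega> * ennreal (ecum u \<omega>) * indicator {t<..s} u) \<partial>Q \<partial>lborel)"
    proof (rule nn_integral_cong)
      fix u :: real
      have pt: "indicator {t<..s} u * (indicator B \<omega> * L u \<omega> * (alive u \<omega> * x u \<omega>))
        = indicator B \<omega> * (p u \<omega> * ennreal (ecum u \<omega>) * indicator {t<..s} u)" for \<omega>
      proof (cases "t < u \<and> x u \<omega> \<noteq> 0")
        case True
        then have "cum u \<omega> \<le> ennreal c" using x_zero[of u \<omega>] ts by force
        moreover have "ennreal (gam u \<omega> * ecum u \<omega>) = ennreal (gam u \<omega>) * ennreal (ecum u \<omega>)"
          by (rule ennreal_mult) (auto simp: gam_nonneg ecum_def)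
        ultimately show ?thesis by (simp add: L_def p_def indicator_def mult_ac)
      qed (auto simp: p_def)
      have "indicator {t<..s} u * (\<integral>\<^sup>+\<omega>. indicator B \<omega> * L u \<omega> * (alive u \<omega> * x u \<omega>) \<partial>Q)
        = (\<integral>\<^sup>+\<omega>. indicator {t<..s} u * (indicator B \<omega> * L u \<omega> * (alive u \<omega> * x u \<omega>)) \<partial>Q)"
        by (rule nn_integral_cmult[symmetric]) measurable
      then show "indicator {t<..s} u * (\<integral>\<^sup>+\<omega>. indicator B \<omega> * L u \<omega> * (alive u \<omega> * x u \<omega>) \<partial>Q)
        = (\<integral>\<^sup>+\<omega>. indicator B \<omega> * (p u \<omega> * ennreal (ecum u \<omega>) * indicator {t<..s} u) \<partial>Q)"
        by (simp only: pt)
    qed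
    also have "\<dots> = (\<integral>\<^sup>+\<omega>. \<integral>\<^sup>+u. indicator B \<omega> * (p u \<omega> * ennreal (ecum u \<omega>) * indicator {t<..s} u) \<partial>lborel \<partial>Q)"
      by (rule LQ.Fubini'[symmetric]) measurable
    also have "\<dots> = I"
      unfolding I_def by (rule nn_integral_cong, rule nn_integral_cmult) measurable
    finally show ?thesis .
  qed
  define D where "D u \<omega> = (\<integral>\<^sup>+r. x r \<omega> * ennreal (gam r \<omega>) * indicator {r. u < r \<and> r \<le> s \<and> ereal r < \<tau> \<omega>} r \<partial>lborel)" for u \<omega>
  have D_joint: "(\<lambda>(v, \<omega>). D v \<omega>) \<in> borel_measurable (lborel \<Otimes>\<^sub>M Q)" unfolding D_def by measurable
  note [measurable (raw)] = jointly_measurable_compose[OF D_joint]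
  have D_eq: "D u \<omega> = (\<integral>\<^sup>+r. p r \<omega> * indicator {r. u < r \<and> r \<le> s} r \<partial>lborel)" for u \<omega>
    unfolding D_def p_def by (intro nn_integral_cong) (auto simp: indicator_def)
  \<comment> \<open>Fubini on the triangle t < u < r \<le> s: integrating the density L over u up to
    r turns it into \<Lambda>_r. The diagonal u = r is a null set.\<close>
  have swap: "(\<integral>\<^sup>+u. L u \<omega> * indicator {t<..s} u * D u \<omega> \<partial>lborel) = (\<integral>\<^sup>+r. p r \<omega> * indicator {t<..s} r * \<Lambda> r \<omega> \<partial>lborel)"
    if \<omega>: "\<omega> \<in> space Q" for \<omega>
  proof -
    have "(\<integral>\<^sup>+u. L u \<omega> * indicator {t<..s} u * D u \<omega> \<partial>lborel)
      = (\<integral>\<^sup>+u. \<integral>\<^sup>+r. L u \<omega> * indicator {t<..s} u * (p r \<omega> * indicator {r. u < r \<and> r \<le> s} r) \<partial>lborel \<partial>lborel)"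
      unfolding D_eq using \<omega> by (intro nn_integral_cong nn_integral_cmult[symmetric]) measurable
    also have "\<dots> = (\<integral>\<^sup>+r. \<integral>\<^sup>+u. L u \<omega> * indicator {t<..s} u * (p r \<omega> * indicator {r. u < r \<and> r \<le> s} r) \<partial>lborel \<partial>lborel)"
      using \<omega> by (intro lborel_pair.Fubini') measurable
    also have "\<dots> = (\<integral>\<^sup>+r. \<integral>\<^sup>+u. p r \<omega> * indicator {t<..s} r * (L u \<omega> * indicator {u. t < u \<and> u \<le> r} u) \<partial>lborel \<partial>lborel)"
    proof (rule nn_integral_cong, rule nn_integral_cong_AE)
      fix r :: real
      have "AE u in lborel. u \<noteq> r" by (rule AE_lborel_singleton)
      then show "AE u in lborel. L u \<omega> * indicator {t<..s} u * (p r \<omega> * indicator {r. u < r \<and> r \<le> s} r)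
        = p r \<omega> * indicator {t<..s} r * (L u \<omega> * indicator {u. t < u \<and> u \<le> r} u)"
        by eventually_elim (auto simp: indicator_def mult_ac)
    qed
    also have "\<dots> = (\<integral>\<^sup>+r. p r \<omega> * indicator {t<..s} r * \<Lambda> r \<omega> \<partial>lborel)"
      unfolding \<Lambda>_def using \<omega> by (intro nn_integral_cong nn_integral_cmult) measurable
    finally show ?thesis .
  qed
  have right: "(\<integral>\<^sup>+u. indicator {t<..s} u * (\<integral>\<^sup>+\<omega>. indicator B \<omega> * L u \<omega> * (a \<omega> + D u \<omega>) \<partial>Q) \<partial>lborel)
    = (\<integral>\<^sup>+\<omega>. indicator B \<omega> * (a \<omega> * \<Lambda> s \<omega> + (\<integral>\<^sup>+r. p r \<omega> * indicator {t<..s} r * \<Lambda> r \<omega> \<partial>lborel)) \<partial>Q)"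
  proof -
    have "(\<integral>\<^sup>+u. indicator {t<..s} u * (\<integral>\<^sup>+\<omega>. indicator B \<omega> * L u \<omega> * (a \<omega> + D u \<omega>) \<partial>Q) \<partial>lborel)
      = (\<integral>\<^sup>+u. \<integral>\<^sup>+\<omega>. indicator {t<..s} u * (indicator B \<omega> * L u \<omega> * (a \<omega> + D u \<omega>)) \<partial>Q \<partial>lborel)"
      by (intro nn_integral_cong nn_integral_cmult[symmetric]) measurable
    also have "\<dots> = (\<integral>\<^sup>+\<omega>. \<integral>\<^sup>+u. indicator {t<..s} u * (indicator B \<omega> * L u \<omega> * (a \<omega> + D u \<omega>)) \<partial>lborel \<partial>Q)"
      by (rule LQ.Fubini'[symmetric]) measurable
    also have "\<dots> = (\<integral>\<^sup>+\<omega>. indicator B \<omega> * (a \<omega> * \<Lambda> s \<omega> + (\<integral>\<^sup>+r. p r \<omega> * indicator {t<..s} r * \<Lambda> r \<omega> \<partial>lborel)) \<partial>Q)"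
    proof (rule nn_integral_cong)
      fix \<omega> assume \<omega>: "\<omega> \<in> space Q"
      have "(\<integral>\<^sup>+u. indicator {t<..s} u * (indicator B \<omega> * L u \<omega> * (a \<omega> + D u \<omega>)) \<partial>lborel)
        = (\<integral>\<^sup>+u. indicator B \<omega> * (a \<omega> * (L u \<omega> * indicator {u. t < u \<and> u \<le> s} u) + L u \<omega> * indicator {t<..s} u * D u \<omega>) \<partial>lborel)"
        by (intro nn_integral_cong) (auto simp: indicator_def algebra_simps)
      also have "\<dots> = indicator B \<omega> * (\<integral>\<^sup>+u. a \<omega> * (L u \<omega> * indicator {u. t < u \<and> u \<le> s} u) + L u \<omega> * indicator {t<..s} u * D u \<omega> \<partial>lborel)"
        using \<omega> by (intro nn_integral_cmult) measurable
      also have "(\<integral>\<^sup>+u. a \<omega> * (L u \<omega> * indicator {u. t < u \<and> u \<le> s} u) + L u \<omega> * indicator {t<..s} u * D u \<omega> \<partial>lborel)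
        = (\<integral>\<^sup>+u. a \<omega> * (L u \<omega> * indicator {u. t < u \<and> u \<le> s} u) \<partial>lborel) + (\<integral>\<^sup>+u. L u \<omega> * indicator {t<..s} u * D u \<omega> \<partial>lborel)"
        using \<omega> by (intro nn_integral_add) measurable
      also have "(\<integral>\<^sup>+u. a \<omega> * (L u \<omega> * indicator {u. t < u \<and> u \<le> s} u) \<partial>lborel) = a \<omega> * \<Lambda> s \<omega>"
        unfolding \<Lambda>_def using \<omega> by (intro nn_integral_cmult) measurable
      finally show "(\<integral>\<^sup>+u. indicator {t<..s} u * (indicator B \<omega> * L u \<omega> * (a \<omega> + D u \<omega>)) \<partial>lborel)
        = indicator B \<omega> * (a \<omega> * \<Lambda> s \<omega> + (\<integral>\<^sup>+r. p r \<omega> * indicator {t<..s} r * \<Lambda> r \<omega> \<partial>lborel))"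
        unfolding swap[OF \<omega>] .
    qed
    finally show ?thesis .
  qed
  have [measurable]: "\<Lambda> s \<in> borel_measurable Q" "D t \<in> borel_measurable Q"
    using jointly_measurable_compose[OF \<Lambda>_joint measurable_const measurable_ident_sets[OF refl], of s]
      jointly_measurable_compose[OF D_joint measurable_const measurable_ident_sets[OF refl], of t] by simp_all
  have I_eq: "I = (\<integral>\<^sup>+\<omega>. indicator B \<omega> * (a \<omega> * \<Lambda> s \<omega> + (\<integral>\<^sup>+r. p r \<omega> * indicator {t<..s} r * \<Lambda> r \<omega> \<partial>lborel)) \<partial>Q)"
    unfolding left[symmetric] right[symmetric]
  proof (rule nn_integral_cong)
    fix u :: real
    have "(\<integral>\<^sup>+\<omega>. indicator B \<omega> * L u \<omega> * (alive u \<omega> * x u \<omega>) \<partial>Q)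
      = (\<integral>\<^sup>+\<omega>. indicator B \<omega> * L u \<omega> * (a \<omega> + D u \<omega>) \<partial>Q)" if u: "t < u" "u \<le> s"
      unfolding a_def D_def
    proof (rule eq)
      have u': "0 \<le> u" "u \<le> T" using u ts by auto
      note [measurable] = gam_meas_F[OF u'] ecum_meas_F[OF u'] cum_meas_F[OF u']
      have [measurable]: "B \<in> sets (F u)" by (rule filtration_on_mono[OF F_filt ts(1) _ B]) (use u in simp)
      show "(\<lambda>\<omega>. indicator B \<omega> * L u \<omega>) \<in> borel_measurable (F u)" unfolding L_def by measurable
    qed (use u in auto)
    then show "indicator {t<..s} u * (\<integral>\<^sup>+\<omega>. indicator B \<omega> * L u \<omega> * (alive u \<omega> * x u \<omega>) \<partial>Q)
      = indicator {t<..s} u * (\<integral>\<^sup>+\<omega>. indicator B \<omega> * L u \<omega> * (a \<omega> + D u \<omega>) \<partial>Q)"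
      by (cases "t < u \<and> u \<le> s") auto
  qed
  have t_eq: "(\<integral>\<^sup>+\<omega>. indicator B \<omega> * (alive t \<omega> * x t \<omega> * ennreal (ecum t \<omega>)) \<partial>Q)
    = (\<integral>\<^sup>+\<omega>. indicator B \<omega> * ennreal (ecum t \<omega>) * (a \<omega> + D t \<omega>) \<partial>Q)"
  proof -
    have t: "t \<le> T" using ts by simp
    note [measurable] = ecum_meas_F[OF ts(1) t] B
    have "(\<lambda>\<omega>. indicator B \<omega> * ennreal (ecum t \<omega>)) \<in> borel_measurable (F t)" by measurable
    from eq[OF order_refl ts(2) this] show ?thesis unfolding a_def D_def by (simp add: mult_ac)
  qed
  \<comment> \<open>The hypothesis integrated against L over (t, s] is added to the hypothesis at t
    multiplied by e^{\<Gamma>_t}. On the right, \<Lambda> and e^{\<Gamma>_t} combine to e^\<Gamma>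
    by \<open>K\<close>, both in the terminal value and under the integral; the latter reproduces I,
    which cancels.\<close>
  have sum: "I + (\<integral>\<^sup>+\<omega>. indicator B \<omega> * (alive t \<omega> * x t \<omega> * ennreal (ecum t \<omega>)) \<partial>Q)
    = (\<integral>\<^sup>+\<omega>. indicator B \<omega> * (a \<omega> * \<Lambda> s \<omega> + (\<integral>\<^sup>+r. p r \<omega> * indicator {t<..s} r * \<Lambda> r \<omega> \<partial>lborel))
        + indicator B \<omega> * ennreal (ecum t \<omega>) * (a \<omega> + D t \<omega>) \<partial>Q)"
    unfolding I_eq t_eq by (rule nn_integral_add[symmetric]) measurable
  note sum
  also have "\<dots> = (\<integral>\<^sup>+\<omega>. indicator B \<omega> * (alive s \<omega> * x s \<omega> * ennreal (ecum s \<omega>))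
      + indicator B \<omega> * (\<integral>\<^sup>+r. p r \<omega> * ennreal (ecum r \<omega>) * indicator {t<..s} r \<partial>lborel) \<partial>Q)"
  proof (rule nn_integral_cong)
    fix \<omega> assume \<omega>: "\<omega> \<in> space Q"
    have 1: "a \<omega> * \<Lambda> s \<omega> + ennreal (ecum t \<omega>) * a \<omega> = alive s \<omega> * x s \<omega> * ennreal (ecum s \<omega>)"
      using K[OF \<omega> ts(2)] unfolding a_def by (simp add: indicator_def mult_ac)
    have "(\<integral>\<^sup>+r. p r \<omega> * indicator {t<..s} r * \<Lambda> r \<omega> \<partial>lborel) + ennreal (ecum t \<omega>) * D t \<omega>
      = (\<integral>\<^sup>+r. p r \<omega> * indicator {t<..s} r * \<Lambda> r \<omega> \<partial>lborel) + (\<integral>\<^sup>+r. ennreal (ecum t \<omega>) * (p r \<omega> * indicator {r. t < r \<and> r \<le> s} r) \<partial>lborel)"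
      unfolding D_eq by (rule arg_cong2[where f = "(+)", OF refl nn_integral_cmult[symmetric]]) (use \<omega> in measurable)
    also have "\<dots> = (\<integral>\<^sup>+r. p r \<omega> * indicator {t<..s} r * \<Lambda> r \<omega> + ennreal (ecum t \<omega>) * (p r \<omega> * indicator {r. t < r \<and> r \<le> s} r) \<partial>lborel)"
      using \<omega> by (intro nn_integral_add[symmetric]) measurable
    also have "\<dots> = (\<integral>\<^sup>+r. p r \<omega> * ennreal (ecum r \<omega>) * indicator {t<..s} r \<partial>lborel)"
    proof (rule nn_integral_cong)
      fix r :: real
      show "p r \<omega> * indicator {t<..s} r * \<Lambda> r \<omega> + ennreal (ecum t \<omega>) * (p r \<omega> * indicator {r. t < r \<and> r \<le> s} r)
        = p r \<omega> * ennreal (ecum r \<omega>) * indicator {t<..s} r"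
      proof (cases "t < r \<and> r \<le> s \<and> ereal r < \<tau> \<omega>")
        case True
        have "p r \<omega> * \<Lambda> r \<omega> + ennreal (ecum t \<omega>) * p r \<omega> = ennreal (gam r \<omega>) * (x r \<omega> * \<Lambda> r \<omega> + x r \<omega> * ennreal (ecum t \<omega>))"
          using True by (simp add: p_def distrib_left mult_ac)
        also have "\<dots> = ennreal (gam r \<omega>) * (x r \<omega> * ennreal (ecum r \<omega>))" using K[OF \<omega>, of r] True by simp
        also have "\<dots> = p r \<omega> * ennreal (ecum r \<omega>)" using True by (simp add: p_def mult_ac)
        finally show ?thesis using True by simp
      qed (auto simp: p_def)
    qed
    finally have 2: "(\<integral>\<^sup>+r. p r \<omega> * indicator {t<..s} r * \<Lambda> r \<omega> \<partial>lborel) + ennreal (ecum t \<omega>) * D t \<omega>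
      = (\<integral>\<^sup>+r. p r \<omega> * ennreal (ecum r \<omega>) * indicator {t<..s} r \<partial>lborel)" .
    have regroup: "i * (al + y) + i * e * (b + z) = i * (al + e * b) + i * (y + e * z)" for i al y e b z :: ennreal
      by (simp add: distrib_left add_ac mult_ac)
    show "indicator B \<omega> * (a \<omega> * \<Lambda> s \<omega> + (\<integral>\<^sup>+r. p r \<omega> * indicator {t<..s} r * \<Lambda> r \<omega> \<partial>lborel))
        + indicator B \<omega> * ennreal (ecum t \<omega>) * (a \<omega> + D t \<omega>)
      = indicator B \<omega> * (alive s \<omega> * x s \<omega> * ennreal (ecum s \<omega>))
      + indicator B \<omega> * (\<integral>\<^sup>+r. p r \<omega> * ennreal (ecum r \<omega>) * indicator {t<..s} r \<partial>lborel)"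
      unfolding 1[symmetric] 2[symmetric] by (rule regroup)
  qed
  also have "\<dots> = (\<integral>\<^sup>+\<omega>. indicator B \<omega> * (alive s \<omega> * x s \<omega> * ennreal (ecum s \<omega>)) \<partial>Q) + I"
    unfolding I_def by (rule nn_integral_add) measurable
  finally show ?thesis
    using I_fin unfolding add.commute[of _ I] ennreal_add_left_cancel by auto
qed

section \<open>Survival formula\<close>

lemma AE_P_imp_AE_Q:
  assumes "AE \<omega> in P. R \<omega>" "{\<omega>\<in>space Q. \<not> R \<omega>} \<in> sets (F T)"
  shows "AE \<omega> in Q. R \<omega>"
  using AE_Q_iff_AE_P[OF assms(2)] assms(1) by simp

definition disc :: "real \<Rightarrow> real \<Rightarrow> 'a \<Rightarrow> ennreal" where
  "disc t s \<omega> = expneg (Gamma_diff \<gamma> t s \<omega>)"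

text \<open>The discount factor splits into e^{\<Gamma>_t}, known at t, and e^{-\<Gamma>_s}, which
  belongs to the terminal value of the martingale. Finiteness of \<Gamma>_s is essential: the
  \<open>enn2real\<close> on the right would otherwise turn e^{-\<infinity>} into 1.\<close>

lemma disc_eq:
  assumes \<omega>: "\<omega> \<in> space Q" and ts: "0 \<le> t" "t \<le> s" "s \<le> T" and fin: "cum s \<omega> < \<infinity>"
  shows "disc t s \<omega> = ennreal (ecum t \<omega> * exp (- enn2real (cum s \<omega>)))"
proof -
  have "Gamma_diff \<gamma> t s \<omega> = (\<integral>\<^sup>+r\<in>{t<..s}. ennreal (gam r \<omega>) \<partial>lborel)"
    unfolding Gamma_diff_def using ts by (intro nn_integral_cong) (auto simp: indicator_def gam_eq)
  also have "\<dots> = ennreal (enn2real (cum s \<omega>) - enn2real (cum t \<omega>))"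
    unfolding cum_def
    by (rule nn_integral_increment[where t = t and v = s]) (use \<omega> ts fin gam_nonneg gam_path in \<open>auto simp: cum_def\<close>)
  finally have "Gamma_diff \<gamma> t s \<omega> = ennreal (enn2real (cum s \<omega>) - enn2real (cum t \<omega>))" .
  moreover have "enn2real (cum t \<omega>) \<le> enn2real (cum s \<omega>)"
    using cum_mono[OF ts(2), of \<omega>] fin by (intro enn2real_mono) simp_all
  ultimately show ?thesis by (simp add: disc_def expneg_def ecum_def exp_diff exp_minus divide_inverse)
qed

lemma cum_finite: "AE \<omega> in Q. \<forall>s\<le>T. cum s \<omega> < \<infinity>"
  using cum_T_finite by eventually_elim (use cum_mono le_less_trans in blast)

lemma cum_finite_P: "AE \<omega> in P. \<forall>s\<le>T. cum s \<omega> < \<infinity>"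
proof -
  have T: "0 \<le> T" using T_pos by simp
  have "{\<omega>\<in>space (F T). \<not> cum T \<omega> < \<infinity>} \<in> sets (F T)" using cum_meas_F[OF T order_refl] by measurable
  then have "AE \<omega> in P. cum T \<omega> < \<infinity>"
    using AE_Q_iff_AE_P[of "\<lambda>\<omega>. cum T \<omega> < \<infinity>"] cum_T_finite filtration_on_space[OF F_filt T] by simp
  then show ?thesis by eventually_elim (use cum_mono le_less_trans in blast)
qed

text \<open>A density, with respect to \<^term>\<open>P\<close> on \<^term>\<open>F t\<close>, of \<^term>\<open>Q\<close> restricted to \<open>{t < \<tau>}\<close>.\<close>
definition survival_weight :: "real \<Rightarrow> ('a \<Rightarrow> ennreal) \<Rightarrow> bool" where
  "survival_weight t w \<longleftrightarrow> w \<in> borel_measurable (F t) \<and>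
    (\<forall>H\<in>borel_measurable (F t). (\<integral>\<^sup>+\<omega>. w \<omega> * H \<omega> \<partial>P) = (\<integral>\<^sup>+\<omega>. alive t \<omega> * H \<omega> \<partial>Q))"

lemma survival_weight_measurable: "survival_weight t w \<Longrightarrow> w \<in> borel_measurable (F t)"
  by (simp add: survival_weight_def)

lemma survival_weight_integral:
  "survival_weight t w \<Longrightarrow> H \<in> borel_measurable (F t) \<Longrightarrow>
    (\<integral>\<^sup>+\<omega>. w \<omega> * H \<omega> \<partial>P) = (\<integral>\<^sup>+\<omega>. alive t \<omega> * H \<omega> \<partial>Q)"
  by (simp add: survival_weight_def)

text \<open>Radon-Nikodym on \<open>F t\<close>: a P-null event of \<open>F t\<close> lies in
  \<open>F T\<close>, so it is Q-null and in particular null for Q restricted to {t <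
  \<tau>}.\<close>

lemma survival_weight_exists:
  assumes t: "0 \<le> t" "t \<le> T"
  obtains w where "survival_weight t w"
proof -
  let ?D = "density Q (indicator {\<omega>. ereal t < \<tau> \<omega>})"
  let ?M = "restr_to_subalg P (F t)" and ?N = "restr_to_subalg ?D (F t)"
  have subD: "subalgebra ?D (F t)" using F_sub[OF t(1)] by (simp add: subalgebra_def)
  note subP = F_sub_P[OF t(1)]
  interpret M: prob_space ?M by (rule prob_space_restr_to_subalg[OF subP P(1)])
  have "absolutely_continuous ?M ?N"
    unfolding absolutely_continuous_def null_sets_restr_to_subalg[OF subP] null_sets_restr_to_subalg[OF subD]
  proof
    fix A assume A: "A \<in> null_sets P \<inter> sets (F t)"
    then have "A \<in> sets (F T)" using filtration_on_mono[OF F_filt t] by blast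
    then have "emeasure Q A = 0" using A P_equiv by auto
    then have "A \<in> null_sets Q" using A P(2) by auto
    then have "A \<in> null_sets ?D" by (subst null_sets_density_iff) (auto dest: AE_not_in elim: eventually_mono)
    then show "A \<in> null_sets ?D \<inter> sets (F t)" using A by simp
  qed
  moreover have "sets ?N = sets ?M" by (simp add: sets_restr_to_subalg[OF subP] sets_restr_to_subalg[OF subD])
  ultimately obtain w where w: "w \<in> borel_measurable ?M" "density ?M w = ?N"
    using M.Radon_Nikodym by blast
  have w_F: "w \<in> borel_measurable (F t)" by (rule measurable_in_subalg'[OF subP w(1)])
  have "survival_weight t w"
    unfolding survival_weight_def
  proof (intro conjI ballI)
    fix H :: "'a \<Rightarrow> ennreal" assume H: "H \<in> borel_measurable (F t)"
    note [measurable] = measurable_from_subalg[OF F_sub[OF t(1)] H]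
    have "(\<integral>\<^sup>+\<omega>. w \<omega> * H \<omega> \<partial>P) = (\<integral>\<^sup>+\<omega>. w \<omega> * H \<omega> \<partial>?M)"
      by (rule nn_integral_subalgebra2[OF subP, symmetric]) (use w_F H in measurable)
    also have "\<dots> = (\<integral>\<^sup>+\<omega>. H \<omega> \<partial>density ?M w)"
      by (rule nn_integral_density[symmetric]) (use w(1) measurable_in_subalg[OF subP H] in auto)
    also have "\<dots> = (\<integral>\<^sup>+\<omega>. H \<omega> \<partial>?D)" unfolding w(2) by (rule nn_integral_subalgebra2[OF subD H])
    also have "\<dots> = (\<integral>\<^sup>+\<omega>. alive t \<omega> * H \<omega> \<partial>Q)"
      by (rule nn_integral_density) measurable
    finally show "(\<integral>\<^sup>+\<omega>. w \<omega> * H \<omega> \<partial>P) = (\<integral>\<^sup>+\<omega>. alive t \<omega> * H \<omega> \<partial>Q)" .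
  qed (rule w_F)
  then show ?thesis by (rule that)
qed

text \<open>At s the product X e^\<Gamma> equals the payoff \<xi>, and
  \<open>exponential_hazard\<close> moves the expectation back to X_t e^{\<Gamma>_t} on {t <
  \<tau>}. There only \<open>F t\<close> information is left, so the survival weight carries it over
  to P, where the martingale property replaces X_t by its terminal value \<xi>
  e^{-\<Gamma>_s}.\<close>

lemma survival_formula_bounded:
  assumes ts: "0 \<le> t" "t \<le> s" "s \<le> T" and c: "0 \<le> c"
    and \<xi>_meas: "\<xi> \<in> borel_measurable (F s)" and \<xi>_bounds: "\<And>\<omega>. 0 \<le> \<xi> \<omega> \<and> \<xi> \<omega> \<le> (d::real)"
    and \<xi>_zero: "\<And>\<omega>. ennreal c < cum s \<omega> \<Longrightarrow> \<xi> \<omega> = 0"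
    and w: "survival_weight t w"
    and B: "B \<in> sets (F t)"
  shows "(\<integral>\<^sup>+\<omega>. indicator B \<omega> * (alive s \<omega> * ennreal (\<xi> \<omega>)) \<partial>Q)
    = (\<integral>\<^sup>+\<omega>. w \<omega> * indicator B \<omega> * ennreal (\<xi> \<omega> * (ecum t \<omega> * exp (- enn2real (cum s \<omega>)))) \<partial>P)"
proof -
  have s: "0 \<le> s" and tT: "t \<le> T" using ts by auto
  define Y where "Y \<omega> = \<xi> \<omega> * exp (- enn2real (cum s \<omega>))" for \<omega>
  have Y_F: "Y \<in> borel_measurable (F s)"
    using \<xi>_meas cum_meas_F[OF s ts(3)] unfolding Y_def by measurable
  have Y_Q[measurable]: "Y \<in> borel_measurable Q" by (rule filtration_on_borel[OF F_filt s Y_F])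
  have Y_P[measurable]: "Y \<in> borel_measurable P" using Y_Q by (simp add: borel_P)
  have \<xi>_Q[measurable]: "\<xi> \<in> borel_measurable Q" by (rule filtration_on_borel[OF F_filt s \<xi>_meas])
  have Y_bounds: "0 \<le> Y \<omega> \<and> Y \<omega> \<le> d" for \<omega>
  proof -
    have "Y \<omega> \<le> d * 1" unfolding Y_def by (rule mult_mono') (use \<xi>_bounds in auto)
    then show ?thesis using \<xi>_bounds by (simp add: Y_def)
  qed
  obtain X where X: "\<And>u. 0 \<le> u \<Longrightarrow> u \<le> T \<Longrightarrow> X u \<in> borel_measurable (F u)" and ad: "adapted F X" and cad: "cadlag Q X"
    and X_bounds: "\<And>u \<omega>. 0 \<le> u \<Longrightarrow> 0 \<le> X u \<omega> \<and> X u \<omega> \<le> d"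
    and X_int: "\<And>u B. 0 \<le> u \<Longrightarrow> u \<le> T \<Longrightarrow> B \<in> sets (F u) \<Longrightarrow>
       (\<integral>\<omega>. indicator B \<omega> * X u \<omega> \<partial>P) = (\<integral>\<omega>. indicator B \<omega> * Y \<omega> \<partial>P)"
    and lm: "local_martingale P F X"
    using regularized_martingale[OF Y_Q Y_bounds] by blast
  have X_Q[measurable]: "X u \<in> borel_measurable Q" if "0 \<le> u" for u by (rule adapted_borel[OF ad that])
  have X_P[measurable]: "X u \<in> borel_measurable P" if "0 \<le> u" for u using X_Q[OF that] by (simp add: borel_P)
  have X_P_int: "integrable P (X u)" if "0 \<le> u" for u
    by (rule P.integrable_const_bound[where B = d]) (use X_bounds X_P that in auto)
  have Y_P_int: "integrable P Y"
    by (rule P.integrable_const_bound[where B = d]) (use Y_bounds in auto)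
  \<comment> \<open>The truncation makes x vanish identically where \<Gamma>_r > c, as
    \<open>exponential_hazard\<close> demands pointwise; the martingale itself has this property
    only almost surely.\<close>
  define x where "x r \<omega> = ennreal (X (max 0 r) \<omega>) * (if cum r \<omega> \<le> ennreal c then 1 else 0)" for r \<omega>
  have x_joint: "(\<lambda>(r, \<omega>). x r \<omega>) \<in> borel_measurable (lborel \<Otimes>\<^sub>M Q)"
  proof -
    note [measurable (raw)] = cadlag_adapted_measurable[OF cad ad]
    show ?thesis unfolding x_def by measurable
  qed
  note [measurable (raw)] = jointly_measurable_compose[OF x_joint]
  have x_Q[measurable]: "x u \<in> borel_measurable Q" for u
    using jointly_measurable_compose[OF x_joint measurable_const measurable_ident_sets[OF refl], of u] by simp
  \<comment> \<open>On {\<Gamma>_u > c} also \<Gamma>_s > c, so the terminal value Y is 0. The event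
    belongs to \<open>F u\<close>, hence X_u has integral 0 over it and, being nonnegative, vanishes
    there almost surely.\<close>
  have x_AE: "AE \<omega> in Q. ennreal (X u \<omega>) = x u \<omega>" if u: "0 \<le> u" "u \<le> s" for u
  proof -
    have uT: "u \<le> T" using u ts by simp
    have sp: "space (F u) = space Q" by (rule filtration_on_space[OF F_filt u(1)])
    define A where "A = {\<omega>\<in>space Q. \<not> cum u \<omega> \<le> ennreal c}"
    have A: "A \<in> sets (F u)"
    proof -
      have "{\<omega>\<in>space (F u). \<not> cum u \<omega> \<le> ennreal c} \<in> sets (F u)" using cum_meas_F[OF u(1) uT] by measurable
      then show ?thesis by (simp add: A_def sp)
    qed
    have A_P: "A \<in> sets P" using filtration_on_sets[OF F_filt u(1) A] P(2) by simp
    have "Y \<omega> = 0" if "\<omega> \<in> A" for \<omega>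
      using that \<xi>_zero[of \<omega>] cum_mono[OF u(2), of \<omega>] by (auto simp: A_def Y_def not_le)
    then have "(\<integral>\<omega>. indicator A \<omega> * Y \<omega> \<partial>P) = 0"
      by (intro integral_eq_zero_AE AE_I2) (auto simp: indicator_def)
    then have "(\<integral>\<omega>. indicator A \<omega> * X u \<omega> \<partial>P) = 0" using X_int[OF u(1) uT A] by simp
    moreover have "integrable P (\<lambda>\<omega>. indicator A \<omega> * X u \<omega>)"
      using integrable_real_mult_indicator[OF A_P X_P_int[OF u(1)]] by (simp add: mult.commute)
    ultimately have "AE \<omega> in P. indicator A \<omega> * X u \<omega> = 0"
      using X_bounds[OF u(1)] by (subst (asm) integral_nonneg_eq_0_iff_AE) auto
    then have "AE \<omega> in P. \<not> cum u \<omega> \<le> ennreal c \<longrightarrow> X u \<omega> = 0"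
      using AE_space by eventually_elim (auto simp: A_def space_P indicator_def split: if_splits)
    moreover have "{\<omega>\<in>space Q. \<not> (\<not> cum u \<omega> \<le> ennreal c \<longrightarrow> X u \<omega> = 0)} \<in> sets (F T)"
    proof (rule filtration_on_mono[OF F_filt u(1) uT])
      have "{\<omega>\<in>space (F u). \<not> (\<not> cum u \<omega> \<le> ennreal c \<longrightarrow> X u \<omega> = 0)} \<in> sets (F u)"
        using cum_meas_F[OF u(1) uT] X[OF u(1) uT] by measurable
      then show "{\<omega>\<in>space Q. \<not> (\<not> cum u \<omega> \<le> ennreal c \<longrightarrow> X u \<omega> = 0)} \<in> sets (F u)" by (simp add: sp)
    qed
    ultimately have "AE \<omega> in Q. \<not> cum u \<omega> \<le> ennreal c \<longrightarrow> X u \<omega> = 0" by (rule AE_P_imp_AE_Q)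
    then show ?thesis by eventually_elim (use u in \<open>auto simp: x_def\<close>)
  qed
  have X_s: "AE \<omega> in Q. X s \<omega> = Y \<omega>"
  proof -
    interpret FS: finite_measure_subalgebra P "F s" by unfold_locales (rule F_sub_P[OF s])
    have "AE \<omega> in P. real_cond_exp P (F s) Y \<omega> = X s \<omega>"
    proof (rule FS.real_cond_exp_charact)
      show "(\<integral>\<omega>\<in>A. Y \<omega> \<partial>P) = (\<integral>\<omega>\<in>A. X s \<omega> \<partial>P)" if "A \<in> sets (F s)" for A
        using X_int[OF s ts(3) that] by (simp add: set_lebesgue_integral_def)
    qed (use X_P_int Y_P_int X s ts in auto)
    moreover have "AE \<omega> in P. real_cond_exp P (F s) Y \<omega> = Y \<omega>"
      by (rule FS.real_cond_exp_F_meas[OF Y_P_int Y_F])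
    ultimately have "AE \<omega> in P. X s \<omega> = Y \<omega>" by eventually_elim simp
    moreover have "{\<omega>\<in>space Q. \<not> X s \<omega> = Y \<omega>} \<in> sets (F T)"
    proof (rule filtration_on_mono[OF F_filt s ts(3)])
      have "{\<omega>\<in>space (F s). \<not> X s \<omega> = Y \<omega>} \<in> sets (F s)" using X[OF s ts(3)] Y_F by measurable
      then show "{\<omega>\<in>space Q. \<not> X s \<omega> = Y \<omega>} \<in> sets (F s)" by (simp add: filtration_on_space[OF F_filt s])
    qed
    ultimately show ?thesis by (rule AE_P_imp_AE_Q)
  qed
  \<comment> \<open>The equality holds almost surely at each fixed time; Fubini turns this into
    equality at almost all times along almost every path, which is what the integral over time
    needs.\<close>
  have x_AE_path: "AE \<omega> in Q. AE r in lborel. 0 < r \<and> r \<le> s \<longrightarrow> ennreal (X (max 0 r) \<omega>) = x r \<omega>"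
  proof -
    note [measurable (raw)] = cadlag_adapted_measurable[OF cad ad]
    have "AE r in lborel. AE \<omega> in Q. 0 < r \<and> r \<le> s \<longrightarrow> ennreal (X (max 0 r) \<omega>) = x r \<omega>"
    proof (rule AE_I2)
      fix r :: real
      show "AE \<omega> in Q. 0 < r \<and> r \<le> s \<longrightarrow> ennreal (X (max 0 r) \<omega>) = x r \<omega>"
        using x_AE[of r] by (cases "0 < r \<and> r \<le> s") auto
    qed
    moreover have "{z \<in> space (lborel \<Otimes>\<^sub>M Q). 0 < fst z \<and> fst z \<le> s \<longrightarrow> ennreal (X (max 0 (fst z)) (snd z)) = x (fst z) (snd z)} \<in> sets (lborel \<Otimes>\<^sub>M Q)"
      by measurable
    ultimately show ?thesis
      using LQ.AE_commute[of "\<lambda>r \<omega>. 0 < r \<and> r \<le> s \<longrightarrow> ennreal (X (max 0 r) \<omega>) = x r \<omega>"] by simp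
  qed
  have eq: "(\<integral>\<^sup>+\<omega>. H \<omega> * (alive u \<omega> * x u \<omega>) \<partial>Q)
        = (\<integral>\<^sup>+\<omega>. H \<omega> * (alive s \<omega> * x s \<omega>
          + (\<integral>\<^sup>+r. x r \<omega> * ennreal (gam r \<omega>) * indicator {r. u < r \<and> r \<le> s \<and> ereal r < \<tau> \<omega>} r \<partial>lborel)) \<partial>Q)"
    if u: "t \<le> u" "u \<le> s" and H: "H \<in> borel_measurable (F u)" for u H
  proof -
    have u0: "0 \<le> u" using u ts by simp
    let ?D = "\<lambda>\<omega>. \<integral>\<^sup>+r. ennreal (X r \<omega> * gam r \<omega>) * indicator {r. u < r \<and> r \<le> s \<and> ereal r < \<tau> \<omega>} r \<partial>lborel"
    let ?D' = "\<lambda>\<omega>. \<integral>\<^sup>+r. x r \<omega> * ennreal (gam r \<omega>) * indicator {r. u < r \<and> r \<le> s \<and> ereal r < \<tau> \<omega>} r \<partial>lborel"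
    have D_AE: "AE \<omega> in Q. ?D \<omega> = ?D' \<omega>"
      using x_AE_path
    proof eventually_elim
      case (elim \<omega>)
      show ?case
      proof (rule nn_integral_cong_AE)
        show "AE r in lborel. ennreal (X r \<omega> * gam r \<omega>) * indicator {r. u < r \<and> r \<le> s \<and> ereal r < \<tau> \<omega>} r
          = x r \<omega> * ennreal (gam r \<omega>) * indicator {r. u < r \<and> r \<le> s \<and> ereal r < \<tau> \<omega>} r"
          using elim
        proof eventually_elim
          case (elim r)
          show ?case
          proof (cases "u < r \<and> r \<le> s")
            case True
            then have "ennreal (X r \<omega>) = x r \<omega>" using elim u0 by (simp add: max_def split: if_splits)
            moreover have "ennreal (X r \<omega> * gam r \<omega>) = ennreal (X r \<omega>) * ennreal (gam r \<omega>)"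
              using True u0 by (intro ennreal_mult) (auto simp: X_bounds gam_nonneg)
            ultimately show ?thesis by simp
          qed auto
        qed
      qed
    qed
    have D_meas[measurable]: "?D \<in> borel_measurable Q"
    proof -
      note [measurable (raw)] = cadlag_adapted_measurable[OF cad ad]
      have "?D = (\<lambda>\<omega>. \<integral>\<^sup>+r. ennreal (X (max 0 r) \<omega> * gam r \<omega>) * indicator {r. u < r \<and> r \<le> s \<and> ereal r < \<tau> \<omega>} r \<partial>lborel)"
        by (rule ext, rule nn_integral_cong) (use u0 in \<open>auto simp: indicator_def max_def\<close>)
      then show ?thesis by simp
    qed
    have "(\<integral>\<^sup>+\<omega>. H \<omega> * (alive u \<omega> * x u \<omega>) \<partial>Q) = (\<integral>\<^sup>+\<omega>. H \<omega> * (alive u \<omega> * ennreal (X u \<omega>)) \<partial>Q)"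
      by (rule nn_integral_cong_AE) (use x_AE[OF u0 u(2)] in \<open>eventually_elim, simp\<close>)
    also have "\<dots> = (\<integral>\<^sup>+\<omega>. H \<omega> * (alive s \<omega> * ennreal (X s \<omega>) + ?D \<omega>) \<partial>Q)"
    proof (rule nn_integral_eq_if_eq_on_subalgebra[OF F_sub[OF u0] _ _ _ H])
      note [measurable] = X_Q[OF u0] X_Q[OF s]
      show "(\<lambda>\<omega>. alive u \<omega> * ennreal (X u \<omega>)) \<in> borel_measurable Q"
        "(\<lambda>\<omega>. alive s \<omega> * ennreal (X s \<omega>) + ?D \<omega>) \<in> borel_measurable Q" by measurable
    qed (rule hazard_equation_set[OF lm ad cad X_bounds u0 u(2) ts(3)])
    also have "\<dots> = (\<integral>\<^sup>+\<omega>. H \<omega> * (alive s \<omega> * x s \<omega> + ?D' \<omega>) \<partial>Q)"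
      by (rule nn_integral_cong_AE) (use x_AE[OF s order_refl] D_AE in \<open>eventually_elim, simp\<close>)
    finally show ?thesis .
  qed
  have "(\<integral>\<^sup>+\<omega>. indicator B \<omega> * (alive s \<omega> * ennreal (\<xi> \<omega>)) \<partial>Q)
    = (\<integral>\<^sup>+\<omega>. indicator B \<omega> * (alive s \<omega> * x s \<omega> * ennreal (ecum s \<omega>)) \<partial>Q)"
  proof (rule nn_integral_cong_AE)
    show "AE \<omega> in Q. indicator B \<omega> * (alive s \<omega> * ennreal (\<xi> \<omega>))
      = indicator B \<omega> * (alive s \<omega> * x s \<omega> * ennreal (ecum s \<omega>))"
      using x_AE[OF s order_refl] X_s
    proof eventually_elim
      case (elim \<omega>)
      have "x s \<omega> * ennreal (ecum s \<omega>) = ennreal (Y \<omega> * ecum s \<omega>)"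
        using elim Y_bounds by (simp add: ennreal_mult ecum_def)
      also have "Y \<omega> * ecum s \<omega> = \<xi> \<omega>" by (simp add: Y_def ecum_def exp_minus)
      finally show ?case by (simp add: mult.assoc)
    qed
  qed
  also have "\<dots> = (\<integral>\<^sup>+\<omega>. indicator B \<omega> * (alive t \<omega> * x t \<omega> * ennreal (ecum t \<omega>)) \<partial>Q)"
  proof (rule exponential_hazard[OF ts c x_joint _ _ eq B])
    show "x r \<omega> \<le> ennreal d" if "0 \<le> r" for r \<omega> using X_bounds[OF that] by (simp add: x_def ennreal_leI that)
    show "x r \<omega> = 0" if "0 \<le> r" "ennreal c < cum r \<omega>" for r \<omega> using that by (simp add: x_def not_le)
  qed
  also have "\<dots> = (\<integral>\<^sup>+\<omega>. alive t \<omega> * (indicator B \<omega> * ennreal (X t \<omega>) * ennreal (ecum t \<omega>)) \<partial>Q)"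
    by (rule nn_integral_cong_AE) (use x_AE[OF ts(1,2)] in \<open>eventually_elim, simp add: mult_ac\<close>)
  also have "\<dots> = (\<integral>\<^sup>+\<omega>. w \<omega> * (indicator B \<omega> * ennreal (X t \<omega>) * ennreal (ecum t \<omega>)) \<partial>P)"
  proof (rule survival_weight_integral[OF w, symmetric])
    note [measurable] = X[OF ts(1) tT] ecum_meas_F[OF ts(1) tT] B
    show "(\<lambda>\<omega>. indicator B \<omega> * ennreal (X t \<omega>) * ennreal (ecum t \<omega>)) \<in> borel_measurable (F t)" by measurable
  qed
  also have "\<dots> = (\<integral>\<^sup>+\<omega>. (w \<omega> * indicator B \<omega> * ennreal (ecum t \<omega>)) * ennreal (X t \<omega>) \<partial>P)" by (simp add: mult_ac)
  also have "\<dots> = (\<integral>\<^sup>+\<omega>. (w \<omega> * indicator B \<omega> * ennreal (ecum t \<omega>)) * ennreal (Y \<omega>) \<partial>P)"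
  proof (rule nn_integral_eq_if_eq_on_subalgebra[OF F_sub_P[OF ts(1)]])
    note [measurable] = ecum_meas_F[OF ts(1) tT] B survival_weight_measurable[OF w]
    show "(\<lambda>\<omega>. w \<omega> * indicator B \<omega> * ennreal (ecum t \<omega>)) \<in> borel_measurable (F t)" by measurable
    show "(\<lambda>\<omega>. ennreal (X t \<omega>)) \<in> borel_measurable P" using X_P[OF ts(1)] by measurable
    show "(\<lambda>\<omega>. ennreal (Y \<omega>)) \<in> borel_measurable P" by measurable
    fix A assume A: "A \<in> sets (F t)"
    then have A_P: "A \<in> sets P" using filtration_on_sets[OF F_filt ts(1) A] P(2) by simp
    have conv: "(\<integral>\<^sup>+\<omega>. indicator A \<omega> * ennreal (f \<omega>) \<partial>P) = ennreal (\<integral>\<omega>. indicator A \<omega> * f \<omega> \<partial>P)"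
      if "integrable P f" "\<And>\<omega>. 0 \<le> f \<omega>" for f
    proof -
      have "(\<integral>\<^sup>+\<omega>. indicator A \<omega> * ennreal (f \<omega>) \<partial>P) = (\<integral>\<^sup>+\<omega>. ennreal (indicator A \<omega> * f \<omega>) \<partial>P)"
        by (intro nn_integral_cong) (auto simp: indicator_def)
      also have "\<dots> = ennreal (\<integral>\<omega>. indicator A \<omega> * f \<omega> \<partial>P)"
        using integrable_real_mult_indicator[OF A_P that(1)] that(2)
        by (intro nn_integral_eq_integral) (auto simp: mult.commute)
      finally show ?thesis .
    qed
    show "(\<integral>\<^sup>+\<omega>. indicator A \<omega> * ennreal (X t \<omega>) \<partial>P) = (\<integral>\<^sup>+\<omega>. indicator A \<omega> * ennreal (Y \<omega>) \<partial>P)"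
      using conv[OF X_P_int[OF ts(1)]] conv[OF Y_P_int] X_int[OF ts(1) tT A] X_bounds[OF ts(1)] Y_bounds by simp
  qed
  also have "\<dots> = (\<integral>\<^sup>+\<omega>. w \<omega> * indicator B \<omega> * ennreal (\<xi> \<omega> * (ecum t \<omega> * exp (- enn2real (cum s \<omega>)))) \<partial>P)"
  proof (rule nn_integral_cong)
    fix \<omega>
    have "ennreal (ecum t \<omega>) * ennreal (Y \<omega>) = ennreal (\<xi> \<omega> * (ecum t \<omega> * exp (- enn2real (cum s \<omega>))))"
      using Y_bounds[of \<omega>] by (subst ennreal_mult[symmetric]) (auto simp: ecum_def Y_def mult_ac)
    then show "w \<omega> * indicator B \<omega> * ennreal (ecum t \<omega>) * ennreal (Y \<omega>)
      = w \<omega> * indicator B \<omega> * ennreal (\<xi> \<omega> * (ecum t \<omega> * exp (- enn2real (cum s \<omega>))))"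
      by (simp add: mult.assoc)
  qed
  finally show ?thesis .
qed

end

lemma SUP_min_of_nat: "(SUP n. min (x :: ennreal) (of_nat n)) = x"
proof -
  have "(SUP n. inf x (of_nat n :: ennreal)) = inf x (SUP n. of_nat n)" by (rule inf_SUP[symmetric])
  then show ?thesis by (simp add: ennreal_SUP_of_nat_eq_top inf_min)
qed

context invariance_time
begin

text \<open>The payoff is cut at n and set to 0 where \<Gamma>_s > n, so that the same n serves as
  both constants of the bounded case. Off the null set {\<Gamma>_s = \<infinity>} the cut payoffs
  increase to \<xi>, and monotone convergence applies under Q and under P.\<close>

lemma survival_formula:
  assumes ts: "0 \<le> t" "t \<le> s" "s \<le> T"
    and \<xi>_meas: "\<xi> \<in> borel_measurable (F s)"
    and w: "survival_weight t w"
    and B: "B \<in> sets (F t)"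
  shows "(\<integral>\<^sup>+\<omega>. indicator B \<omega> * (alive s \<omega> * \<xi> \<omega>) \<partial>Q)
    = (\<integral>\<^sup>+\<omega>. w \<omega> * indicator B \<omega> * (\<xi> \<omega> * disc t s \<omega>) \<partial>P)"
proof -
  have s: "0 \<le> s" using ts by simp
  have tT: "t \<le> T" using ts by simp
  note [measurable] = cum_meas_F[OF s ts(3)]
  define y where "y n \<omega> = min (\<xi> \<omega>) (of_nat n) * (if cum s \<omega> \<le> ennreal (real n) then 1 else 0)" for n \<omega>
  define z where "z n \<omega> = enn2real (y n \<omega>)" for n \<omega>
  define e where "e \<omega> = ennreal (ecum t \<omega> * exp (- enn2real (cum s \<omega>)))" for \<omega>
  have y_le: "y n \<omega> \<le> ennreal (real n)" for n \<omega>
    by (simp add: y_def ennreal_of_nat_eq_real_of_nat)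
  have z: "ennreal (z n \<omega>) = y n \<omega>" for n \<omega>
    using le_less_trans[OF y_le[of n \<omega>] ennreal_less_top] by (simp add: z_def)
  have y_mono: "y n \<omega> \<le> y (Suc n) \<omega>" for n \<omega>
  proof -
    have "min (\<xi> \<omega>) (of_nat n) \<le> min (\<xi> \<omega>) (of_nat (Suc n))"
      by (intro min.mono order_refl) (simp add: ennreal_of_nat_eq_real_of_nat ennreal_leI)
    moreover have "cum s \<omega> \<le> ennreal (real (Suc n))" if "cum s \<omega> \<le> ennreal (real n)"
      using that by (rule order_trans) (simp add: ennreal_leI)
    ultimately show ?thesis unfolding y_def by (intro mult_mono) auto
  qed
  have y_sup: "(SUP n. y n \<omega>) = \<xi> \<omega>" if fin: "cum s \<omega> < \<infinity>" for \<omega>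
  proof (rule antisym)
    show "(SUP n. y n \<omega>) \<le> \<xi> \<omega>" by (rule SUP_least) (simp add: y_def)
    obtain N :: nat where N: "cum s \<omega> \<le> of_nat N"
      using fin ennreal_Ex_less_of_nat[of "cum s \<omega>"] by (auto intro: less_imp_le)
    have "min (\<xi> \<omega>) (of_nat n) \<le> (SUP n. y n \<omega>)" for n
    proof -
      have "cum s \<omega> \<le> ennreal (real (max n N))"
        using N by (rule order_trans) (simp add: ennreal_of_nat_eq_real_of_nat ennreal_leI)
      then have "min (\<xi> \<omega>) (of_nat (max n N)) = y (max n N) \<omega>" by (simp add: y_def)
      moreover have "min (\<xi> \<omega>) (of_nat n) \<le> min (\<xi> \<omega>) (of_nat (max n N))"
        by (intro min.mono order_refl) (simp add: ennreal_of_nat_eq_real_of_nat ennreal_leI)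
      ultimately show ?thesis by (metis SUP_upper2 UNIV_I)
    qed
    then have "(SUP n. min (\<xi> \<omega>) (of_nat n)) \<le> (SUP n. y n \<omega>)" by (rule SUP_least)
    then show "\<xi> \<omega> \<le> (SUP n. y n \<omega>)" by (simp only: SUP_min_of_nat)
  qed
  have y_F: "y n \<in> borel_measurable (F s)" for n unfolding y_def using \<xi>_meas by measurable
  have y_Q[measurable]: "y n \<in> borel_measurable Q" for n by (rule measurable_from_subalg[OF F_sub[OF s] y_F])
  have y_P[measurable]: "y n \<in> borel_measurable P" for n by (rule measurable_from_subalg[OF F_sub_P[OF s] y_F])
  have w_P[measurable]: "w \<in> borel_measurable P" by (rule measurable_from_subalg[OF F_sub_P[OF ts(1)] survival_weight_measurable[OF w]])
  have B_Q[measurable]: "B \<in> sets Q" using filtration_on_sets[OF F_filt ts(1) B] .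
  have B_P[measurable]: "B \<in> sets P" using B_Q P(2) by simp
  have e_P[measurable]: "e \<in> borel_measurable P"
    using measurable_from_subalg[OF F_sub_P[OF s] cum_meas_F[OF s ts(3)]]
      measurable_from_subalg[OF F_sub_P[OF ts(1)] ecum_meas_F[OF ts(1) tT]]
    unfolding e_def by measurable
  have step: "(\<integral>\<^sup>+\<omega>. indicator B \<omega> * alive s \<omega> * y n \<omega> \<partial>Q) = (\<integral>\<^sup>+\<omega>. w \<omega> * indicator B \<omega> * e \<omega> * y n \<omega> \<partial>P)" for n
  proof -
    have "(\<integral>\<^sup>+\<omega>. indicator B \<omega> * (alive s \<omega> * ennreal (z n \<omega>)) \<partial>Q)
      = (\<integral>\<^sup>+\<omega>. w \<omega> * indicator B \<omega> * ennreal (z n \<omega> * (ecum t \<omega> * exp (- enn2real (cum s \<omega>)))) \<partial>P)"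
    proof (rule survival_formula_bounded[OF ts _ _ _ _ w B, where c = "real n" and d = "real n"])
      show "z n \<in> borel_measurable (F s)" using y_F[of n] unfolding z_def by measurable
      show "0 \<le> z n \<omega> \<and> z n \<omega> \<le> real n" for \<omega>
        unfolding z_def using enn2real_leI[OF _ y_le[of n \<omega>]] by simp
      show "z n \<omega> = 0" if "ennreal (real n) < cum s \<omega>" for \<omega> using that by (simp add: z_def y_def not_le)
    qed simp
    moreover have "ennreal (z n \<omega> * (ecum t \<omega> * exp (- enn2real (cum s \<omega>)))) = y n \<omega> * e \<omega>" for \<omega>
      unfolding z[symmetric] e_def by (rule ennreal_mult) (auto simp: z_def ecum_def)
    ultimately show ?thesis by (simp add: z mult_ac)
  qed
  have "(\<integral>\<^sup>+\<omega>. indicator B \<omega> * (alive s \<omega> * \<xi> \<omega>) \<partial>Q)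
    = (\<integral>\<^sup>+\<omega>. (SUP n. indicator B \<omega> * alive s \<omega> * y n \<omega>) \<partial>Q)"
  proof (rule nn_integral_cong_AE)
    show "AE \<omega> in Q. indicator B \<omega> * (alive s \<omega> * \<xi> \<omega>) = (SUP n. indicator B \<omega> * alive s \<omega> * y n \<omega>)"
      using cum_finite by eventually_elim (simp add: SUP_mult_left_ennreal[symmetric] y_sup ts mult.assoc)
  qed
  also have "\<dots> = (SUP n. \<integral>\<^sup>+\<omega>. indicator B \<omega> * alive s \<omega> * y n \<omega> \<partial>Q)"
  proof (rule nn_integral_monotone_convergence_SUP)
    show "incseq (\<lambda>n \<omega>. indicator B \<omega> * alive s \<omega> * y n \<omega>)"
      by (intro incseq_SucI le_funI mult_left_mono y_mono) simp
  qed measurable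
  also have "\<dots> = (SUP n. \<integral>\<^sup>+\<omega>. w \<omega> * indicator B \<omega> * e \<omega> * y n \<omega> \<partial>P)" by (simp only: step)
  also have "\<dots> = (\<integral>\<^sup>+\<omega>. (SUP n. w \<omega> * indicator B \<omega> * e \<omega> * y n \<omega>) \<partial>P)"
  proof (rule nn_integral_monotone_convergence_SUP[symmetric])
    show "incseq (\<lambda>n \<omega>. w \<omega> * indicator B \<omega> * e \<omega> * y n \<omega>)"
      by (intro incseq_SucI le_funI mult_left_mono y_mono) simp
  qed measurable
  also have "\<dots> = (\<integral>\<^sup>+\<omega>. w \<omega> * indicator B \<omega> * (\<xi> \<omega> * disc t s \<omega>) \<partial>P)"
  proof (rule nn_integral_cong_AE)
    show "AE \<omega> in P. (SUP n. w \<omega> * indicator B \<omega> * e \<omega> * y n \<omega>) = w \<omega> * indicator B \<omega> * (\<xi> \<omega> * disc t s \<omega>)"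
      using cum_finite_P AE_space
    proof eventually_elim
      case (elim \<omega>)
      then have "disc t s \<omega> = e \<omega>" unfolding e_def using ts by (intro disc_eq) (auto simp: space_P)
      then show ?case using elim ts by (simp add: SUP_mult_left_ennreal[symmetric] y_sup mult_ac)
    qed
  qed
  finally show ?thesis .
qed

text \<open>An event of \<open>G t\<close> may be exchanged for an event of \<open>F t\<close> with
  the same trace on {t < \<tau>}, so testing on \<open>F t\<close> determines the conditional
  expectation there. The weight w is used a second time, now to bring the conditional expectation
  under P, which is \<open>F t\<close>-measurable, back to an integral under Q.\<close>

lemma cond_exp_eq_before_tau:
  assumes t: "0 \<le> t" "t \<le> T"
    and w: "survival_weight t w"
    and f[measurable]: "f \<in> borel_measurable Q" and g: "g \<in> borel_measurable Q"
    and eq: "\<And>B. B \<in> sets (F t) \<Longrightarrow>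
      (\<integral>\<^sup>+\<omega>. indicator B \<omega> * (alive t \<omega> * f \<omega>) \<partial>Q) = (\<integral>\<^sup>+\<omega>. w \<omega> * indicator B \<omega> * g \<omega> \<partial>P)"
  shows "AE \<omega> in Q. ereal t < \<tau> \<omega> \<longrightarrow> nn_cond_exp Q (G t) f \<omega> = nn_cond_exp P (F t) g \<omega>"
proof -
  interpret GQ: finite_measure_subalgebra Q "G t" by unfold_locales (rule G_sub[OF t(1)])
  interpret FP: finite_measure_subalgebra P "F t" by unfold_locales (rule F_sub_P[OF t(1)])
  define h where "h = nn_cond_exp P (F t) g"
  define J where "J \<omega> = (indicator {\<omega>\<in>space Q. ereal t < \<tau> \<omega>} \<omega> :: ennreal)" for \<omega>
  have J_G: "J \<in> borel_measurable (G t)" unfolding J_def using tau_less_G[OF t(1)] by simp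
  have J_Q[measurable]: "J \<in> borel_measurable Q" by (rule measurable_from_subalg[OF G_sub[OF t(1)] J_G])
  have J_eq: "alive t \<omega> = J \<omega>" if "\<omega> \<in> space Q" for \<omega> using that by (simp add: J_def indicator_def)
  have h_F: "h \<in> borel_measurable (F t)" by (simp add: h_def)
  have h_G: "h \<in> borel_measurable (G t)"
    by (rule measurable_from_subalg[OF _ h_F])
      (use F_sub[OF t(1)] G_sub[OF t(1)] F_le_G[OF t(1)] in \<open>auto simp: subalgebra_def\<close>)
  have h_Q[measurable]: "h \<in> borel_measurable Q" by (rule measurable_from_subalg[OF F_sub[OF t(1)] h_F])
  have g_P: "g \<in> borel_measurable P" using g by (simp add: borel_P)
  have "AE \<omega> in Q. J \<omega> * h \<omega> = nn_cond_exp Q (G t) (\<lambda>\<omega>. J \<omega> * f \<omega>) \<omega>"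
  proof (rule GQ.nn_cond_exp_charact)
    show "(\<lambda>\<omega>. J \<omega> * f \<omega>) \<in> borel_measurable Q" by measurable
    show "(\<lambda>\<omega>. J \<omega> * h \<omega>) \<in> borel_measurable (G t)" using J_G h_G by measurable
    fix A assume A: "A \<in> sets (G t)"
    then obtain B where B: "B \<in> sets (F t)" "A \<inter> {\<omega>. ereal t < \<tau> \<omega>} = B \<inter> {\<omega>. ereal t < \<tau> \<omega>}"
      using key t(1) by blast
    have AB: "J \<omega> * k * indicator A \<omega> = indicator B \<omega> * (alive t \<omega> * k)" if "\<omega> \<in> space Q" for \<omega> and k :: ennreal
      using B(2) that by (auto simp: J_def indicator_def)
    have "(\<integral>\<^sup>+\<omega>\<in>A. (J \<omega> * f \<omega>) \<partial>Q) = (\<integral>\<^sup>+\<omega>. indicator B \<omega> * (alive t \<omega> * f \<omega>) \<partial>Q)"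
      by (rule nn_integral_cong) (rule AB)
    also have "\<dots> = (\<integral>\<^sup>+\<omega>. w \<omega> * indicator B \<omega> * g \<omega> \<partial>P)" by (rule eq[OF B(1)])
    also have "\<dots> = (\<integral>\<^sup>+\<omega>. w \<omega> * indicator B \<omega> * h \<omega> \<partial>P)"
      unfolding h_def by (rule FP.nn_cond_exp_intg[symmetric]) (use survival_weight_measurable[OF w] B(1) g_P in auto)
    also have "\<dots> = (\<integral>\<^sup>+\<omega>. w \<omega> * (indicator B \<omega> * h \<omega>) \<partial>P)" by (simp add: mult.assoc)
    also have "\<dots> = (\<integral>\<^sup>+\<omega>. alive t \<omega> * (indicator B \<omega> * h \<omega>) \<partial>Q)"
      by (rule survival_weight_integral[OF w]) (use B(1) h_F in measurable)
    also have "\<dots> = (\<integral>\<^sup>+\<omega>\<in>A. (J \<omega> * h \<omega>) \<partial>Q)"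
    proof (rule nn_integral_cong)
      fix \<omega> assume "\<omega> \<in> space Q"
      from AB[OF this, of "h \<omega>"]
      show "alive t \<omega> * (indicator B \<omega> * h \<omega>) = J \<omega> * h \<omega> * indicator A \<omega>"
        by (simp add: mult_ac)
    qed
    finally show "(\<integral>\<^sup>+\<omega>\<in>A. (J \<omega> * f \<omega>) \<partial>Q) = (\<integral>\<^sup>+\<omega>\<in>A. (J \<omega> * h \<omega>) \<partial>Q)" .
  qed
  moreover have "AE \<omega> in Q. J \<omega> * nn_cond_exp Q (G t) f \<omega> = nn_cond_exp Q (G t) (\<lambda>\<omega>. J \<omega> * f \<omega>) \<omega>"
    by (rule GQ.nn_cond_exp_prod[OF J_G f])
  ultimately show ?thesis
    using AE_space by eventually_elim (auto simp: J_def h_def indicator_def split: if_splits)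
qed

section \<open>Payment at the random time\<close>

lemma measurable_P_pair: "borel_measurable (lborel \<Otimes>\<^sub>M P) = borel_measurable (lborel \<Otimes>\<^sub>M Q)"
  by (rule measurable_cong_sets[OF sets_pair_measure_cong[OF refl P(2)] refl])

text \<open>The minimum with T keeps the dates in the range where \<open>\<gamma>\<close> coincides
  with its jointly measurable version \<open>gam\<close>.\<close>

lemma disc_joint:
  assumes "0 \<le> t"
  shows "(\<lambda>(s, \<omega>). disc t (min T s) \<omega>) \<in> borel_measurable (lborel \<Otimes>\<^sub>M Q)"
proof -
  have "(\<lambda>(s, \<omega>). disc t (min T s) \<omega>)
    = (\<lambda>(s, \<omega>). expneg (\<integral>\<^sup>+r. ennreal (gam r \<omega>) * indicator {r. t < r \<and> r \<le> min T s} r \<partial>lborel))"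
    unfolding disc_def Gamma_diff_def
    by (intro ext, clarsimp, rule arg_cong[where f = expneg], rule nn_integral_cong) (use assms in \<open>auto simp: indicator_def gam_eq\<close>)
  also have "\<dots> \<in> borel_measurable (lborel \<Otimes>\<^sub>M Q)" unfolding expneg_def by measurable
  finally show ?thesis .
qed

text \<open>The compensator spreads the payment K_\<tau> into the rate K_s \<gamma>_s paid while s <
  \<tau>. For each fixed s this is a survival payment with payoff K_s \<gamma>_s, known at s; Fubini
  before and after the change of measure does the rest.\<close>

lemma default_payment_formula:
  assumes t: "0 \<le> t" "t \<le> T" and K_nn: "\<forall>s \<omega>. 0 \<le> K s \<omega>" and K: "predictable Q F K"
  shows "AE \<omega> in Q. ereal t < \<tau> \<omega> \<longrightarrow>
    nn_cond_exp Q (G t) (\<lambda>\<omega>. ennreal (if \<tau> \<omega> \<le> ereal T then K (real_of_ereal (\<tau> \<omega>)) \<omega> else 0)) \<omega>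
    = nn_cond_exp P (F t) (\<lambda>\<omega>. \<integral>\<^sup>+ s\<in>{t..T}. ennreal (K s \<omega>) * expneg (Gamma_diff \<gamma> t s \<omega>) * ennreal (\<gamma> s \<omega>) \<partial>lborel) \<omega>"
proof -
  obtain w where w: "survival_weight t w"
    using survival_weight_exists[OF t] by blast
  have T: "0 \<le> T" using T_pos by simp
  define k where "k s \<omega> = K (max 0 (min T s)) \<omega>" for s \<omega>
  have k_eq: "k s \<omega> = K s \<omega>" if "0 \<le> s" "s \<le> T" for s \<omega> using that by (simp add: k_def max_def min_def)
  have k_joint: "(\<lambda>(s, \<omega>). k s \<omega>) \<in> borel_measurable (lborel \<Otimes>\<^sub>M Q)"
    using progressive_to_Q[OF predictable_progressive[OF F_filt K T] T] by (simp add: k_def)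
  note [measurable (raw)] = jointly_measurable_compose[OF k_joint] jointly_measurable_compose[OF disc_joint[OF t(1)]]
  define g where "g \<omega> = (\<integral>\<^sup>+ s\<in>{t..T}. ennreal (K s \<omega>) * expneg (Gamma_diff \<gamma> t s \<omega>) * ennreal (\<gamma> s \<omega>) \<partial>lborel)" for \<omega>
  have g_eq: "g \<omega> = (\<integral>\<^sup>+ s. ennreal (k s \<omega>) * disc t (min T s) \<omega> * ennreal (gam s \<omega>) * indicator {t<..T} s \<partial>lborel)" for \<omega>
  proof -
    have "g \<omega> = (\<integral>\<^sup>+ s\<in>{t<..T}. ennreal (K s \<omega>) * expneg (Gamma_diff \<gamma> t s \<omega>) * ennreal (\<gamma> s \<omega>) \<partial>lborel)"
      unfolding g_def by (rule null_boundary_point_nn_integral[symmetric])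
    also have "\<dots> = (\<integral>\<^sup>+ s. ennreal (k s \<omega>) * disc t (min T s) \<omega> * ennreal (gam s \<omega>) * indicator {t<..T} s \<partial>lborel)"
      by (intro nn_integral_cong) (use t in \<open>auto simp: indicator_def k_eq gam_eq disc_def min_def\<close>)
    finally show ?thesis .
  qed
  have g_Q: "g \<in> borel_measurable Q" unfolding g_eq[abs_def] by measurable
  note [measurable] = tau_graph_measurable
  have f_Q: "(\<lambda>\<omega>. ennreal (if \<tau> \<omega> \<le> ereal T then K (real_of_ereal (\<tau> \<omega>)) \<omega> else 0)) \<in> borel_measurable Q"
  proof -
    have "(\<lambda>\<omega>. K (real_of_ereal (\<tau> \<omega>)) \<omega>) \<in> borel_measurable Q"
      using measurable_compose[OF tau_graph_measurable K[unfolded predictable_def]] by simp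
    then show ?thesis by measurable
  qed
  show ?thesis
    unfolding g_def[symmetric]
  proof (rule cond_exp_eq_before_tau[OF t w f_Q g_Q])
    fix B assume B: "B \<in> sets (F t)"
    have B_Q[measurable]: "B \<in> sets Q" using filtration_on_sets[OF F_filt t(1) B] .
    have B_P[measurable]: "B \<in> sets P" using B_Q P(2) by simp
    have w_P[measurable]: "w \<in> borel_measurable P" by (rule measurable_from_subalg[OF F_sub_P[OF t(1)] survival_weight_measurable[OF w]])
    \<comment> \<open>Restricting to B and to times after t is done by the predictable process 1_B
      1_{(t,T]}, since the compensator formula accepts predictable integrands only.\<close>
    define l where "l = (\<lambda>x. ennreal ((\<lambda>(s, \<omega>). if t < s \<and> s \<le> T then indicator B \<omega> else 0) x * (\<lambda>(s, \<omega>). K s \<omega>) x))"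
    have l: "l \<in> borel_measurable (predictable_sigma Q F)"
    proof -
      have "(\<lambda>(s, \<omega>). if t < s \<and> s \<le> T then indicator B \<omega> else 0 :: real) \<in> borel_measurable (predictable_sigma Q F)"
        by (rule predictable_step[OF F_filt t(1)]) (use B in simp)
      then show ?thesis unfolding l_def using K unfolding predictable_def by measurable
    qed
    have "(\<integral>\<^sup>+\<omega>. indicator B \<omega> * (alive t \<omega> * ennreal (if \<tau> \<omega> \<le> ereal T then K (real_of_ereal (\<tau> \<omega>)) \<omega> else 0)) \<partial>Q)
      = (\<integral>\<^sup>+\<omega>. indicator {\<omega>. \<tau> \<omega> \<le> ereal T} \<omega> * l (real_of_ereal (\<tau> \<omega>), \<omega>) \<partial>Q)"
    proof (rule nn_integral_cong)
      fix \<omega> assume \<omega>: "\<omega> \<in> space Q"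
      show "indicator B \<omega> * (alive t \<omega> * ennreal (if \<tau> \<omega> \<le> ereal T then K (real_of_ereal (\<tau> \<omega>)) \<omega> else 0))
        = indicator {\<omega>. \<tau> \<omega> \<le> ereal T} \<omega> * l (real_of_ereal (\<tau> \<omega>), \<omega>)"
      proof (cases "\<tau> \<omega> \<le> ereal T")
        case True
        obtain r where r: "\<tau> \<omega> = ereal r" using real_tau(2)[OF \<omega> True] by metis
        show ?thesis using True by (auto simp: l_def indicator_def r)
      qed simp
    qed
    also have "\<dots> = (\<integral>\<^sup>+\<omega>. \<integral>\<^sup>+s. l (s, \<omega>) * ennreal (gam s \<omega>) * indicator {s. 0 < s \<and> s \<le> T \<and> ereal s < \<tau> \<omega>} s \<partial>lborel \<partial>Q)"
      by (rule compensator[OF l])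
    also have "\<dots> = (\<integral>\<^sup>+\<omega>. \<integral>\<^sup>+s. indicator {t<..T} s * (indicator B \<omega> * (alive s \<omega> * (ennreal (k s \<omega>) * ennreal (gam s \<omega>)))) \<partial>lborel \<partial>Q)"
      by (intro nn_integral_cong) (use t in \<open>auto simp: l_def indicator_def k_eq\<close>)
    also have "\<dots> = (\<integral>\<^sup>+s. \<integral>\<^sup>+\<omega>. indicator {t<..T} s * (indicator B \<omega> * (alive s \<omega> * (ennreal (k s \<omega>) * ennreal (gam s \<omega>)))) \<partial>Q \<partial>lborel)"
      by (rule LQ.Fubini') measurable
    also have "\<dots> = (\<integral>\<^sup>+s. \<integral>\<^sup>+\<omega>. indicator {t<..T} s * (w \<omega> * indicator B \<omega> * (ennreal (k s \<omega>) * ennreal (gam s \<omega>) * disc t (min T s) \<omega>)) \<partial>P \<partial>lborel)"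
    proof (rule nn_integral_cong)
      fix s :: real
      show "(\<integral>\<^sup>+\<omega>. indicator {t<..T} s * (indicator B \<omega> * (alive s \<omega> * (ennreal (k s \<omega>) * ennreal (gam s \<omega>)))) \<partial>Q)
        = (\<integral>\<^sup>+\<omega>. indicator {t<..T} s * (w \<omega> * indicator B \<omega> * (ennreal (k s \<omega>) * ennreal (gam s \<omega>) * disc t (min T s) \<omega>)) \<partial>P)"
      proof (cases "t < s \<and> s \<le> T")
        case True
        then have s: "0 \<le> s" "t \<le> s" "s \<le> T" using t by auto
        have "k s = K s" using s by (simp add: k_eq fun_eq_iff)
        then have "k s \<in> borel_measurable (F s)" using predictable_adapted[OF F_filt K s(1)] by simp
        then have "(\<lambda>\<omega>. ennreal (k s \<omega>) * ennreal (gam s \<omega>)) \<in> borel_measurable (F s)"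
          using gam_meas_F[OF s(1,3)] by measurable
        from survival_formula[OF t(1) s(2,3) this w B] show ?thesis using True by simp
      qed simp
    qed
    also have "\<dots> = (\<integral>\<^sup>+\<omega>. \<integral>\<^sup>+s. indicator {t<..T} s * (w \<omega> * indicator B \<omega> * (ennreal (k s \<omega>) * ennreal (gam s \<omega>) * disc t (min T s) \<omega>)) \<partial>lborel \<partial>P)"
    proof (rule LP.Fubini'[symmetric])
      have w_Q[measurable]: "w \<in> borel_measurable Q" by (rule measurable_from_subalg[OF F_sub[OF t(1)] survival_weight_measurable[OF w]])
      show "(\<lambda>(s, \<omega>). indicator {t<..T} s * (w \<omega> * indicator B \<omega> * (ennreal (k s \<omega>) * ennreal (gam s \<omega>) * disc t (min T s) \<omega>)))
        \<in> borel_measurable (lborel \<Otimes>\<^sub>M P)"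
        unfolding measurable_P_pair by measurable
    qed
    also have "\<dots> = (\<integral>\<^sup>+\<omega>. w \<omega> * indicator B \<omega> * g \<omega> \<partial>P)"
    proof (rule nn_integral_cong)
      fix \<omega> assume "\<omega> \<in> space P"
      then have \<omega>: "\<omega> \<in> space Q" by (simp add: space_P)
      have "(\<integral>\<^sup>+s. indicator {t<..T} s * (w \<omega> * indicator B \<omega> * (ennreal (k s \<omega>) * ennreal (gam s \<omega>) * disc t (min T s) \<omega>)) \<partial>lborel)
        = (\<integral>\<^sup>+s. w \<omega> * indicator B \<omega> * (ennreal (k s \<omega>) * disc t (min T s) \<omega> * ennreal (gam s \<omega>) * indicator {t<..T} s) \<partial>lborel)"
        by (intro nn_integral_cong) (simp add: mult_ac)
      also have "\<dots> = w \<omega> * indicator B \<omega> * g \<omega>"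
        unfolding g_eq using \<omega> by (intro nn_integral_cmult) measurable
      finally show "(\<integral>\<^sup>+s. indicator {t<..T} s * (w \<omega> * indicator B \<omega> * (ennreal (k s \<omega>) * ennreal (gam s \<omega>) * disc t (min T s) \<omega>)) \<partial>lborel)
        = w \<omega> * indicator B \<omega> * g \<omega>" .
    qed
    finally show "(\<integral>\<^sup>+\<omega>. indicator B \<omega> * (alive t \<omega> * ennreal (if \<tau> \<omega> \<le> ereal T then K (real_of_ereal (\<tau> \<omega>)) \<omega> else 0)) \<partial>Q)
      = (\<integral>\<^sup>+\<omega>. w \<omega> * indicator B \<omega> * g \<omega> \<partial>P)" .
  qed
qed

end

section \<open>Discretization of payment dates\<close>

text \<open>The least k with v \<le> k/2^n, for v \<ge> 0. Equality is allowed here, in contrast to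
  \<open>dyadic_above\<close>: a date on the grid is not moved.\<close>

definition grid_index :: "nat \<Rightarrow> real \<Rightarrow> nat" where
  "grid_index n v = nat \<lceil>2 ^ n * v\<rceil>"

definition grid_point :: "real \<Rightarrow> real \<Rightarrow> nat \<Rightarrow> nat \<Rightarrow> real" where
  "grid_point t T n k = max t (min T (real k / 2 ^ n))"

text \<open>Rounding up makes a payment on the k-th cell known at its grid date, and the rounded
  dates decrease to v as n grows. Clamping to [t, T] keeps them where the survival formula
  applies.\<close>

definition grid_above :: "real \<Rightarrow> real \<Rightarrow> nat \<Rightarrow> real \<Rightarrow> real" where
  "grid_above t T n v = grid_point t T n (grid_index n v)"

lemma grid_index_mono: "u \<le> v \<Longrightarrow> grid_index n u \<le> grid_index n v"
  unfolding grid_index_def by (intro nat_mono ceiling_mono mult_left_mono) auto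

lemma grid_index_le_iff: "grid_index n v \<le> k \<longleftrightarrow> v \<le> real k / 2 ^ n"
proof -
  have "grid_index n v \<le> k \<longleftrightarrow> \<lceil>2 ^ n * v\<rceil> \<le> int k" by (simp only: nat_le_iff grid_index_def)
  also have "\<dots> \<longleftrightarrow> 2 ^ n * v \<le> real k" by (metis ceiling_le_iff of_int_of_nat_eq)
  also have "\<dots> \<longleftrightarrow> v \<le> real k / 2 ^ n" by (simp add: field_simps)
  finally show ?thesis .
qed

lemma grid_index_bounds:
  assumes "0 \<le> v" shows "v \<le> real (grid_index n v) / 2 ^ n" "real (grid_index n v) / 2 ^ n \<le> v + 1 / 2 ^ n"
proof -
  show "v \<le> real (grid_index n v) / 2 ^ n" using grid_index_le_iff by blast
  have "real (grid_index n v) \<le> 2 ^ n * v + 1" 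
  proof -
    have "0 \<le> 2 ^ n * v" using assms by simp
    then have "real (grid_index n v) = of_int \<lceil>2 ^ n * v\<rceil>" unfolding grid_index_def by (subst of_nat_nat) auto
    then show ?thesis by (metis of_int_ceiling_le_add_one)
  qed
  then show "real (grid_index n v) / 2 ^ n \<le> v + 1 / 2 ^ n" by (simp add: field_simps)
qed

text \<open>Doubling the old index gives the same point on the finer grid, an admissible upper bound
  for v there.\<close>

lemma grid_index_Suc: "real (grid_index (Suc n) v) / 2 ^ Suc n \<le> real (grid_index n v) / 2 ^ n"
proof -
  have "v \<le> real (2 * grid_index n v) / 2 ^ Suc n" using grid_index_le_iff[of n v "grid_index n v"] by simp
  then have "grid_index (Suc n) v \<le> 2 * grid_index n v" by (simp only: grid_index_le_iff)
  then have "real (grid_index (Suc n) v) \<le> 2 * real (grid_index n v)" by linarith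
  then show ?thesis by (simp add: field_simps)
qed

lemma grid_point_in: "t \<le> T \<Longrightarrow> grid_point t T n k \<in> {t..T}"
  by (auto simp: grid_point_def)

lemma grid_above_in: "t \<le> T \<Longrightarrow> grid_above t T n v \<in> {t..T}"
  unfolding grid_above_def by (rule grid_point_in)

lemma grid_above_ge: "0 \<le> v \<Longrightarrow> v \<le> T \<Longrightarrow> v \<le> grid_above t T n v"
  using grid_index_bounds(1)[of v n] by (auto simp: grid_above_def grid_point_def)

lemma grid_above_le: "0 \<le> v \<Longrightarrow> t \<le> v \<Longrightarrow> grid_above t T n v \<le> v + 1 / 2 ^ n"
  using grid_index_bounds(2)[of v n] by (auto simp: grid_above_def grid_point_def min_def intro: order_trans)

lemma grid_above_Suc: "grid_above t T (Suc n) v \<le> grid_above t T n v"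
  using grid_index_Suc[of n v] by (auto simp: grid_above_def grid_point_def max_def min_def)

lemma grid_above_tendsto:
  assumes "0 \<le> t" "t \<le> v" "v \<le> T"
  shows "(\<lambda>n. grid_above t T n v) \<longlonglongrightarrow> v"
proof -
  have upper: "(\<lambda>n. v + 1 / 2 ^ n) \<longlonglongrightarrow> v"
    using tendsto_add[OF tendsto_const LIMSEQ_inverse_realpow_zero[of 2], of v] by (simp add: inverse_eq_divide)
  show ?thesis
    by (rule tendsto_sandwich[OF _ _ tendsto_const upper]) (use assms in \<open>auto intro!: always_eventually grid_above_ge grid_above_le\<close>)
qed

lemma sum_over_grid:
  fixes h :: "nat \<Rightarrow> 'b :: comm_monoid_add"
  assumes "v \<le> T"
  shows "(\<Sum>k\<le>grid_index n T. if grid_index n v = k then h k else 0) = h (grid_index n v)"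
  using grid_index_mono[OF assms] by (simp add: sum.delta')

text \<open>Dates in (t, T] with the same index form one interval between consecutive clamped grid
  points. For k = 0 natural subtraction makes both endpoints equal; the interval is empty, as it
  should be because t \<ge> 0.\<close>

lemma grid_cell:
  assumes t: "0 \<le> t" "t \<le> T"
  shows "{v. t < v \<and> v \<le> T \<and> grid_index n v = k} = {grid_point t T n (k - 1)<..grid_point t T n k}"
proof (cases k)
  case 0
  have "grid_index n v \<noteq> 0" if "t < v" for v
    using grid_index_le_iff[of n v 0] that t(1) by auto
  then have "{v. t < v \<and> v \<le> T \<and> grid_index n v = k} = {}" using 0 by blast
  then show ?thesis using 0 by (simp only: diff_0_eq_0 greaterThanAtMost_empty order_refl)
next
  case (Suc j)
  have cell: "grid_index n v = Suc j \<longleftrightarrow> real j / 2 ^ n < v \<and> v \<le> real (Suc j) / 2 ^ n" for v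
    using grid_index_le_iff[of n v j] grid_index_le_iff[of n v "Suc j"] by linarith
  have "{v. t < v \<and> v \<le> T \<and> grid_index n v = k} = {v. t < v \<and> v \<le> T \<and> real j / 2 ^ n < v \<and> v \<le> real (Suc j) / 2 ^ n}"
    unfolding Suc cell ..
  also have "\<dots> = {grid_point t T n (k - 1)<..grid_point t T n k}"
  proof -
    have "{v. t < v \<and> v \<le> T \<and> p < v \<and> v \<le> q} = {max t (min T p)<..max t (min T q)}" for p q :: real
      using t by auto
    then show ?thesis unfolding Suc grid_point_def by simp
  qed
  finally show ?thesis .
qed

context invariance_time
begin

lemma Gamma_diff_mono: "a \<le> b \<Longrightarrow> Gamma_diff \<gamma> t a \<omega> \<le> Gamma_diff \<gamma> t b \<omega>"
  unfolding Gamma_diff_def by (intro nn_integral_mono) (auto simp: indicator_def)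

lemma expneg_antimono: "x \<le> y \<Longrightarrow> expneg y \<le> expneg x"
  by (auto simp: expneg_def top_unique less_top intro!: ennreal_leI enn2real_mono)

lemma disc_antimono: "a \<le> b \<Longrightarrow> disc t b \<omega> \<le> disc t a \<omega>"
  unfolding disc_def by (intro expneg_antimono Gamma_diff_mono)

text \<open>\<Gamma> is continuous on paths where it is finite, so discounting to the rounded dates
  converges to discounting to v.\<close>

lemma disc_grid_SUP:
  assumes \<omega>: "\<omega> \<in> space Q" and tv: "0 \<le> t" "t \<le> v" "v \<le> T" and fin: "\<forall>s\<le>T. cum s \<omega> < \<infinity>"
  shows "(SUP n. disc t (grid_above t T n v) \<omega>) = disc t v \<omega>"
proof (rule LIMSEQ_unique[OF LIMSEQ_SUP])
  show "incseq (\<lambda>n. disc t (grid_above t T n v) \<omega>)" by (intro incseq_SucI disc_antimono grid_above_Suc)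
  have tT: "t \<le> T" using tv by simp
  have J: "continuous_on {0..T} (\<lambda>u. enn2real (cum u \<omega>))"
    by (rule cumulative_continuous[where t = 0 and v = T and g = "\<lambda>s. gam s \<omega>"])
      (use \<omega> fin T_pos gam_nonneg gam_path in \<open>auto simp: cum_def\<close>)
  have "(\<lambda>n. enn2real (cum (grid_above t T n v) \<omega>)) \<longlonglongrightarrow> enn2real (cum v \<omega>)"
    by (rule continuous_on_tendsto_compose[OF J grid_above_tendsto[OF tv]])
      (use tv grid_above_in[OF tT] in \<open>auto intro!: always_eventually intro: order_trans\<close>)
  then have "(\<lambda>n. ennreal (ecum t \<omega> * exp (- enn2real (cum (grid_above t T n v) \<omega>)))) \<longlonglongrightarrow> ennreal (ecum t \<omega> * exp (- enn2real (cum v \<omega>)))"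
    by (intro tendsto_ennrealI tendsto_mult tendsto_const tendsto_exp tendsto_minus)
  moreover have "disc t (grid_above t T n v) \<omega> = ennreal (ecum t \<omega> * exp (- enn2real (cum (grid_above t T n v) \<omega>)))" for n
    by (rule disc_eq[OF \<omega> tv(1)]) (use grid_above_in[OF tT, of n v] fin in auto)
  moreover have "disc t v \<omega> = ennreal (ecum t \<omega> * exp (- enn2real (cum v \<omega>)))"
    by (rule disc_eq[OF \<omega> tv]) (use fin tv in auto)
  ultimately show "(\<lambda>n. disc t (grid_above t T n v) \<omega>) \<longlonglongrightarrow> disc t v \<omega>" by simp
qed

lemma survival_grid_incseq:
  "alive (grid_above t T n v) \<omega> \<le> (indicator {\<omega>. ereal (grid_above t T (Suc n) v) < \<tau> \<omega>} \<omega> :: ennreal)"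
proof -
  have "ereal (grid_above t T (Suc n) v) \<le> ereal (grid_above t T n v)" using grid_above_Suc by simp
  from le_less_trans[OF this, of "\<tau> \<omega>"] show ?thesis by (simp add: indicator_def)
qed

text \<open>The strict inequality v < \<tau> persists for slightly later dates; this is what makes
  rounding up compatible with survival.\<close>

lemma survival_grid_SUP:
  assumes tv: "0 \<le> t" "t \<le> v" "v \<le> T"
  shows "(SUP n. alive (grid_above t T n v) \<omega>) = (alive v \<omega> :: ennreal)"
proof (cases "ereal v < \<tau> \<omega>")
  case False
  then have "\<not> ereal (grid_above t T n v) < \<tau> \<omega>" for n
    using grid_above_ge[of v T t n] tv by (meson ereal_less_eq(3) le_less_trans order_trans)
  then show ?thesis using False by simp
next
  case True
  have "(\<lambda>n. ereal (grid_above t T n v)) \<longlonglongrightarrow> ereal v" using grid_above_tendsto[OF tv] by simp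
  then have "\<forall>\<^sub>F n in sequentially. ereal (grid_above t T n v) < \<tau> \<omega>" using True by (rule order_tendstoD)
  then obtain N where N: "ereal (grid_above t T N v) < \<tau> \<omega>" unfolding eventually_sequentially by blast
  have "(SUP n. alive (grid_above t T n v) \<omega>) = (1 :: ennreal)"
  proof (rule antisym)
    show "(SUP n. alive (grid_above t T n v) \<omega>) \<le> (1 :: ennreal)"
      by (rule SUP_least) (simp add: indicator_def)
    show "(1 :: ennreal) \<le> (SUP n. alive (grid_above t T n v) \<omega>)"
      by (rule SUP_upper2[of N]) (use N in simp_all)
  qed
  then show ?thesis using True by simp
qed

lemma survival_formula_grid:
  assumes t: "0 \<le> t" "t \<le> T"
    and w: "survival_weight t w"
    and B: "B \<in> sets (F t)"
    and a: "\<And>k. a k \<in> borel_measurable (F (grid_point t T n k))"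
  shows "(\<integral>\<^sup>+\<omega>. indicator B \<omega> * (\<Sum>k\<le>N. alive (grid_point t T n k) \<omega> * a k \<omega>) \<partial>Q)
    = (\<integral>\<^sup>+\<omega>. w \<omega> * indicator B \<omega> * (\<Sum>k\<le>N. a k \<omega> * disc t (grid_point t T n k) \<omega>) \<partial>P)"
proof -
  have s: "0 \<le> grid_point t T n k" "t \<le> grid_point t T n k" "grid_point t T n k \<le> T" for k
    using grid_point_in[OF t(2), of n k] t by auto
  have B_Q[measurable]: "B \<in> sets Q" using filtration_on_sets[OF F_filt t(1) B] .
  have B_P[measurable]: "B \<in> sets P" using B_Q P(2) by simp
  have [measurable]: "a k \<in> borel_measurable Q" for k by (rule measurable_from_subalg[OF F_sub[OF s(1)] a])
  have [measurable]: "a k \<in> borel_measurable P" for k by (rule measurable_from_subalg[OF F_sub_P[OF s(1)] a])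
  have [measurable]: "w \<in> borel_measurable P" by (rule measurable_from_subalg[OF F_sub_P[OF t(1)] survival_weight_measurable[OF w]])
  have [measurable]: "disc t (grid_point t T n k) \<in> borel_measurable P" for k
    using jointly_measurable_compose[OF disc_joint[OF t(1)] measurable_const measurable_ident_sets[OF refl], of "grid_point t T n k"] s(3)[of k]
    by (simp add: borel_P min.absorb2)
  have "(\<integral>\<^sup>+\<omega>. indicator B \<omega> * (\<Sum>k\<le>N. alive (grid_point t T n k) \<omega> * a k \<omega>) \<partial>Q)
    = (\<Sum>k\<le>N. \<integral>\<^sup>+\<omega>. indicator B \<omega> * (alive (grid_point t T n k) \<omega> * a k \<omega>) \<partial>Q)"
    unfolding sum_distrib_left by (rule nn_integral_sum) measurable
  also have "\<dots> = (\<Sum>k\<le>N. \<integral>\<^sup>+\<omega>. w \<omega> * indicator B \<omega> * (a k \<omega> * disc t (grid_point t T n k) \<omega>) \<partial>P)"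
    by (intro sum.cong refl survival_formula s a w B t)
  also have "\<dots> = (\<integral>\<^sup>+\<omega>. w \<omega> * indicator B \<omega> * (\<Sum>k\<le>N. a k \<omega> * disc t (grid_point t T n k) \<omega>) \<partial>P)"
    unfolding sum_distrib_left by (rule nn_integral_sum[symmetric]) measurable
  finally show ?thesis .
qed

text \<open>\<open>stopped_sigma\<close> is a generated sigma-algebra, so the defining property of
  its generators is extended by induction; the complement step uses that {\<sigma> \<le> u} itself
  lies in \<open>F u\<close>.\<close>

lemma stopped_sigma_indicator:
  assumes \<sigma>: "stopping_time_on F (\<lambda>\<omega>. ereal (\<sigma> \<omega>))"
    and \<xi>: "\<xi> \<in> borel_measurable (stopped_sigma Q F (\<lambda>\<omega>. ereal (\<sigma> \<omega>)))"
    and u: "0 \<le> u" and C: "C \<in> sets borel"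
  shows "{\<omega>\<in>space Q. \<xi> \<omega> \<in> C \<and> \<sigma> \<omega> \<le> u} \<in> sets (F u)"
proof -
  let ?A = "{B. B \<in> sets Q \<and> (\<forall>s\<ge>0. B \<inter> {\<omega>. ereal (\<sigma> \<omega>) \<le> ereal s} \<in> sets (F s))}"
  have sub: "?A \<subseteq> Pow (space Q)" using sets.sets_into_space by auto
  have \<sigma>_le: "{\<omega>\<in>space Q. \<sigma> \<omega> \<le> s} \<in> sets (F s)" if "0 \<le> s" for s
  proof -
    have "{\<omega>\<in>space (F s). ereal (\<sigma> \<omega>) \<le> ereal s} \<in> sets (F s)"
      using \<sigma> that unfolding stopping_time_on_def by blast
    then show ?thesis using filtration_on_space[OF F_filt that] by simp
  qed
  have "\<xi> -` C \<inter> space Q \<in> sigma_sets (space Q) ?A"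
    using measurable_sets[OF \<xi> C] sub by (simp add: stopped_sigma_def space_measure_of sets_measure_of)
  then have "(\<xi> -` C \<inter> space Q) \<inter> {\<omega>. \<sigma> \<omega> \<le> u} \<in> sets (F u)"
  proof (induction rule: sigma_sets.induct)
    case (Basic B)
    then show ?case using u by auto
  next
    case Empty
    then show ?case by simp
  next
    case (Compl B)
    have "(space Q - B) \<inter> {\<omega>. \<sigma> \<omega> \<le> u} = {\<omega>\<in>space Q. \<sigma> \<omega> \<le> u} - B \<inter> {\<omega>. \<sigma> \<omega> \<le> u}" by auto
    then show ?case using Compl.IH \<sigma>_le[OF u] by auto
  next
    case (Union B)
    have eq: "(\<Union>i. B i) \<inter> {\<omega>. \<sigma> \<omega> \<le> u} = (\<Union>i. B i \<inter> {\<omega>. \<sigma> \<omega> \<le> u})" by auto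
    show ?case unfolding eq using Union.IH by (intro sets.countable_UN) auto
  qed
  moreover have "(\<xi> -` C \<inter> space Q) \<inter> {\<omega>. \<sigma> \<omega> \<le> u} = {\<omega>\<in>space Q. \<xi> \<omega> \<in> C \<and> \<sigma> \<omega> \<le> u}" by auto
  ultimately show ?thesis by simp
qed

text \<open>With \<sigma> rounded up to the grid, the payment becomes a finite sum of payments at
  fixed dates, each restricted to one cell of values of \<sigma>. Refinement decreases the date to
  \<sigma>, so the survival indicator under Q and the discount factor under P increase.\<close>

lemma terminal_payment_formula:
  assumes t: "0 \<le> t" "t \<le> T"
    and \<sigma>: "stopping_time_on F (\<lambda>\<omega>. ereal (\<sigma> \<omega>))"
    and \<sigma>_rng: "\<forall>\<omega>\<in>space Q. t \<le> \<sigma> \<omega> \<and> \<sigma> \<omega> \<le> T"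
    and \<xi>_nn: "\<forall>\<omega>\<in>space Q. 0 \<le> \<xi> \<omega>"
    and \<xi>: "\<xi> \<in> borel_measurable (stopped_sigma Q F (\<lambda>\<omega>. ereal (\<sigma> \<omega>)))"
  shows "AE \<omega> in Q. ereal t < \<tau> \<omega> \<longrightarrow>
    nn_cond_exp Q (G t) (\<lambda>\<omega>. ennreal (\<xi> \<omega> * indicator {\<omega>. ereal (\<sigma> \<omega>) < \<tau> \<omega>} \<omega>)) \<omega>
    = nn_cond_exp P (F t) (\<lambda>\<omega>. ennreal (\<xi> \<omega>) * expneg (Gamma_diff \<gamma> t (\<sigma> \<omega>) \<omega>)) \<omega>"
proof -
  obtain w where w: "survival_weight t w"
    using survival_weight_exists[OF t] by blast
  have T: "0 \<le> T" using T_pos by simp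
  have \<xi>_ind: "{\<omega>\<in>space Q. \<xi> \<omega> \<in> C \<and> \<sigma> \<omega> \<le> u} \<in> sets (F u)" if "0 \<le> u" "C \<in> sets borel" for u C
    by (rule stopped_sigma_indicator[OF \<sigma> \<xi> that])
  have \<sigma>_le: "{\<omega>\<in>space Q. \<sigma> \<omega> \<le> u} \<in> sets (F u)" if "0 \<le> u" for u
    using \<xi>_ind[OF that, of UNIV] by simp
  have \<sigma>_meas[measurable]: "\<sigma> \<in> borel_measurable Q"
    using stopping_time_measurable[OF \<sigma> F_filt] by simp
  have \<xi>_meas[measurable]: "\<xi> \<in> borel_measurable Q"
  proof (rule measurableI)
    fix C :: "real set" assume C: "C \<in> sets borel"
    have "\<xi> -` C \<inter> space Q = {\<omega>\<in>space Q. \<xi> \<omega> \<in> C \<and> \<sigma> \<omega> \<le> T}" using \<sigma>_rng by auto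
    then show "\<xi> -` C \<inter> space Q \<in> sets Q" using filtration_on_sets[OF F_filt T \<xi>_ind[OF T C]] by simp
  qed simp
  define c where "c n \<omega> = grid_above t T n (\<sigma> \<omega>)" for n \<omega>
  have c_in: "t \<le> c n \<omega>" "c n \<omega> \<le> T" for n \<omega> using grid_above_in[OF t(2), of n "\<sigma> \<omega>"] by (auto simp: c_def)
  have c_meas[measurable]: "c n \<in> borel_measurable Q" for n
    unfolding c_def grid_above_def grid_point_def grid_index_def by measurable
  note [measurable (raw)] = jointly_measurable_compose[OF disc_joint[OF t(1)]]
  have disc_c[measurable]: "(\<lambda>\<omega>. disc t (c n \<omega>) \<omega>) \<in> borel_measurable Q" for n
  proof -
    have "(\<lambda>\<omega>. disc t (min T (c n \<omega>)) \<omega>) \<in> borel_measurable Q" by measurable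
    then show ?thesis using c_in(2) by (simp add: min.absorb2)
  qed
  define a where "a n k \<omega> = (if grid_index n (\<sigma> \<omega>) = k then ennreal (\<xi> \<omega>) else 0)" for n k \<omega>
  have a_F: "a n k \<in> borel_measurable (F (grid_point t T n k))" for n k
  proof -
    let ?s = "grid_point t T n k"
    have s: "0 \<le> ?s" "?s \<le> T" using grid_point_in[OF t(2), of n k] t by auto
    have sp: "space (F ?s) = space Q" by (rule filtration_on_space[OF F_filt s(1)])
    \<comment> \<open>The unclamped grid value may exceed T while ?s does not; the event is then the
      whole space, because \<sigma> \<le> T.\<close>
    have le: "{\<omega>\<in>space Q. \<sigma> \<omega> \<le> real j / 2 ^ n} \<in> sets (F ?s)" if "j \<le> k" for j
    proof (cases "real j / 2 ^ n \<le> T")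
      case True
      have "real j / 2 ^ n \<le> real k / 2 ^ n" using that by (simp add: divide_right_mono)
      then have "real j / 2 ^ n \<le> ?s" using True by (simp add: grid_point_def)
      then show ?thesis using filtration_on_mono[OF F_filt _ _ \<sigma>_le] by simp
    next
      case False
      then have "{\<omega>\<in>space Q. \<sigma> \<omega> \<le> real j / 2 ^ n} = space (F ?s)" using \<sigma>_rng sp by force
      then show ?thesis by simp
    qed
    have cell: "{\<omega>\<in>space (F ?s). grid_index n (\<sigma> \<omega>) = k} \<in> sets (F ?s)"
    proof (cases k)
      case 0
      then have "{\<omega>\<in>space (F ?s). grid_index n (\<sigma> \<omega>) = k} = {\<omega>\<in>space Q. \<sigma> \<omega> \<le> real k / 2 ^ n}"
        using grid_index_le_iff[of n _ 0] sp by auto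
      then show ?thesis using le[of k] by simp
    next
      case (Suc j)
      then have "{\<omega>\<in>space (F ?s). grid_index n (\<sigma> \<omega>) = k} = {\<omega>\<in>space Q. \<sigma> \<omega> \<le> real k / 2 ^ n} - {\<omega>\<in>space Q. \<sigma> \<omega> \<le> real j / 2 ^ n}"
        using sp by (auto simp: grid_index_le_iff[symmetric] simp del: of_nat_Suc)
      then show ?thesis using le[of k] le[of j] Suc by auto
    qed
    \<comment> \<open>The payoff need not be known at ?s on its own, only on {\<sigma> \<le> ?s};
      this event contains the cell under consideration.\<close>
    have "(\<lambda>\<omega>. if \<sigma> \<omega> \<le> ?s then \<xi> \<omega> else 0) \<in> borel_measurable (F ?s)"
    proof (rule measurableI)
      fix C :: "real set" assume C: "C \<in> sets borel"
      have "(\<lambda>\<omega>. if \<sigma> \<omega> \<le> ?s then \<xi> \<omega> else 0) -` C \<inter> space (F ?s)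
        = {\<omega>\<in>space Q. \<xi> \<omega> \<in> C \<and> \<sigma> \<omega> \<le> ?s} \<union> (if 0 \<in> C then space (F ?s) - {\<omega>\<in>space Q. \<sigma> \<omega> \<le> ?s} else {})"
        using sp by (auto split: if_splits)
      then show "(\<lambda>\<omega>. if \<sigma> \<omega> \<le> ?s then \<xi> \<omega> else 0) -` C \<inter> space (F ?s) \<in> sets (F ?s)"
        using \<xi>_ind[OF s(1) C] \<sigma>_le[OF s(1)] by auto
    qed simp
    then have "(\<lambda>\<omega>. if grid_index n (\<sigma> \<omega>) = k then ennreal (if \<sigma> \<omega> \<le> ?s then \<xi> \<omega> else 0) else 0) \<in> borel_measurable (F ?s)"
      using cell by measurable
    moreover have "a n k \<omega> = (if grid_index n (\<sigma> \<omega>) = k then ennreal (if \<sigma> \<omega> \<le> ?s then \<xi> \<omega> else 0) else 0)" if "\<omega> \<in> space (F ?s)" for \<omega>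
    proof -
      have "\<sigma> \<omega> \<le> ?s" if "grid_index n (\<sigma> \<omega>) = k"
        using grid_above_ge[of "\<sigma> \<omega>" T t n] \<sigma>_rng \<open>\<omega> \<in> space (F ?s)\<close> sp that t by (auto simp: grid_above_def)
      then show ?thesis by (simp add: a_def)
    qed
    ultimately show ?thesis by (simp cong: measurable_cong)
  qed
  have sum_Q: "(\<Sum>k\<le>grid_index n T. alive (grid_point t T n k) \<omega> * a n k \<omega>)
    = indicator {\<omega>. ereal (c n \<omega>) < \<tau> \<omega>} \<omega> * ennreal (\<xi> \<omega>)" if "\<omega> \<in> space Q" for n \<omega>
  proof -
    have "(\<Sum>k\<le>grid_index n T. alive (grid_point t T n k) \<omega> * a n k \<omega>)
      = (\<Sum>k\<le>grid_index n T. if grid_index n (\<sigma> \<omega>) = k then alive (grid_point t T n k) \<omega> * ennreal (\<xi> \<omega>) else 0)"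
      by (intro sum.cong) (auto simp: a_def)
    also have "\<dots> = indicator {x. ereal (grid_point t T n (grid_index n (\<sigma> \<omega>))) < \<tau> x} \<omega> * ennreal (\<xi> \<omega>)"
      using sum_over_grid[of "\<sigma> \<omega>" T n "\<lambda>k. alive (grid_point t T n k) \<omega> * ennreal (\<xi> \<omega>)"] \<sigma>_rng that
      by blast
    finally show ?thesis by (simp add: c_def grid_above_def indicator_def)
  qed
  have sum_P: "(\<Sum>k\<le>grid_index n T. a n k \<omega> * disc t (grid_point t T n k) \<omega>) = ennreal (\<xi> \<omega>) * disc t (c n \<omega>) \<omega>" if "\<omega> \<in> space Q" for n \<omega>
  proof -
    have "(\<Sum>k\<le>grid_index n T. a n k \<omega> * disc t (grid_point t T n k) \<omega>)
      = (\<Sum>k\<le>grid_index n T. if grid_index n (\<sigma> \<omega>) = k then ennreal (\<xi> \<omega>) * disc t (grid_point t T n k) \<omega> else 0)"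
      by (intro sum.cong) (auto simp: a_def)
    also have "\<dots> = ennreal (\<xi> \<omega>) * disc t (grid_point t T n (grid_index n (\<sigma> \<omega>))) \<omega>"
      using sum_over_grid[of "\<sigma> \<omega>" T n "\<lambda>k. ennreal (\<xi> \<omega>) * disc t (grid_point t T n k) \<omega>"] \<sigma>_rng that
      by blast
    finally show ?thesis by (simp add: c_def grid_above_def)
  qed
  have g_Q: "(\<lambda>\<omega>. ennreal (\<xi> \<omega>) * expneg (Gamma_diff \<gamma> t (\<sigma> \<omega>) \<omega>)) \<in> borel_measurable Q"
  proof -
    have "(\<lambda>\<omega>. ennreal (\<xi> \<omega>) * disc t (min T (\<sigma> \<omega>)) \<omega>) \<in> borel_measurable Q" by measurable
    then show ?thesis using \<sigma>_rng by (subst measurable_cong[where g = "\<lambda>\<omega>. ennreal (\<xi> \<omega>) * disc t (min T (\<sigma> \<omega>)) \<omega>"]) (auto simp: disc_def min.absorb2)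
  qed
  show ?thesis
  proof (rule cond_exp_eq_before_tau[OF t w _ g_Q])
    show "(\<lambda>\<omega>. ennreal (\<xi> \<omega> * indicator {\<omega>. ereal (\<sigma> \<omega>) < \<tau> \<omega>} \<omega>)) \<in> borel_measurable Q" by measurable
    fix B assume B: "B \<in> sets (F t)"
    have B_Q[measurable]: "B \<in> sets Q" using filtration_on_sets[OF F_filt t(1) B] .
    have B_P[measurable]: "B \<in> sets P" using B_Q P(2) by simp
    have [measurable]: "w \<in> borel_measurable P" by (rule measurable_from_subalg[OF F_sub_P[OF t(1)] survival_weight_measurable[OF w]])
    have [measurable]: "\<xi> \<in> borel_measurable P" "(\<lambda>\<omega>. disc t (c n \<omega>) \<omega>) \<in> borel_measurable P" for n
      using \<xi>_meas disc_c by (simp_all add: borel_P)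
    have step: "(\<integral>\<^sup>+\<omega>. indicator B \<omega> * ennreal (\<xi> \<omega>) * indicator {\<omega>. ereal (c n \<omega>) < \<tau> \<omega>} \<omega> \<partial>Q)
      = (\<integral>\<^sup>+\<omega>. w \<omega> * indicator B \<omega> * ennreal (\<xi> \<omega>) * disc t (c n \<omega>) \<omega> \<partial>P)" for n
    proof -
      have "(\<integral>\<^sup>+\<omega>. indicator B \<omega> * ennreal (\<xi> \<omega>) * indicator {\<omega>. ereal (c n \<omega>) < \<tau> \<omega>} \<omega> \<partial>Q)
        = (\<integral>\<^sup>+\<omega>. indicator B \<omega> * (\<Sum>k\<le>grid_index n T. alive (grid_point t T n k) \<omega> * a n k \<omega>) \<partial>Q)"
        by (rule nn_integral_cong, subst sum_Q, assumption) (simp only: mult_ac)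
      also have "\<dots> = (\<integral>\<^sup>+\<omega>. w \<omega> * indicator B \<omega> * (\<Sum>k\<le>grid_index n T. a n k \<omega> * disc t (grid_point t T n k) \<omega>) \<partial>P)"
        by (rule survival_formula_grid[OF t w B a_F])
      also have "\<dots> = (\<integral>\<^sup>+\<omega>. w \<omega> * indicator B \<omega> * ennreal (\<xi> \<omega>) * disc t (c n \<omega>) \<omega> \<partial>P)"
        by (rule nn_integral_cong, subst sum_P, simp add: space_P) (simp only: mult_ac)
      finally show ?thesis .
    qed
    have "(\<integral>\<^sup>+\<omega>. indicator B \<omega> * (alive t \<omega> * ennreal (\<xi> \<omega> * indicator {\<omega>. ereal (\<sigma> \<omega>) < \<tau> \<omega>} \<omega>)) \<partial>Q)
      = (\<integral>\<^sup>+\<omega>. (SUP n. indicator B \<omega> * ennreal (\<xi> \<omega>) * indicator {\<omega>. ereal (c n \<omega>) < \<tau> \<omega>} \<omega>) \<partial>Q)"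
    proof (rule nn_integral_cong)
      fix \<omega> assume \<omega>: "\<omega> \<in> space Q"
      have rng: "t \<le> \<sigma> \<omega>" "\<sigma> \<omega> \<le> T" using \<sigma>_rng \<omega> by auto
      have "ereal t < \<tau> \<omega>" if "ereal (\<sigma> \<omega>) < \<tau> \<omega>" using that rng by (meson ereal_less_eq(3) le_less_trans)
      then have "alive t \<omega> * ennreal (\<xi> \<omega> * indicator {\<omega>. ereal (\<sigma> \<omega>) < \<tau> \<omega>} \<omega>)
        = ennreal (\<xi> \<omega>) * indicator {\<omega>. ereal (\<sigma> \<omega>) < \<tau> \<omega>} \<omega>"
        by (auto simp: indicator_def)
      moreover have "(SUP n. indicator {\<omega>. ereal (c n \<omega>) < \<tau> \<omega>} \<omega>) = (indicator {\<omega>. ereal (\<sigma> \<omega>) < \<tau> \<omega>} \<omega> :: ennreal)"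
        using survival_grid_SUP[OF t(1) rng, of \<omega>] by (simp add: c_def indicator_def)
      ultimately show "indicator B \<omega> * (alive t \<omega> * ennreal (\<xi> \<omega> * indicator {\<omega>. ereal (\<sigma> \<omega>) < \<tau> \<omega>} \<omega>))
        = (SUP n. indicator B \<omega> * ennreal (\<xi> \<omega>) * indicator {\<omega>. ereal (c n \<omega>) < \<tau> \<omega>} \<omega>)"
        by (simp add: SUP_mult_left_ennreal[symmetric] mult.assoc)
    qed
    also have "\<dots> = (SUP n. \<integral>\<^sup>+\<omega>. indicator B \<omega> * ennreal (\<xi> \<omega>) * indicator {\<omega>. ereal (c n \<omega>) < \<tau> \<omega>} \<omega> \<partial>Q)"
    proof (rule nn_integral_monotone_convergence_SUP)
      show "incseq (\<lambda>n \<omega>. indicator B \<omega> * ennreal (\<xi> \<omega>) * indicator {\<omega>. ereal (c n \<omega>) < \<tau> \<omega>} \<omega>)"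
      proof (intro incseq_SucI le_funI mult_left_mono)
        fix n \<omega>
        show "indicator {\<omega>. ereal (c n \<omega>) < \<tau> \<omega>} \<omega> \<le> (indicator {\<omega>. ereal (c (Suc n) \<omega>) < \<tau> \<omega>} \<omega> :: ennreal)"
          using survival_grid_incseq[of t n "\<sigma> \<omega>" \<omega>] by (simp add: c_def indicator_def)
      qed simp
    qed measurable
    also have "\<dots> = (SUP n. \<integral>\<^sup>+\<omega>. w \<omega> * indicator B \<omega> * ennreal (\<xi> \<omega>) * disc t (c n \<omega>) \<omega> \<partial>P)" by (simp only: step)
    also have "\<dots> = (\<integral>\<^sup>+\<omega>. (SUP n. w \<omega> * indicator B \<omega> * ennreal (\<xi> \<omega>) * disc t (c n \<omega>) \<omega>) \<partial>P)"
    proof (rule nn_integral_monotone_convergence_SUP[symmetric])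
      show "incseq (\<lambda>n \<omega>. w \<omega> * indicator B \<omega> * ennreal (\<xi> \<omega>) * disc t (c n \<omega>) \<omega>)"
        unfolding c_def by (intro incseq_SucI le_funI mult_left_mono disc_antimono grid_above_Suc) simp
    qed measurable
    also have "\<dots> = (\<integral>\<^sup>+\<omega>. w \<omega> * indicator B \<omega> * (ennreal (\<xi> \<omega>) * expneg (Gamma_diff \<gamma> t (\<sigma> \<omega>) \<omega>)) \<partial>P)"
    proof (rule nn_integral_cong_AE)
      show "AE \<omega> in P. (SUP n. w \<omega> * indicator B \<omega> * ennreal (\<xi> \<omega>) * disc t (c n \<omega>) \<omega>)
        = w \<omega> * indicator B \<omega> * (ennreal (\<xi> \<omega>) * expneg (Gamma_diff \<gamma> t (\<sigma> \<omega>) \<omega>))"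
        using cum_finite_P AE_space
      proof eventually_elim
        case (elim \<omega>)
        then have \<omega>: "\<omega> \<in> space Q" by (simp add: space_P)
        then have "t \<le> \<sigma> \<omega>" "\<sigma> \<omega> \<le> T" using \<sigma>_rng by auto
        from disc_grid_SUP[OF \<omega> t(1) this] elim show ?case
          by (simp add: SUP_mult_left_ennreal[symmetric] c_def disc_def mult.assoc)
      qed
    qed
    finally show "(\<integral>\<^sup>+\<omega>. indicator B \<omega> * (alive t \<omega> * ennreal (\<xi> \<omega> * indicator {\<omega>. ereal (\<sigma> \<omega>) < \<tau> \<omega>} \<omega>)) \<partial>Q)
      = (\<integral>\<^sup>+\<omega>. w \<omega> * indicator B \<omega> * (ennreal (\<xi> \<omega>) * expneg (Gamma_diff \<gamma> t (\<sigma> \<omega>) \<omega>)) \<partial>P)" .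
  qed
qed

end

section \<open>Stieltjes measures of nondecreasing paths and cash flows\<close>

lemma emeasure_interval_measure_before:
  fixes a :: "real \<Rightarrow> real" and \<theta> :: ereal
  assumes mono: "\<And>x y. x \<le> y \<Longrightarrow> a x \<le> a y" and rc: "\<And>x. continuous (at_right x) a"
    and t: "t \<le> T" "ereal t < \<theta>"
  shows "emeasure (interval_measure a) {v. t < v \<and> v \<le> T \<and> ereal v < \<theta>}
    = ennreal ((if ereal T < \<theta> then a T else Lim (at_left (real_of_ereal \<theta>)) a) - a t)"
proof (cases "ereal T < \<theta>")
  case True
  have "ereal v < \<theta>" if "v \<le> T" for v using that True by (meson ereal_less_eq(3) le_less_trans)
  then have "{v. t < v \<and> v \<le> T \<and> ereal v < \<theta>} = {t<..T}" by auto
  then show ?thesis using True emeasure_interval_measure_Ioc[OF t(1) mono rc] by simp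
next
  case False
  then obtain r where r: "\<theta> = ereal r" using t(2) by (cases \<theta>) auto
  have tr: "t < r" "r \<le> T" using t False by (auto simp: r)
  let ?\<mu> = "interval_measure a"
  have set_eq: "{v. t < v \<and> v \<le> T \<and> ereal v < \<theta>} = {t<..<r}" using tr by (auto simp: r)
  have Ioc: "emeasure ?\<mu> {x<..y} = ennreal (a y - a x)" if "x \<le> y" for x y
    by (rule emeasure_interval_measure_Ioc[OF that mono rc])
  have "emeasure ?\<mu> {t<..<r} \<le> emeasure ?\<mu> {t<..r}" by (rule emeasure_mono) auto
  also have "\<dots> < \<infinity>" using tr by (simp add: Ioc)
  finally have fin: "emeasure ?\<mu> {t<..<r} < \<infinity>" .
  \<comment> \<open>Continuity of the measure from below along times increasing to r yields the left
    limit of a at r and its value together; the mass of (t, r) is then a(r-) - a(t), the increment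
    of a path stopped just before r.\<close>
  have "(a \<longlongrightarrow> a t + measure ?\<mu> {t<..<r}) (at_left r)"
  proof (rule tendsto_at_left_sequentially[OF tr(1)])
    fix S :: "nat \<Rightarrow> real"
    assume S: "\<And>n. S n < r" "\<And>n. t < S n" "incseq S" "S \<longlonglongrightarrow> r"
    have "(\<Union>n. {t<..S n}) = {t<..<r}"
    proof (intro subset_antisym subsetI)
      fix x assume "x \<in> {t<..<r}"
      then have "\<forall>\<^sub>F n in sequentially. x < S n" using S(4) by (intro order_tendstoD) auto
      then obtain n where "x < S n" unfolding eventually_sequentially by blast
      then show "x \<in> (\<Union>n. {t<..S n})" using \<open>x \<in> {t<..<r}\<close> by (auto intro: less_imp_le)
    qed (use S(1) in \<open>auto intro: le_less_trans\<close>)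
    moreover have "(\<lambda>n. emeasure ?\<mu> {t<..S n}) \<longlonglongrightarrow> emeasure ?\<mu> (\<Union>n. {t<..S n})"
    proof (rule Lim_emeasure_incseq)
      show "incseq (\<lambda>n. {t<..S n})" using S(3) unfolding incseq_def by fastforce
    qed auto
    moreover have "emeasure ?\<mu> {t<..S n} = ennreal (a (S n) - a t)" for n by (rule Ioc[OF less_imp_le[OF S(2)]])
    moreover have "emeasure ?\<mu> {t<..<r} = ennreal (measure ?\<mu> {t<..<r})"
      using fin by (intro emeasure_eq_ennreal_measure) simp
    ultimately have "(\<lambda>n. ennreal (a (S n) - a t)) \<longlonglongrightarrow> ennreal (measure ?\<mu> {t<..<r})"
      by (simp only:)
    then have "(\<lambda>n. a (S n) - a t) \<longlonglongrightarrow> measure ?\<mu> {t<..<r}"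
      by (rule tendsto_ennrealD) (use mono S(2) in \<open>auto intro!: always_eventually less_imp_le simp: less_imp_le\<close>)
    from tendsto_add[OF tendsto_const this, of "a t"] show "(\<lambda>n. a (S n)) \<longlonglongrightarrow> a t + measure ?\<mu> {t<..<r}" by simp
  qed
  then have "Lim (at_left r) a = a t + measure ?\<mu> {t<..<r}" by (rule tendsto_Lim[OF trivial_limit_at_left_real])
  moreover have "emeasure ?\<mu> {t<..<r} = ennreal (measure ?\<mu> {t<..<r})"
    using fin by (intro emeasure_eq_ennreal_measure) simp
  ultimately show ?thesis unfolding set_eq using False by (simp add: r)
qed

lemma grid_index_measurable[measurable]: "grid_index n \<in> measurable borel (count_space UNIV)"
  unfolding grid_index_def by measurable

lemma nn_integral_interval_measure_grid:
  fixes a :: "real \<Rightarrow> real" and h :: "nat \<Rightarrow> ennreal"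
  assumes mono: "\<And>x y. x \<le> y \<Longrightarrow> a x \<le> a y" and rc: "\<And>x. continuous (at_right x) a"
    and t: "0 \<le> t" "t \<le> T"
  shows "(\<integral>\<^sup>+v\<in>{t<..T}. h (grid_index n v) \<partial>interval_measure a)
    = (\<Sum>k\<le>grid_index n T. h k * ennreal (a (grid_point t T n k) - a (grid_point t T n (k - 1))))"
proof -
  let ?s = "grid_point t T n"
  have le: "?s (k - 1) \<le> ?s k" for k
    unfolding grid_point_def by (intro max.mono min.mono order_refl divide_right_mono) auto
  have "(\<integral>\<^sup>+v\<in>{t<..T}. h (grid_index n v) \<partial>interval_measure a)
    = (\<integral>\<^sup>+v. (\<Sum>k\<le>grid_index n T. h k * indicator {?s (k - 1)<..?s k} v) \<partial>interval_measure a)"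
  proof (rule nn_integral_cong)
    fix v
    show "h (grid_index n v) * indicator {t<..T} v = (\<Sum>k\<le>grid_index n T. h k * indicator {?s (k - 1)<..?s k} v)"
    proof (cases "t < v \<and> v \<le> T")
      case True
      have "(\<Sum>k\<le>grid_index n T. h k * indicator {?s (k - 1)<..?s k} v) = (\<Sum>k\<le>grid_index n T. if grid_index n v = k then h k else 0)"
        unfolding grid_cell[OF t, symmetric] using True by (intro sum.cong) (auto simp: indicator_def)
      also have "\<dots> = h (grid_index n v)" using sum_over_grid[of v T n h] True by blast
      finally show ?thesis using True by simp
    next
      case False
      then show ?thesis unfolding grid_cell[OF t, symmetric] by (auto simp: indicator_def)
    qed
  qed
  also have "\<dots> = (\<Sum>k\<le>grid_index n T. \<integral>\<^sup>+v. h k * indicator {?s (k - 1)<..?s k} v \<partial>interval_measure a)"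
    by (rule nn_integral_sum) simp
  also have "\<dots> = (\<Sum>k\<le>grid_index n T. h k * ennreal (a (?s k) - a (?s (k - 1))))"
    using emeasure_interval_measure_Ioc[OF le mono rc] by (intro sum.cong) (simp_all add: nn_integral_cmult_indicator)
  finally show ?thesis .
qed

lemma nn_integral_interval_measure_SUP:
  fixes h :: "nat \<Rightarrow> nat \<Rightarrow> ennreal"
  assumes inc: "\<And>n v. t < v \<Longrightarrow> v \<le> T \<Longrightarrow> h n (grid_index n v) \<le> h (Suc n) (grid_index (Suc n) v)"
    and sup: "\<And>v. t < v \<Longrightarrow> v \<le> T \<Longrightarrow> (SUP n. h n (grid_index n v)) = H v"
  shows "(SUP n. \<integral>\<^sup>+v\<in>{t<..T}. h n (grid_index n v) \<partial>interval_measure a) = (\<integral>\<^sup>+v\<in>{t<..T}. H v \<partial>interval_measure a)"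
    and "(\<integral>\<^sup>+v\<in>{t<..T}. h n (grid_index n v) \<partial>interval_measure a) \<le> (\<integral>\<^sup>+v\<in>{t<..T}. h (Suc n) (grid_index (Suc n) v) \<partial>interval_measure a)"
proof -
  have [measurable]: "(\<lambda>v. h n (grid_index n v)) \<in> borel_measurable borel" for n
    by (rule measurable_compose[OF grid_index_measurable]) simp
  have incseq: "incseq (\<lambda>n v. h n (grid_index n v) * indicator {t<..T} v)"
    by (intro incseq_SucI le_funI) (use inc in \<open>auto simp: indicator_def\<close>)
  have "(SUP n. \<integral>\<^sup>+v\<in>{t<..T}. h n (grid_index n v) \<partial>interval_measure a)
    = (\<integral>\<^sup>+v. (SUP n. h n (grid_index n v) * indicator {t<..T} v) \<partial>interval_measure a)"
    by (rule nn_integral_monotone_convergence_SUP[OF incseq, symmetric]) measurable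
  also have "\<dots> = (\<integral>\<^sup>+v\<in>{t<..T}. H v \<partial>interval_measure a)"
    by (rule nn_integral_cong) (auto simp: indicator_def sup)
  finally show "(SUP n. \<integral>\<^sup>+v\<in>{t<..T}. h n (grid_index n v) \<partial>interval_measure a) = (\<integral>\<^sup>+v\<in>{t<..T}. H v \<partial>interval_measure a)" .
  show "(\<integral>\<^sup>+v\<in>{t<..T}. h n (grid_index n v) \<partial>interval_measure a) \<le> (\<integral>\<^sup>+v\<in>{t<..T}. h (Suc n) (grid_index (Suc n) v) \<partial>interval_measure a)"
    using incseq_SucD[OF incseq, of n] by (intro nn_integral_mono) (auto simp: le_fun_def)
qed

context invariance_time
begin

text \<open>By the usual conditions every subset of a null set is an event, so changing a function
  on a null set keeps it measurable.\<close>

lemma borel_measurable_AE_eq: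
  fixes f h :: "'a \<Rightarrow> ennreal"
  assumes eq: "AE \<omega> in Q. f \<omega> = h \<omega>" and h: "h \<in> borel_measurable Q"
  shows "f \<in> borel_measurable Q"
proof -
  obtain N where N: "{\<omega>\<in>space Q. f \<omega> \<noteq> h \<omega>} \<subseteq> N" "emeasure Q N = 0" "N \<in> sets Q" using eq by (auto elim: AE_E)
  have null: "A \<in> sets Q" if "A \<subseteq> N" "A \<subseteq> space Q" for A
  proof (rule filtration_on_sets[OF F_filt order_refl])
    have "N \<in> null_sets Q" using N by auto
    then show "A \<in> sets (F 0)" using F that unfolding usual_conditions_def by blast
  qed
  show ?thesis
  proof (rule measurableI)
    fix A :: "ennreal set" assume A: "A \<in> sets borel"
    have split: "f -` A \<inter> space Q = (f -` A \<inter> space Q \<inter> N) \<union> (h -` A \<inter> space Q - N)" using N(1) by auto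
    have "f -` A \<inter> space Q \<inter> N \<in> sets Q" by (rule null) auto
    moreover have "h -` A \<inter> space Q - N \<in> sets Q" using measurable_sets[OF h A] N(3) by simp
    ultimately show "f -` A \<inter> space Q \<in> sets Q" by (subst split) (rule sets.Un)
  qed simp
qed

text \<open>The flow on each grid cell is paid at the right end of the cell, where its amount is
  known. Under Q the sums increase to the mass that the path of A gives to the times in (t, T]
  before \<tau>, the increment of A stopped before \<tau>; under P they increase to the discounted
  Stieltjes integral.\<close>

lemma cash_flow_formula:
  assumes t: "0 \<le> t" "t \<le> T"
    and A_opt: "optional Q F A"
    and A_mono: "\<forall>\<omega>\<in>space Q. mono_on {0..} (\<lambda>s. A s \<omega>)"
    and A_rc: "\<forall>\<omega>\<in>space Q. \<forall>s\<ge>0. continuous (at_right s) (\<lambda>u. A u \<omega>)"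
  shows "AE \<omega> in Q. ereal t < \<tau> \<omega> \<longrightarrow>
    nn_cond_exp Q (G t) (\<lambda>\<omega>. ennreal (stopped_left A \<tau> T \<omega> - stopped_left A \<tau> t \<omega>)) \<omega>
    = nn_cond_exp P (F t) (\<lambda>\<omega>. \<integral>\<^sup>+ s\<in>{t<..T}. expneg (Gamma_diff \<gamma> t s \<omega>) \<partial>(interval_measure (\<lambda>u. A (max 0 u) \<omega>))) \<omega>"
proof -
  obtain w where w: "survival_weight t w"
    using survival_weight_exists[OF t] by blast
  \<comment> \<open>Extending A by its value at 0 to negative times makes the path nondecreasing and
    right continuous on the whole line, as required of a Stieltjes distribution function.\<close>
  define \<mu> where "\<mu> \<omega> = interval_measure (\<lambda>u. A (max 0 u) \<omega>)" for \<omega>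
  have path_mono: "A (max 0 x) \<omega> \<le> A (max 0 y) \<omega>" if "\<omega> \<in> space Q" "x \<le> y" for \<omega> x y
  proof -
    have "mono_on {0..} (\<lambda>s. A s \<omega>)" using A_mono that(1) by blast
    then show ?thesis by (rule mono_onD) (use that in auto)
  qed
  have path_rc: "continuous (at_right x) (\<lambda>u. A (max 0 u) \<omega>)" if "\<omega> \<in> space Q" for \<omega> x
  proof (cases "0 \<le> x")
    case True
    have "((\<lambda>u. A u \<omega>) \<longlongrightarrow> A x \<omega>) (at_right x)" using A_rc that True by (simp add: continuous_within)
    moreover have "\<forall>\<^sub>F u in at_right x. A u \<omega> = A (max 0 u) \<omega>"
      unfolding eventually_at_right_field using True by (intro exI[of _ "x + 1"]) auto
    ultimately have "((\<lambda>u. A (max 0 u) \<omega>) \<longlongrightarrow> A x \<omega>) (at_right x)" by (rule Lim_transform_eventually)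
    then show ?thesis using True by (simp add: continuous_within)
  next
    case False
    have "\<forall>\<^sub>F u in at_right x. A 0 \<omega> = A (max 0 u) \<omega>"
      unfolding eventually_at_right_field using False by (intro exI[of _ 0]) auto
    then have "((\<lambda>u. A (max 0 u) \<omega>) \<longlongrightarrow> A 0 \<omega>) (at_right x)" by (rule Lim_transform_eventually[OF tendsto_const])
    then show ?thesis using False by (simp add: continuous_within)
  qed
  define s where "s n k = grid_point t T n k" for n k
  have s: "0 \<le> s n k" "t \<le> s n k" "s n k \<le> T" for n k using grid_point_in[OF t(2), of n k] t by (auto simp: s_def)
  define a where "a n k \<omega> = ennreal (A (s n k) \<omega> - A (s n (k - 1)) \<omega>)" for n k \<omega>
  have a_F: "a n k \<in> borel_measurable (F (s n k))" for n k
  proof -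
    have "s n (k - 1) \<le> s n k"
      unfolding s_def grid_point_def by (intro max.mono min.mono order_refl divide_right_mono) auto
    then have "A (s n (k - 1)) \<in> borel_measurable (F (s n k))"
      by (rule filtration_on_borel_mono[OF F_filt s(1) _ optional_adapted[OF F_filt A_opt s(1)]])
    moreover have "A (s n k) \<in> borel_measurable (F (s n k))" by (rule optional_adapted[OF F_filt A_opt s(1)])
    ultimately show ?thesis unfolding a_def by measurable
  qed
  have a_Q[measurable]: "a n k \<in> borel_measurable Q" for n k by (rule measurable_from_subalg[OF F_sub[OF s(1)] a_F])
  have disc_Q[measurable]: "disc t (s n k) \<in> borel_measurable Q" for n k
    using jointly_measurable_compose[OF disc_joint[OF t(1)] measurable_const measurable_ident_sets[OF refl], of "s n k"] s(3)[of n k]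
    by (simp add: min.absorb2)
  define fs where "fs n \<omega> = (\<Sum>k\<le>grid_index n T. alive (s n k) \<omega> * a n k \<omega>)" for n \<omega>
  define gs where "gs n \<omega> = (\<Sum>k\<le>grid_index n T. a n k \<omega> * disc t (s n k) \<omega>)" for n \<omega>
  have fs_Q[measurable]: "fs n \<in> borel_measurable Q" for n unfolding fs_def by measurable
  have gs_Q[measurable]: "gs n \<in> borel_measurable Q" for n unfolding gs_def by measurable
  define f where "f \<omega> = ennreal (stopped_left A \<tau> T \<omega> - stopped_left A \<tau> t \<omega>)" for \<omega>
  define g where "g \<omega> = (\<integral>\<^sup>+ s\<in>{t<..T}. expneg (Gamma_diff \<gamma> t s \<omega>) \<partial>\<mu> \<omega>)" for \<omega>
  have grid_sum: "(\<integral>\<^sup>+v\<in>{t<..T}. h (grid_index n v) \<partial>\<mu> \<omega>) = (\<Sum>k\<le>grid_index n T. h k * a n k \<omega>)" if "\<omega> \<in> space Q" for h n \<omega>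
  proof -
    have "max 0 (s n k) = s n k" for k using s(1) by (simp add: max_def)
    then show ?thesis
      using nn_integral_interval_measure_grid[OF path_mono[OF that] path_rc[OF that] t, of h n]
      by (simp add: \<mu>_def a_def s_def)
  qed
  have fs_limit: "(SUP n. fs n \<omega>) = f \<omega>" "fs n \<omega> \<le> fs (Suc n) \<omega>" if \<omega>: "\<omega> \<in> space Q" for \<omega> n
  proof -
    define h where "h n k = (alive (s n k) \<omega> :: ennreal)" for n k
    have fs_eq: "fs n \<omega> = (\<integral>\<^sup>+v\<in>{t<..T}. h n (grid_index n v) \<partial>\<mu> \<omega>)" for n
      unfolding grid_sum[OF \<omega>] by (simp add: fs_def h_def)
    have h_above: "h n (grid_index n v) = alive (grid_above t T n v) \<omega>" for n v
      by (simp add: h_def s_def grid_above_def)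
    have inc: "h n (grid_index n v) \<le> h (Suc n) (grid_index (Suc n) v)" for n v
      unfolding h_above by (rule survival_grid_incseq)
    have sup: "(SUP n. h n (grid_index n v)) = alive v \<omega>" if "t < v" "v \<le> T" for v
      unfolding h_above by (rule survival_grid_SUP[OF t(1)]) (use that in auto)
    show "fs n \<omega> \<le> fs (Suc n) \<omega>"
      unfolding fs_eq \<mu>_def by (rule nn_integral_interval_measure_SUP(2)[where h = h, OF inc sup])
    have "(SUP n. fs n \<omega>) = (\<integral>\<^sup>+v\<in>{t<..T}. alive v \<omega> \<partial>\<mu> \<omega>)"
      unfolding fs_eq \<mu>_def by (rule nn_integral_interval_measure_SUP(1)[where h = h, OF inc sup])
    also have "\<dots> = (\<integral>\<^sup>+v. indicator {v. t < v \<and> v \<le> T \<and> ereal v < \<tau> \<omega>} v \<partial>\<mu> \<omega>)"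
      by (intro nn_integral_cong) (auto simp: indicator_def)
    also have "\<dots> = emeasure (\<mu> \<omega>) {v. t < v \<and> v \<le> T \<and> ereal v < \<tau> \<omega>}"
      by (rule nn_integral_indicator) (simp add: \<mu>_def)
    also have "\<dots> = f \<omega>"
    proof (cases "ereal t < \<tau> \<omega>")
      case True
      have "emeasure (\<mu> \<omega>) {v. t < v \<and> v \<le> T \<and> ereal v < \<tau> \<omega>}
        = ennreal ((if ereal T < \<tau> \<omega> then A (max 0 T) \<omega> else Lim (at_left (real_of_ereal (\<tau> \<omega>))) (\<lambda>u. A (max 0 u) \<omega>)) - A (max 0 t) \<omega>)"
        unfolding \<mu>_def by (rule emeasure_interval_measure_before[OF path_mono[OF \<omega>] path_rc[OF \<omega>] t(2) True])
      moreover have "Lim (at_left (real_of_ereal (\<tau> \<omega>))) (\<lambda>u. A (max 0 u) \<omega>) = Lim (at_left (real_of_ereal (\<tau> \<omega>))) (\<lambda>u. A u \<omega>)"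
        if "\<not> ereal T < \<tau> \<omega>"
      proof -
        have "0 < real_of_ereal (\<tau> \<omega>)" using real_tau(1)[OF \<omega>, of T] that by (simp add: not_less)
        then have "\<forall>\<^sub>F u in at_left (real_of_ereal (\<tau> \<omega>)). A (max 0 u) \<omega> = A u \<omega>"
          unfolding eventually_at_left_field by (intro exI[of _ 0]) auto
        then have "((\<lambda>u. A (max 0 u) \<omega>) \<longlongrightarrow> l) (at_left (real_of_ereal (\<tau> \<omega>)))
          \<longleftrightarrow> ((\<lambda>u. A u \<omega>) \<longlongrightarrow> l) (at_left (real_of_ereal (\<tau> \<omega>)))" for l
          by (rule tendsto_cong)
        then show ?thesis unfolding Topological_Spaces.Lim_def by (simp only:)
      qed
      moreover have "max 0 T = T" "max 0 t = t" "\<tau> \<omega> \<noteq> 0" using t True by auto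
      ultimately show ?thesis using True by (cases "ereal T < \<tau> \<omega>") (simp_all add: f_def stopped_left_def)
    next
      case False
      then have empty: "{v. t < v \<and> v \<le> T \<and> ereal v < \<tau> \<omega>} = {}"
        by (metis (mono_tags, lifting) Collect_empty_eq less_ereal.simps(1) less_trans)
      have "\<not> ereal T < \<tau> \<omega>" using False t(2) by (meson ereal_less_eq(3) le_less_trans)
      then show ?thesis unfolding empty using False by (simp add: f_def stopped_left_def)
    qed
    finally show "(SUP n. fs n \<omega>) = f \<omega>" .
  qed
  have gs_eq: "gs n \<omega> = (\<integral>\<^sup>+v\<in>{t<..T}. disc t (s n (grid_index n v)) \<omega> \<partial>\<mu> \<omega>)" if "\<omega> \<in> space Q" for n \<omega>
    using grid_sum[OF that, of "\<lambda>k. disc t (s n k) \<omega>" n] by (simp add: gs_def mult.commute)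
  have disc_above: "disc t (s n (grid_index n v)) \<omega> = disc t (grid_above t T n v) \<omega>" for n v \<omega>
    by (simp add: s_def grid_above_def)
  have gs_limit: "(SUP n. gs n \<omega>) = g \<omega>" "gs n \<omega> \<le> gs (Suc n) \<omega>" if \<omega>: "\<omega> \<in> space Q" and fin: "\<forall>s\<le>T. cum s \<omega> < \<infinity>" for \<omega> n
  proof -
    have inc: "disc t (s n (grid_index n v)) \<omega> \<le> disc t (s (Suc n) (grid_index (Suc n) v)) \<omega>" for n v
      unfolding disc_above by (rule disc_antimono[OF grid_above_Suc])
    have sup: "(SUP n. disc t (s n (grid_index n v)) \<omega>) = disc t v \<omega>" if "t < v" "v \<le> T" for v
      unfolding disc_above by (rule disc_grid_SUP[OF \<omega> t(1) _ _ fin]) (use that in auto)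
    show "gs n \<omega> \<le> gs (Suc n) \<omega>"
      unfolding gs_eq[OF \<omega>] \<mu>_def
      by (rule nn_integral_interval_measure_SUP(2)[where h = "\<lambda>n k. disc t (s n k) \<omega>", OF inc sup])
    show "(SUP n. gs n \<omega>) = g \<omega>"
      unfolding gs_eq[OF \<omega>] \<mu>_def g_def disc_def[symmetric]
      by (rule nn_integral_interval_measure_SUP(1)[where h = "\<lambda>n k. disc t (s n k) \<omega>", OF inc sup])
  qed
  have f_Q: "f \<in> borel_measurable Q"
  proof -
    have "(\<lambda>\<omega>. SUP n. fs n \<omega>) \<in> borel_measurable Q" by measurable
    then show ?thesis by (subst measurable_cong[where g = "\<lambda>\<omega>. SUP n. fs n \<omega>"]) (simp_all add: fs_limit)
  qed
  \<comment> \<open>The discretized sums are known to converge to g only where \<Gamma> is finite,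
    so measurability of g comes from an almost sure limit.\<close>
  have g_Q: "g \<in> borel_measurable Q"
  proof (rule borel_measurable_AE_eq)
    show "AE \<omega> in Q. g \<omega> = (SUP n. gs n \<omega>)"
      using cum_finite AE_space by eventually_elim (simp add: gs_limit)
  qed measurable
  show ?thesis
    unfolding f_def[symmetric] \<mu>_def[symmetric] g_def[symmetric]
  proof (rule cond_exp_eq_before_tau[OF t w f_Q g_Q])
    fix B assume B: "B \<in> sets (F t)"
    have B_Q[measurable]: "B \<in> sets Q" using filtration_on_sets[OF F_filt t(1) B] .
    have B_P[measurable]: "B \<in> sets P" using B_Q P(2) by simp
    have [measurable]: "w \<in> borel_measurable P" by (rule measurable_from_subalg[OF F_sub_P[OF t(1)] survival_weight_measurable[OF w]])
    have [measurable]: "gs n \<in> borel_measurable P" for n using gs_Q by (simp add: borel_P)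
    have "(\<integral>\<^sup>+\<omega>. indicator B \<omega> * (alive t \<omega> * f \<omega>) \<partial>Q) = (\<integral>\<^sup>+\<omega>. (SUP n. indicator B \<omega> * fs n \<omega>) \<partial>Q)"
    proof (rule nn_integral_cong)
      fix \<omega> assume \<omega>: "\<omega> \<in> space Q"
      \<comment> \<open>On {\<tau> \<le> t} the stopped process has already stopped moving, so f is
        0 and the indicator of survival changes nothing.\<close>
      have "alive t \<omega> * f \<omega> = f \<omega>"
      proof (cases "ereal t < \<tau> \<omega>")
        case False
        then have "\<not> ereal T < \<tau> \<omega>" using t(2) by (meson ereal_less_eq(3) le_less_trans)
        then show ?thesis using False by (simp add: f_def stopped_left_def)
      qed simp
      then show "indicator B \<omega> * (alive t \<omega> * f \<omega>) = (SUP n. indicator B \<omega> * fs n \<omega>)"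
        by (simp only: SUP_mult_left_ennreal[symmetric] fs_limit(1)[OF \<omega>])
    qed
    also have "\<dots> = (SUP n. \<integral>\<^sup>+\<omega>. indicator B \<omega> * fs n \<omega> \<partial>Q)"
      by (rule nn_integral_monotone_convergence_SUP_AE) (auto intro!: AE_I2 mult_left_mono fs_limit(2))
    also have "\<dots> = (SUP n. \<integral>\<^sup>+\<omega>. w \<omega> * indicator B \<omega> * gs n \<omega> \<partial>P)"
      unfolding fs_def gs_def s_def
      by (intro SUP_cong refl survival_formula_grid[OF t w B] a_F[unfolded s_def])
    also have "\<dots> = (\<integral>\<^sup>+\<omega>. (SUP n. w \<omega> * indicator B \<omega> * gs n \<omega>) \<partial>P)"
    proof (rule nn_integral_monotone_convergence_SUP_AE[symmetric])
      show "AE \<omega> in P. w \<omega> * indicator B \<omega> * gs n \<omega> \<le> w \<omega> * indicator B \<omega> * gs (Suc n) \<omega>" for n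
        using cum_finite_P AE_space by eventually_elim (auto intro!: mult_left_mono gs_limit(2) simp: space_P)
    qed measurable
    also have "\<dots> = (\<integral>\<^sup>+\<omega>. w \<omega> * indicator B \<omega> * g \<omega> \<partial>P)"
    proof (rule nn_integral_cong_AE)
      show "AE \<omega> in P. (SUP n. w \<omega> * indicator B \<omega> * gs n \<omega>) = w \<omega> * indicator B \<omega> * g \<omega>"
        using cum_finite_P AE_space
        by eventually_elim (simp add: SUP_mult_left_ennreal[symmetric] gs_limit(1) space_P)
    qed
    finally show "(\<integral>\<^sup>+\<omega>. indicator B \<omega> * (alive t \<omega> * f \<omega>) \<partial>Q) = (\<integral>\<^sup>+\<omega>. w \<omega> * indicator B \<omega> * g \<omega> \<partial>P)" .
  qed
qed

end

theorem theorem3p1: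
  fixes Q P :: "'a measure"
    and G F :: "real \<Rightarrow> 'a measure"
    and \<tau> :: "'a \<Rightarrow> ereal"
    and \<gamma> K A :: "real \<Rightarrow> 'a \<Rightarrow> real"
    and T t :: real
    and \<sigma> \<xi> :: "'a \<Rightarrow> real"
  assumes Q: "prob_space Q"
    and G: "usual_conditions Q G"
    and F: "usual_conditions Q F"
    and FG: "\<forall>s\<ge>0. sets (F s) \<subseteq> sets (G s)"
    and tau_st: "stopping_time_on G \<tau>"
    and tau_pos: "\<forall>\<omega>\<in>space Q. 0 < \<tau> \<omega>"
    and key: "\<forall>s\<ge>0. \<forall>B\<in>sets (G s). \<exists>B'\<in>sets (F s).
               B \<inter> {\<omega>. ereal s < \<tau> \<omega>} = B' \<inter> {\<omega>. ereal s < \<tau> \<omega>}"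
    and T_pos: "0 < T"
    and gamma_nn: "\<forall>s \<omega>. 0 \<le> \<gamma> s \<omega>"
    and gamma_pred: "predictable Q F \<gamma>"
    and Ca: "has_intensity Q G \<tau> \<gamma>"
    and Cb: "AE \<omega> in Q. 0 < real_cond_exp Q (F T) (\<lambda>\<omega>. indicator {\<omega>. ereal T < \<tau> \<omega>} \<omega>) \<omega>"
    and P: "prob_space P" "sets P = sets Q"
    and P_equiv: "\<forall>B\<in>sets (F T). emeasure P B = 0 \<longleftrightarrow> emeasure Q B = 0"
    and Cc: "\<forall>X. local_martingale P F X \<longrightarrow> local_martingale_upto Q G (stopped_left X \<tau>) T"
    and t: "0 \<le> t" "t \<le> T"
    and sigma_st: "stopping_time_on F (\<lambda>\<omega>. ereal (\<sigma> \<omega>))"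
    and sigma_rng: "\<forall>\<omega>\<in>space Q. t \<le> \<sigma> \<omega> \<and> \<sigma> \<omega> \<le> T"
    and chi_nn: "\<forall>\<omega>\<in>space Q. 0 \<le> \<xi> \<omega>"
    and chi_meas: "\<xi> \<in> borel_measurable (stopped_sigma Q F (\<lambda>\<omega>. ereal (\<sigma> \<omega>)))"
    and K_nn: "\<forall>s \<omega>. 0 \<le> K s \<omega>"
    and K_pred: "predictable Q F K"
    and A_opt: "optional Q F A"
    and A_mono: "\<forall>\<omega>\<in>space Q. mono_on {0..} (\<lambda>s. A s \<omega>)"
    and A_rc: "\<forall>\<omega>\<in>space Q. \<forall>s\<ge>0. continuous (at_right s) (\<lambda>u. A u \<omega>)"
    and A0: "\<forall>\<omega>\<in>space Q. A 0 \<omega> = 0"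
  shows "(AE \<omega> in Q. ereal t < \<tau> \<omega> \<longrightarrow>
           nn_cond_exp Q (G t) (\<lambda>\<omega>. ennreal (\<xi> \<omega> * indicator {\<omega>. ereal (\<sigma> \<omega>) < \<tau> \<omega>} \<omega>)) \<omega>
           = nn_cond_exp P (F t) (\<lambda>\<omega>. ennreal (\<xi> \<omega>) * expneg (Gamma_diff \<gamma> t (\<sigma> \<omega>) \<omega>)) \<omega>) \<and>
    (AE \<omega> in Q. ereal t < \<tau> \<omega> \<longrightarrow>
           nn_cond_exp Q (G t) (\<lambda>\<omega>. ennreal (if \<tau> \<omega> \<le> ereal T then K (real_of_ereal (\<tau> \<omega>)) \<omega> else 0)) \<omega>
           = nn_cond_exp P (F t) (\<lambda>\<omega>. \<integral>\<^sup>+ s\<in>{t..T}.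
                ennreal (K s \<omega>) * expneg (Gamma_diff \<gamma> t s \<omega>) * ennreal (\<gamma> s \<omega>) \<partial>lborel) \<omega>) \<and>
    (AE \<omega> in Q. ereal t < \<tau> \<omega> \<longrightarrow>
           nn_cond_exp Q (G t) (\<lambda>\<omega>. ennreal (stopped_left A \<tau> T \<omega> - stopped_left A \<tau> t \<omega>)) \<omega>
           = indicator {\<omega>. ereal t < \<tau> \<omega>} \<omega> * nn_cond_exp P (F t) (\<lambda>\<omega>. \<integral>\<^sup>+ s\<in>{t<..T}.
                expneg (Gamma_diff \<gamma> t s \<omega>) \<partial>(interval_measure (\<lambda>u. A (max 0 u) \<omega>))) \<omega>)"
proof -
  interpret invariance_time Q P G F \<tau> \<gamma> T
    by (rule invariance_time.intro) fact+
  show ?thesis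
    \<comment> \<open>The third formula is claimed on {t < \<tau>}, where the indicator in front of
      its right-hand side equals 1.\<close>
    using terminal_payment_formula[OF t sigma_st sigma_rng chi_nn chi_meas]
      default_payment_formula[OF t K_nn K_pred] cash_flow_formula[OF t A_opt A_mono A_rc]
    by (auto elim: eventually_mono)
qed

end
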